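(* Let $N\in\mathrm{Net}_{I,J}$, let $A\in GL_n$, let $N(A)$ be a network representing $A$ obtained by concatenation of elementary networks, and let $N\circ N(A)$ be the concatenation of $N$ and $N(A)$ described in the context. Then the matrices $\bar X_{N\circ N(A)}$ and $\bar X_NA$ are representatives of the same element in the Grassmannian $G_k(n)$.
   Context: **Networks.** $I\cup J=\{1,\dots,n\}$ is a partition, $I=\{i_1<\dots<i_k\}$. $\mathrm{Net}_{I,J}$ is the set of perfect planar networks in a disk: directed planar graphs without loops and parallel edges, with nonzero edge weights $w_e$, with $n$ boundary vertices $b_1,\dots,b_n$ labelled counterclockwise, $b_i$ being a source (exactly one outgoing edge, no incoming edges) for $i\in I$ and a sink (exactly one incoming edge, no outgoing edges) for $i\in J$, all internal vertices having degree 3 and being white (exactly one incoming edge) or black (exactly one outgoing edge). **Boundary measurements.** For a closed oriented polygonal plane curve $C$ (collinear consecutive segments having the same direction) and an oriented line $l$ not collinear to any segment of $C$, let $c(C)\in\mathbb Z/2\mathbb Z$ be the number mod 2 of pairs $(e',e'')$ of consecutive segments such that the direction vector of $l$ lies in the interior of the cone spanned by $e',e''$ (independent of $l$). Draw the network with straight edges and all internal vertices in the interior of the convex hull of the boundary vertices. For a path $P$ from a source $b_i$ to a sink $b_j$, $C_P$ is obtained by adding to $P$ the path from $b_j$ to $b_i$ going counterclockwise along the boundary of the convex hull, and $w_P=(-1)^{c(C_P)-1}\prod_{e\in P}w_e$. $M(i,j)$ is the sum of $w_P$ over all paths from $b_i$ to $b_j$; this formal series represents a rational function of the edge weights. **The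 matrix $\bar X_N$.** $\bar X_N$ is the $k\times n$ matrix whose columns indexed by $I$ form the identity matrix and whose $(p,j)$-entry for $j\in J$ is $(-1)^{s(p,j)}M(i_p,j)$, where $s(p,j)$ is the number of elements of $I$ lying strictly between $\min\{i_p,j\}$ and $\max\{i_p,j\}$. Its row span is an element of $G_k(n)$. **Networks representing matrices.** Elementary networks are drawn in a square, with sources $1,\dots,n$ on the left side and sinks $1,\dots,n$ on the right side, both labelled from bottom to top, with horizontal paths $j\to j$ directed from left to right. They are: (a) the network of $\mathrm{diag}(d_1,\dots,d_n)$, $d_j\neq0$: only the horizontal paths, the $j$th having weight $d_j$; (b) the network of $E_i^-(l)=\mathbf 1+l\,e_{i,i-1}$: horizontal paths with all weights $1$ and one additional edge of weight $l$ directed from the $i$th horizontal path to the $(i-1)$st; (c) the network of $E_j^+(u)=\mathbf 1+u\,e_{j-1,j}$: horizontal paths with all weights $1$ and one additional edge of weight $u$ directed from the $(j-1)$st horizontal path to the $j$th. Concatenation glues the right side of one square to the left side of the next (glued edges merge, weights multiply) and corresponds to the matrix product. Every $A\in GL_n$ is a product of such elementary matrices; $N(A)$ is the corresponding concatenation. **The network $N\circ N(A)$.** In $N(A)$ reverse the directions of all horizontal paths $i\to i$ for $i\in I$, changing every edge weight $w$ on these paths to $w^{-1}$, and then glue the left side of $N(A)$ to the boundary of $N$ so that boundary vertices with the same label are glued to each other. The boundary vertices of the resulting network are those on the right side of $N(A)$, with the same labels; it belongs to the class of networks with source set $I$ and sink set $J$. *)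

theory Defs
  imports
    "HOL-Analysis.Analysis"
    "HOL-Library.Poly_Mapping"
    "Jordan_Normal_Form.VS_Connect"
begin

section \<open>Drawn weighted graphs\<close>

text \<open>
  A weighted directed graph is given by a drawing in the plane: an edge is a pair consisting of the
  polygonal arc along which it is drawn (list of successive points, the first one being the tail
  and the last one the head of the edge) and its weight. The vertices are the end points of the
  arcs; straight edges are the arcs with two points.

  Labels of boundary vertices, and rows and columns of matrices, are counted from \<open>0\<close>: the
  label \<open>i\<close> below is the label \<open>i + 1\<close> in the usual numbering.
\<close>

type_synonym 'k edge = "complex list \<times> 'k"

abbreviation tail :: "'k edge \<Rightarrow> complex" where
  "tail e \<equiv> hd (fst e)"

abbreviation head :: "'k edge \<Rightarrow> complex" where
  "head e \<equiv> last (fst e)"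

definition polyline :: "complex list \<Rightarrow> complex set" where
  "polyline r = (\<Union>t\<in>{t. Suc t < length r}. closed_segment (r ! t) (r ! Suc t))"

definition simple_arc :: "complex list \<Rightarrow> bool" where
  "simple_arc r \<longleftrightarrow> 2 \<le> length r \<and> distinct r \<and>
     (\<forall>s t. s < t \<and> Suc t < length r \<longrightarrow>
        closed_segment (r ! s) (r ! Suc s) \<inter> closed_segment (r ! t) (r ! Suc t)
          \<subseteq> (if t = Suc s then {r ! t} else {}))"

text \<open>Walks may repeat vertices and edges.\<close>

definition walk :: "'k edge set \<Rightarrow> 'k edge list \<Rightarrow> bool" where
  "walk E P \<longleftrightarrow> P \<noteq> [] \<and> set P \<subseteq> E \<and> successively (\<lambda>e f. head e = tail f) P"

definition route :: "'k edge list \<Rightarrow> complex list" where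
  "route P = tail (hd P) # concat (map (\<lambda>e. tl (fst e)) P)"

section \<open>Perfect planar networks in a disk\<close>

text \<open>
  The disk is a convex polygon, given by its corners in counterclockwise order. In a network with
  \<open>n\<close> boundary vertices these are the first \<open>n\<close> corners. If there are no further
  corners, the polygon is the convex hull of the boundary vertices; further corners are needed for
  \<open>n \<le> 2\<close>, where this convex hull has empty interior.
\<close>

record 'k network =
  corners :: "complex list"
  edges :: "'k edge set"

definition convex_polygon :: "complex list \<Rightarrow> bool" where
  "convex_polygon Q \<longleftrightarrow> 3 \<le> length Q \<and>
     (\<forall>a b c. a < b \<and> b < c \<and> c < length Q \<longrightarrow> Im (cnj (Q ! b - Q ! a) * (Q ! c - Q ! a)) > 0)"

definition boundary_vertices :: "nat \<Rightarrow> 'k network \<Rightarrow> complex set" where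
  "boundary_vertices n N = (\<lambda>i. corners N ! i) ` {..<n}"

definition internal_vertices :: "nat \<Rightarrow> 'k network \<Rightarrow> complex set" where
  "internal_vertices n N = (tail ` edges N \<union> head ` edges N) - boundary_vertices n N"

definition incoming :: "'k network \<Rightarrow> complex \<Rightarrow> 'k edge set" where
  "incoming N v = {e \<in> edges N. head e = v}"

definition outgoing :: "'k network \<Rightarrow> complex \<Rightarrow> 'k edge set" where
  "outgoing N v = {e \<in> edges N. tail e = v}"

text \<open>
  \<open>Net n I N\<close>: the network \<open>N\<close> has \<open>n\<close> boundary vertices, with source set
  \<open>I\<close> and sink set \<open>{..<n} - I\<close>. The position of the disk in the plane is
  normalised so that the origin is one of its interior points. Loops are excluded since arcs are
  simple. The second condition on pairs of edges excludes parallel edges but not pairs of opposite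
  edges.
\<close>

definition Net :: "nat \<Rightarrow> nat set \<Rightarrow> 'k::field network \<Rightarrow> bool" where
  "Net n I N \<longleftrightarrow>
     I \<subseteq> {..<n} \<and>
     convex_polygon (corners N) \<and> n \<le> length (corners N) \<and>
     0 \<in> interior (convex hull set (corners N)) \<and>
     finite (edges N) \<and>
     (\<forall>(r, w)\<in>edges N. w \<noteq> 0 \<and> simple_arc r \<and>
        polyline r - {hd r, last r} \<subseteq> interior (convex hull set (corners N))) \<and>
     (\<forall>e\<in>edges N. \<forall>f\<in>edges N. e \<noteq> f \<longrightarrow>
        polyline (fst e) \<inter> polyline (fst f) \<subseteq> {tail e, head e} \<inter> {tail f, head f} \<and>
        \<not> (tail e = tail f \<and> head e = head f)) \<and>
     (\<forall>i<n. if i \<in> I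
        then card (outgoing N (corners N ! i)) = 1 \<and> incoming N (corners N ! i) = {}
        else card (incoming N (corners N ! i)) = 1 \<and> outgoing N (corners N ! i) = {}) \<and>
     (\<forall>v\<in>internal_vertices n N.
        v \<in> interior (convex hull set (corners N)) \<and>
        card (incoming N v) + card (outgoing N v) = 3 \<and>
        (card (incoming N v) = 1 \<or> card (outgoing N v) = 1))"

section \<open>Boundary measurements\<close>

text \<open>A closed polygonal curve is the list of its successive points, the last one being followed
  by the first one.\<close>

definition sides :: "complex list \<Rightarrow> complex list" where
  "sides C = map (\<lambda>t. C ! (Suc t mod length C) - C ! t) [0..<length C]"

text \<open>
  The number \<open>c(C)\<close>, which matters only modulo \<open>2\<close>. Its parity does not depend on the
  direction \<open>l\<close>, so any admissible direction can be chosen.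
\<close>

definition conc :: "complex list \<Rightarrow> nat" where
  "conc C =
     (let d = sides C; m = length d; l = (SOME l. \<forall>s\<in>set d. \<not> collinear {0, l, s})
      in card {t\<in>{..<m}. l \<in> interior (convex_cone hull {d ! t, d ! (Suc t mod m)})})"

text \<open>The boundary of the polygon \<open>Q\<close> from the corner \<open>j\<close> counterclockwise to the
  corner \<open>i\<close>, without its last point.\<close>

definition boundary_path :: "complex list \<Rightarrow> nat \<Rightarrow> nat \<Rightarrow> complex list" where
  "boundary_path Q j i =
     map (\<lambda>t. Q ! ((j + t) mod length Q)) [0..<(i + length Q - j) mod length Q]"

definition paths :: "'k network \<Rightarrow> nat \<Rightarrow> nat \<Rightarrow> 'k edge list set" where
  "paths N i j =
     {P. walk (edges N) P \<and> tail (hd P) = corners N ! i \<and> head (last P) = corners N ! j}"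

definition closed_path :: "'k network \<Rightarrow> nat \<Rightarrow> nat \<Rightarrow> 'k edge list \<Rightarrow> complex list" where
  "closed_path N i j P = butlast (route P) @ boundary_path (corners N) j i"

text \<open>
  The formal series in which the edge weights are replaced by independent variables, one for each
  edge: the coefficient of a monomial, i.e. of a multiset of edges, is the sum of the signs
  \<open>(-1)^(c(C_P) - 1)\<close> over the paths \<open>P\<close> which traverse these edges. There are finitely
  many such paths.
\<close>

definition measurement_series :: "'k network \<Rightarrow> nat \<Rightarrow> nat \<Rightarrow> 'k edge multiset \<Rightarrow> int" where
  "measurement_series N i j m =
     (\<Sum>P\<in>{P \<in> paths N i j. mset P = m}. (- 1) ^ (conc (closed_path N i j P) + 1))"

text \<open>Polynomials with integer coefficients in the edge variables, and their values at the actual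
  edge weights.\<close>

type_synonym 'k edge_poly = "'k edge multiset \<Rightarrow>\<^sub>0 int"

definition weight_eval :: "'k::field edge_poly \<Rightarrow> 'k" where
  "weight_eval p = (\<Sum>m\<in>Poly_Mapping.keys p. of_int (Poly_Mapping.lookup p m) * (\<Prod>e\<in>#m. snd e))"

text \<open>The formal series \<open>g\<close> represents the rational function \<open>p / q\<close>, that is,
  \<open>q g = p\<close> as formal series.\<close>

definition represents_fraction ::
  "('k edge multiset \<Rightarrow> int) \<Rightarrow> 'k edge_poly \<Rightarrow> 'k edge_poly \<Rightarrow> bool" where
  "represents_fraction g p q \<longleftrightarrow> q \<noteq> 0 \<and>
     (\<forall>m. (\<Sum>a\<in>{a. a \<subseteq># m}. Poly_Mapping.lookup q a * g (m - a)) = Poly_Mapping.lookup p m)"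

text \<open>
  The boundary measurement is the value at the edge weights of the rational function represented by
  the series. This value is unique, and it exists unless all denominators of the rational function
  vanish at the edge weights.
\<close>

definition has_measurement :: "'k::field network \<Rightarrow> nat \<Rightarrow> nat \<Rightarrow> 'k \<Rightarrow> bool" where
  "has_measurement N i j x \<longleftrightarrow>
     (\<exists>p q. represents_fraction (measurement_series N i j) p q \<and>
        weight_eval q \<noteq> 0 \<and> x = weight_eval p / weight_eval q)"

definition measurement :: "'k::field network \<Rightarrow> nat \<Rightarrow> nat \<Rightarrow> 'k" where
  "measurement N i j = (THE x. has_measurement N i j x)"

definition measurements_defined :: "nat \<Rightarrow> nat set \<Rightarrow> 'k::field network \<Rightarrow> bool" where
  "measurements_defined n I N \<longleftrightarrow> (\<forall>i\<in>I. \<forall>j\<in>{..<n} - I. \<exists>x. has_measurement N i j x)"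

section \<open>The matrix of a network and the Grassmannian\<close>

definition Xbar :: "nat \<Rightarrow> nat set \<Rightarrow> 'k::field network \<Rightarrow> 'k Matrix.mat" where
  "Xbar n I N = Matrix.mat (card I) n (\<lambda>(p, j).
     let i = sorted_list_of_set I ! p in
     if j \<in> I then (if j = i then 1 else 0)
     else (- 1) ^ card (I \<inter> {min i j<..<max i j}) * measurement N i j)"

definition Grassmannian :: "nat \<Rightarrow> nat \<Rightarrow> 'k::field Matrix.vec set set" where
  "Grassmannian k n = {W. VectorSpace.subspace class_ring W (module_vec TYPE('k) n) \<and>
     vectorspace.dim class_ring ((module_vec TYPE('k) n)\<lparr>carrier := W\<rparr>) = k}"

definition same_Grassmannian_element ::
  "nat \<Rightarrow> nat \<Rightarrow> 'k::field Matrix.mat \<Rightarrow> 'k Matrix.mat \<Rightarrow> bool" where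
  "same_Grassmannian_element k n X Y \<longleftrightarrow> X \<in> carrier_mat k n \<and> Y \<in> carrier_mat k n \<and>
     (\<exists>W\<in>Grassmannian k n. vec_space.row_space n X = W \<and> vec_space.row_space n Y = W)"

section \<open>Networks representing matrices\<close>

text \<open>\<open>Lower i l\<close> is \<open>1 + l e_(i,i-1)\<close> and \<open>Upper j u\<close> is
  \<open>1 + u e_(j-1,j)\<close>.\<close>

datatype 'k elementary = Diagonal "nat \<Rightarrow> 'k" | Lower nat 'k | Upper nat 'k

fun is_elementary :: "nat \<Rightarrow> 'k::field elementary \<Rightarrow> bool" where
  "is_elementary n (Diagonal d) \<longleftrightarrow> (\<forall>j<n. d j \<noteq> 0)"
| "is_elementary n (Lower i l) \<longleftrightarrow> 1 \<le> i \<and> i < n"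
| "is_elementary n (Upper j u) \<longleftrightarrow> 1 \<le> j \<and> j < n"

fun elementary_mat :: "nat \<Rightarrow> 'k::field elementary \<Rightarrow> 'k Matrix.mat" where
  "elementary_mat n (Diagonal d) = Matrix.mat n n (\<lambda>(r, c). if r = c then d r else 0)"
| "elementary_mat n (Lower i l) =
     1\<^sub>m n + Matrix.mat n n (\<lambda>(r, c). if r = i \<and> c = i - 1 then l else 0)"
| "elementary_mat n (Upper j u) =
     1\<^sub>m n + Matrix.mat n n (\<lambda>(r, c). if r = j - 1 \<and> c = j then u else 0)"

definition product_mat :: "nat \<Rightarrow> 'k::field elementary list \<Rightarrow> 'k Matrix.mat" where
  "product_mat n xs = foldr (\<lambda>x M. elementary_mat n x * M) xs (1\<^sub>m n)"

text \<open>
  The square of an elementary network has its left side on the line \<open>Re z = 0\<close> and its right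
  side on the line \<open>Re z = 1\<close>; the \<open>j\<close>th horizontal path is on the line
  \<open>Im z = j\<close>. In the networks of \<open>Lower i l\<close> and \<open>Upper i l\<close> the paths
  \<open>i - 1\<close> and \<open>i\<close> are subdivided by the end points of the additional edge.
\<close>

definition point :: "real \<Rightarrow> nat \<Rightarrow> complex" where
  "point x j = Complex x (real j)"

definition ladder :: "nat \<Rightarrow> nat \<Rightarrow> 'k::field edge set" where
  "ladder n i =
     (\<lambda>j. ([point 0 j, point 1 j], 1)) ` ({..<n} - {i - 1, i}) \<union>
     (\<lambda>j. ([point 0 j, point (1/2) j], 1)) ` {i - 1, i} \<union>
     (\<lambda>j. ([point (1/2) j, point 1 j], 1)) ` {i - 1, i}"

fun elementary_net :: "nat \<Rightarrow> 'k::field elementary \<Rightarrow> 'k edge set" where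
  "elementary_net n (Diagonal d) = (\<lambda>j. ([point 0 j, point 1 j], d j)) ` {..<n}"
| "elementary_net n (Lower i l) =
     insert ([point (1/2) i, point (1/2) (i - 1)], l) (ladder n i)"
| "elementary_net n (Upper j u) =
     insert ([point (1/2) (j - 1), point (1/2) j], u) (ladder n j)"

text \<open>
  Gluing: the points of \<open>G\<close>, at which one edge ends and another one starts, are no longer
  vertices. The edges of the result are the walks that pass only through points of \<open>G\<close> and
  have no end point in \<open>G\<close>; the weight is the product of the weights of the merged edges.
\<close>

definition merge :: "complex set \<Rightarrow> 'k::field edge set \<Rightarrow> 'k edge set" where
  "merge G E = {(route P, prod_list (map snd P)) |P.
     walk E P \<and> tail (hd P) \<notin> G \<and> head (last P) \<notin> G \<and> head ` set (butlast P) \<subseteq> G}"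

definition map_edge :: "(complex \<Rightarrow> complex) \<Rightarrow> 'k edge \<Rightarrow> 'k edge" where
  "map_edge f e = (map f (fst e), snd e)"

text \<open>The concatenation of the elementary networks in the list; the square of the \<open>t\<close>th one
  is moved to the strip \<open>t \<le> Re z \<le> t + 1\<close>.\<close>

definition mat_net :: "nat \<Rightarrow> 'k::field elementary list \<Rightarrow> 'k edge set" where
  "mat_net n xs =
     merge {point (real t) j |t j. 0 < t \<and> t < length xs \<and> j < n}
       (\<Union>t<length xs. map_edge (\<lambda>z. z + of_nat t) ` elementary_net n (xs ! t))"

definition reverse_paths :: "nat set \<Rightarrow> 'k::field edge set \<Rightarrow> 'k edge set" where
  "reverse_paths I E =
     (\<lambda>(r, w). if \<exists>i\<in>I. \<forall>z\<in>set r. Im z = real i then (rev r, inverse w) else (r, w)) ` E"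

text \<open>
  To glue the left side of \<open>mat_net n xs\<close> to the boundary of \<open>N\<close>, the strip
  \<open>0 \<le> Re z \<le> m\<close>, with \<open>m\<close> the length of \<open>xs\<close>, is wrapped around the polygon:
  the \<open>j\<close>th horizontal path becomes the radial segment from the \<open>j\<close>th boundary vertex
  \<open>b\<close> to \<open>(m + 1) b\<close>, and the vertical segments from path \<open>j - 1\<close> to path
  \<open>j\<close> become parallel to the side of the polygon between the boundary vertices \<open>j - 1\<close>
  and \<open>j\<close>. Only points on the horizontal paths occur as points of the arcs. The network
  obtained is drawn in the polygon dilated by the factor \<open>m + 1\<close>.
\<close>

definition wrap :: "complex list \<Rightarrow> complex \<Rightarrow> complex" where
  "wrap Q z = (1 + Re z) *\<^sub>R (Q ! nat \<lfloor>Im z\<rfloor>)"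

definition compose_net ::
  "nat \<Rightarrow> nat set \<Rightarrow> 'k::field network \<Rightarrow> 'k elementary list \<Rightarrow> 'k network" where
  "compose_net n I N xs =
     \<lparr>corners = map (\<lambda>z. (1 + real (length xs)) *\<^sub>R z) (corners N),
      edges = merge (boundary_vertices n N)
        (edges N \<union> map_edge (wrap (corners N)) ` reverse_paths I (mat_net n xs))\<rparr>"

end

theory Submission
  imports Defs "HOL-Computational_Algebra.Formal_Laurent_Series" "Jordan_Normal_Form.DL_Rank"
begin

text \<open>
  The parity of \<open>c(C)\<close> is a product of local signs over the corners of the curve, namely the
  transition signs of the double cover of the circle of directions; hence the sign of a path is
  multiplicative along it. If the directions at the boundary vertices are measured by their angles as
  seen from the centre of the polygon, then the signs in the matrix of the network reduce to row and
  column signs, and its entries become signed sums over walks.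

  Replacing each weight \<open>w\<close> by \<open>w t^s\<close>, where \<open>s\<close> is the number of
  segments of the edge, turns these sums into power series in \<open>t\<close>, and the boundary
  measurements are the values at \<open>t = 1\<close> of rational series. The sums over the walks from a
  source to a given edge, the currents, are the unique solution of a linear system. Therefore the
  currents leaving \<open>N\<close> are determined by those which enter \<open>N\<close> at its sources,
  while each elementary layer acts on the vector of the currents on the \<open>n\<close> radial lines
  by its matrix, up to column signs. This gives \<open>Y' = C Y P\<close> over the Laurent series with an
  unknown square matrix \<open>C\<close>, where \<open>Y\<close>, \<open>Y'\<close> and \<open>P\<close>
  have the values \<open>Xbar N\<close>, \<open>Xbar (N o N(A))\<close> and \<open>A\<close>. As the columns
  of \<open>Y'\<close> in \<open>I\<close> form the identity matrix,
  \<open>(Y P)\<^sub>I Y' = Y P\<close>, and this equation can be evaluated at \<open>t = 1\<close>.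
\<close>

section \<open>Signs of turns\<close>

text \<open>A boundary measurement is a value of a rational function, not a convergent sum, and
  intermediate quantities can have poles exactly at the given weights although the measurements of
  both networks exist. The detour through one variable \<open>t\<close> keeps every sum over walks
  meaningful as a formal series and still leaves a field of scalars, over which a square matrix with
  a one-sided inverse is invertible. Laurent series are forced by the reversed lines: on the line of
  a source the walks run inwards, so passing to the next outer level divides by \<open>t\<close>.
  The matrix \<open>C\<close> collects the currents that enter \<open>N\<close> at its sources;
  nothing guarantees that its entries have values at \<open>t = 1\<close>, which is why it is
  removed before evaluation. What remains is \<open>G X' = X A\<close>, where \<open>G\<close>
  consists of the columns of \<open>X A\<close> in \<open>I\<close>; the invertibility of
  \<open>G\<close> comes from the rank of \<open>X A\<close>, without any genericity of the
  weights.\<close>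

definition has_angle :: "complex \<Rightarrow> real \<Rightarrow> bool" where
  "has_angle u x \<longleftrightarrow> u \<noteq> 0 \<and> u = of_real (cmod u) * cis x"

text \<open>A direction has two lifts to the double cover of the circle, the square roots of \<open>u\<close> up to
  scaling. The sign of a turn compares the principal lifts of two directions, the gauge compares the
  principal lift with the one given by the angle \<open>x\<close>.\<close>

definition turn_sign :: "complex \<Rightarrow> complex \<Rightarrow> int" where
  "turn_sign u v = (if cos ((Arg v - Arg u) / 2) > 0 then 1 else - 1)"

definition angle_gauge :: "complex \<Rightarrow> real \<Rightarrow> int" where
  "angle_gauge u x = (if cis (Arg u / 2) = cis (x / 2) then 1 else - 1)"

lemma has_angle_Arg: "u \<noteq> 0 \<Longrightarrow> has_angle u (Arg u)"
  using rcis_cmod_Arg[of u] by (simp add: has_angle_def rcis_def)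

lemma has_angle_nonzero: "has_angle u x \<Longrightarrow> u \<noteq> 0"
  by (simp add: has_angle_def)

lemma has_angleI: "0 < r \<Longrightarrow> u = of_real r * cis x \<Longrightarrow> has_angle u x"
  by (auto simp: has_angle_def norm_mult)

lemma has_angle_add_2pi: "has_angle u x \<Longrightarrow> has_angle u (x + 2 * pi)"
  by (simp add: has_angle_def cis_mult [symmetric])

lemma has_angle_uminus: "has_angle u x \<Longrightarrow> has_angle (- u) (x + pi)"
  by (simp add: has_angle_def cis_mult [symmetric])

lemma Im_cnj_mult_has_angle:
  assumes "has_angle u x" "has_angle v y"
  shows "Im (cnj u * v) = cmod u * cmod v * sin (y - x)"
proof -
  have "cnj u * v = cnj (of_real (cmod u) * cis x) * (of_real (cmod v) * cis y)"
    using assms unfolding has_angle_def by simp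
  then show ?thesis by (simp add: sin_diff algebra_simps)
qed

lemma Im_cnj_mult_pos_iff:
  assumes "has_angle u x" "has_angle v y"
  shows "Im (cnj u * v) > 0 \<longleftrightarrow> sin (y - x) > 0" "Im (cnj u * v) < 0 \<longleftrightarrow> sin (y - x) < 0"
  using has_angle_nonzero[OF assms(1)] has_angle_nonzero[OF assms(2)]
  unfolding Im_cnj_mult_has_angle[OF assms] by (auto simp: zero_less_mult_iff mult_less_0_iff)

lemma angle_gauge_square [simp]: "angle_gauge u x * angle_gauge u x = 1"
  by (simp add: angle_gauge_def)

lemma turn_sign_commute: "turn_sign u v = turn_sign v u"
  using cos_minus[of "(Arg v - Arg u) / 2"] by (simp add: turn_sign_def minus_divide_left)

lemma turn_sign_scaleR: "0 < r \<Longrightarrow> turn_sign (r *\<^sub>R u) v = turn_sign u v" 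
  "0 < r \<Longrightarrow> turn_sign u (r *\<^sub>R v) = turn_sign u v"
  by (simp_all add: turn_sign_def scaleR_conv_of_real)

lemma turn_sign_self [simp]: "turn_sign u u = 1"
  by (simp add: turn_sign_def)

lemma cis_half_Arg:
  assumes "has_angle u x"
  shows "cis (Arg u / 2) = of_int (angle_gauge u x) * cis (x / 2)"
proof -
  have "cis (Arg u) = cis x"
    using has_angle_Arg[of u] assms unfolding has_angle_def
    by (metis mult_cancel_left norm_eq_zero of_real_eq_0_iff)
  then have "(cis (Arg u / 2))\<^sup>2 = (cis (x / 2))\<^sup>2"
    by (simp add: power2_eq_square cis_mult)
  then show ?thesis
    by (auto simp: angle_gauge_def power2_eq_iff)
qed

lemma turn_sign_angles:
  assumes "has_angle u x" "has_angle v y" "cos ((y - x) / 2) \<noteq> 0"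
  shows "turn_sign u v = angle_gauge u x * angle_gauge v y * (if cos ((y - x) / 2) > 0 then 1 else - 1)"
proof -
  have c: "cos ((b - a) / 2) = Re (cnj (cis (a / 2)) * cis (b / 2))" for a b
    by (simp add: cos_diff diff_divide_distrib algebra_simps)
  have "cos ((Arg v - Arg u) / 2) = of_int (angle_gauge u x * angle_gauge v y) * cos ((y - x) / 2)"
    unfolding c cis_half_Arg[OF assms(1)] cis_half_Arg[OF assms(2)]
    by (simp add: algebra_simps)
  then show ?thesis
    using assms(3) by (auto simp: turn_sign_def angle_gauge_def)
qed

text \<open>Angles less than \<open>pi\<close> apart have half angles less than a right angle apart,
  so the turn carries one lift to the other. The turn sign is then a product of gauges of the two
  directions, and products of turn signs telescope.\<close>

lemma turn_sign_near:
  assumes "has_angle u x" "has_angle v y" "\<bar>y - x\<bar> < pi"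
  shows "turn_sign u v = angle_gauge u x * angle_gauge v y"
proof -
  have "cos ((y - x) / 2) > 0"
    using assms(3) by (intro cos_gt_zero_pi) (auto simp: abs_if split: if_splits)
  then show ?thesis using turn_sign_angles[OF assms(1,2)] by simp
qed

text \<open>In this range the half angles differ by more than one and less than three right angles,
  so the turn matches one lift with the negative of the other.\<close>

lemma turn_sign_far:
  assumes "has_angle u x" "has_angle v y" "pi < \<bar>y - x\<bar>" "\<bar>y - x\<bar> < 3 * pi"
  shows "turn_sign u v = - (angle_gauge u x * angle_gauge v y)"
proof -
  have "cos (\<bar>y - x\<bar> / 2) = - cos (\<bar>y - x\<bar> / 2 - pi)"
    by (simp add: cos_diff)
  moreover have "cos (\<bar>y - x\<bar> / 2 - pi) > 0"
    using assms(3,4) by (intro cos_gt_zero_pi) auto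
  moreover have "cos (\<bar>y - x\<bar> / 2) = cos ((y - x) / 2)"
    by (metis abs_divide abs_numeral cos_abs_real)
  ultimately have "cos ((y - x) / 2) < 0" by linarith
  then show ?thesis using turn_sign_angles[OF assms(1,2)] by simp
qed

lemma sin_neg_between: "pi < x \<Longrightarrow> x < 2 * pi \<Longrightarrow> sin x < 0"
  using sin_lt_zero by blast

lemma sin_sign_iff:
  assumes "0 < w" "w < 2 * pi" "w \<noteq> pi"
  shows "sin w > 0 \<longleftrightarrow> w < pi" "sin w < 0 \<longleftrightarrow> pi < w"
  using assms sin_gt_zero[of w] sin_neg_between[of w] by (cases "w < pi"; force)+

section \<open>Cones spanned by two directions\<close>

lemma convex_cone_hull_two:
  "convex_cone hull {u, v} = {a *\<^sub>R u + b *\<^sub>R v | a b. 0 \<le> a \<and> 0 \<le> b}" for u v :: complex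
proof (rule hull_unique)
  show "{u, v} \<subseteq> {a *\<^sub>R u + b *\<^sub>R v | a b. 0 \<le> a \<and> 0 \<le> b}"
  proof -
    have "u = 1 *\<^sub>R u + 0 *\<^sub>R v" "v = 0 *\<^sub>R u + 1 *\<^sub>R v" by auto
    then show ?thesis by (smt (verit) empty_subsetI insert_subset mem_Collect_eq)
  qed
  show "convex_cone {a *\<^sub>R u + b *\<^sub>R v | a b. 0 \<le> a \<and> 0 \<le> b}"
    unfolding convex_cone_iff
  proof (intro conjI ballI allI impI)
    show "0 \<in> {a *\<^sub>R u + b *\<^sub>R v | a b. 0 \<le> a \<and> 0 \<le> b}"
      by (auto intro!: exI[of _ 0])
  next
    fix x y assume "x \<in> {a *\<^sub>R u + b *\<^sub>R v | a b. 0 \<le> a \<and> 0 \<le> b}"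
      "y \<in> {a *\<^sub>R u + b *\<^sub>R v | a b. 0 \<le> a \<and> 0 \<le> b}"
    then obtain a b c d where "x = a *\<^sub>R u + b *\<^sub>R v" "y = c *\<^sub>R u + d *\<^sub>R v"
      and "0 \<le> a" "0 \<le> b" "0 \<le> c" "0 \<le> d" by auto
    then have "x + y = (a + c) *\<^sub>R u + (b + d) *\<^sub>R v" "0 \<le> a + c" "0 \<le> b + d"
      by (auto simp: algebra_simps)
    then show "x + y \<in> {a *\<^sub>R u + b *\<^sub>R v | a b. 0 \<le> a \<and> 0 \<le> b}" by blast
  next
    fix x and c :: real assume "x \<in> {a *\<^sub>R u + b *\<^sub>R v | a b. 0 \<le> a \<and> 0 \<le> b}" and c: "0 \<le> c"
    then obtain a b where "x = a *\<^sub>R u + b *\<^sub>R v" "0 \<le> a" "0 \<le> b" by auto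
    then have "c *\<^sub>R x = (c * a) *\<^sub>R u + (c * b) *\<^sub>R v" "0 \<le> c * a" "0 \<le> c * b"
      using c by (auto simp: algebra_simps)
    then show "c *\<^sub>R x \<in> {a *\<^sub>R u + b *\<^sub>R v | a b. 0 \<le> a \<and> 0 \<le> b}" by blast
  qed
next
  fix T :: "complex set" assume "{u, v} \<subseteq> T" "convex_cone T"
  then show "{a *\<^sub>R u + b *\<^sub>R v | a b. 0 \<le> a \<and> 0 \<le> b} \<subseteq> T"
    by (auto intro!: convex_cone_add convex_cone_scaleR)
qed

text \<open>By Cramer's rule the coordinates of \<open>l\<close> with respect to \<open>u\<close>
  and \<open>v\<close> are quotients of these imaginary parts, and the interior of the cone is where
  both coordinates are positive. For parallel \<open>u\<close> and \<open>v\<close> both sides are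
  false.\<close>

lemma interior_convex_cone_hull_two:
  fixes u v l :: complex
  assumes "Im (cnj u * l) \<noteq> 0" "Im (cnj l * v) \<noteq> 0"
  shows "l \<in> interior (convex_cone hull {u, v}) \<longleftrightarrow>
    Im (cnj u * v) * Im (cnj u * l) > 0 \<and> Im (cnj u * v) * Im (cnj l * v) > 0"
    (is "?L \<longleftrightarrow> ?R")
proof
  assume ?L
  then have "l \<in> convex_cone hull {u, v}" using interior_subset by blast
  then obtain a b where l: "l = a *\<^sub>R u + b *\<^sub>R v" and ab: "0 \<le> a" "0 \<le> b"
    unfolding convex_cone_hull_two by auto
  have 1: "Im (cnj u * l) = b * Im (cnj u * v)" "Im (cnj l * v) = a * Im (cnj u * v)"
    unfolding l by (simp_all add: algebra_simps)
  with assms ab have "a > 0" "b > 0" "Im (cnj u * v) \<noteq> 0" by (auto simp: less_le)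
  then have "0 < b * (Im (cnj u * v))\<^sup>2" "0 < a * (Im (cnj u * v))\<^sup>2" by simp_all
  then show ?R unfolding 1 by (simp only: power2_eq_square mult.left_commute)
next
  assume R: ?R
  define D where "D = Im (cnj u * v)"
  define U where "U = {z. D * Im (cnj u * z) > 0} \<inter> {z. D * Im (cnj z * v) > 0}"
  have "open U" unfolding U_def
    by (intro open_Int open_Collect_less continuous_intros)
  moreover have "l \<in> U" using R by (simp add: U_def D_def)
  moreover have "U \<subseteq> convex_cone hull {u, v}"
  proof
    fix z assume z: "z \<in> U"
    then have D: "D \<noteq> 0" by (auto simp: U_def)
    have "D *\<^sub>R z = Im (cnj z * v) *\<^sub>R u + Im (cnj u * z) *\<^sub>R v"
      by (rule complex_eqI) (simp_all add: D_def algebra_simps)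
    then have "z = inverse D *\<^sub>R (Im (cnj z * v) *\<^sub>R u + Im (cnj u * z) *\<^sub>R v)"
      using D by (metis divideR_right inverse_eq_divide scaleR_scaleR divide_inverse)
    then have "z = (Im (cnj z * v) / D) *\<^sub>R u + (Im (cnj u * z) / D) *\<^sub>R v"
      by (simp add: scaleR_add_right divide_inverse mult.commute)
    moreover have "0 \<le> Im (cnj z * v) / D" "0 \<le> Im (cnj u * z) / D"
      using z by (auto simp: U_def zero_less_mult_iff divide_nonneg_nonneg divide_nonpos_nonpos)
    ultimately show "z \<in> convex_cone hull {u, v}"
      unfolding convex_cone_hull_two by blast
  qed
  ultimately show ?L by (meson interiorI)
qed

text \<open>The angle of \<open>u\<close> in the branch of the argument that is cut along
  \<open>l\<close>; the \<open>Arg2pi\<close> of the quotient lies between \<open>0\<close> and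
  \<open>2 * pi\<close>.\<close>

definition angle_after :: "complex \<Rightarrow> complex \<Rightarrow> real" where
  "angle_after l u = Arg l + Arg2pi (u / l)"

lemma has_angle_after:
  assumes "u \<noteq> 0" "l \<noteq> 0"
  shows "has_angle u (angle_after l u)"
proof (rule has_angleI)
  have "l = of_real (cmod l) * cis (Arg l)"
    using has_angle_Arg[OF assms(2)] by (simp add: has_angle_def)
  moreover have "u / l = of_real (cmod (u / l)) * cis (Arg2pi (u / l))"
    using Arg2pi_eq[of "u / l"] by (simp add: cis_conv_exp)
  ultimately have "u = of_real (cmod l) * cis (Arg l) * (of_real (cmod (u / l)) * cis (Arg2pi (u / l)))"
    using assms by (metis nonzero_mult_div_cancel_left times_divide_eq_right)
  then show "u = of_real (cmod u) * cis (angle_after l u)"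
    using assms by (simp add: angle_after_def cis_mult [symmetric] norm_divide field_simps)
qed (use assms in auto)

lemma angle_after_bounds:
  assumes "\<not> collinear {0, l, u}"
  shows "Arg l < angle_after l u" "angle_after l u < Arg l + 2 * pi"
    and "angle_after l u \<noteq> Arg l + pi"
proof -
  have "u / l \<notin> \<real>" using assms by (simp add: collinear_iff_Reals)
  then show "Arg l < angle_after l u" "angle_after l u \<noteq> Arg l + pi"
    using Arg2pi_eq_0_pi[of "u / l"] Arg2pi_ge_0[of "u / l"] by (auto simp: angle_after_def less_le)
  show "angle_after l u < Arg l + 2 * pi" using Arg2pi_lt_2pi[of "u / l"] by (simp add: angle_after_def)
qed

text \<open>At a turn by exactly \<open>pi\<close> neither sense of rotation is shorter, and the
  description of turn signs by gauges breaks down; the curves whose sign is computed must avoid such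
  turns.\<close>

definition non_opposite :: "complex \<Rightarrow> complex \<Rightarrow> bool" where
  "non_opposite u v \<longleftrightarrow> u \<noteq> 0 \<and> v \<noteq> 0 \<and> (\<forall>c>0. v \<noteq> - (c *\<^sub>R u))"

lemma non_opposite_angles:
  assumes "non_opposite u v" "has_angle u x" "has_angle v y"
  shows "\<bar>y - x\<bar> \<noteq> pi"
proof
  have *: "cis (a + pi) = - cis a" for a by (simp add: cis_mult [symmetric])
  assume "\<bar>y - x\<bar> = pi"
  then have "y = x + pi \<or> x = y + pi" by (auto simp: abs_if split: if_splits)
  then have "cis y = - cis x" by (auto simp: *)
  then have "v = of_real (cmod v) * (- cis x)"
    using assms(3) unfolding has_angle_def by simp
  moreover have u: "u = of_real (cmod u) * cis x" "u \<noteq> 0" using assms(2) by (auto simp: has_angle_def)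
  moreover have "(cmod v / cmod u) *\<^sub>R (of_real (cmod u) * cis x) = of_real (cmod v) * cis x"
    using u(2) by (simp add: scaleR_conv_of_real)
  ultimately have "v = - ((cmod v / cmod u) *\<^sub>R (of_real (cmod u) * cis x))"
    by simp
  then have "v = - ((cmod v / cmod u) *\<^sub>R u)" using u by simp
  moreover have "cmod v / cmod u > 0" using assms by (auto simp: has_angle_def)
  ultimately show False using assms(1) unfolding non_opposite_def by blast
qed

text \<open>In the branch cut along \<open>l\<close>, the shorter turn passes over \<open>l\<close>
  exactly when the two angles differ by more than \<open>pi\<close>. The gauges compare this branch
  with the principal one, so the crossing is visible in \<open>turn_sign\<close> up to factors that
  belong to each direction separately.\<close>

lemma turn_sign_eq_cone:
  fixes u v l :: complex
  assumes l: "\<not> collinear {0, l, u}" "\<not> collinear {0, l, v}" and uv: "non_opposite u v"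
  shows "(- 1) ^ of_bool (l \<in> interior (convex_cone hull {u, v}))
     = angle_gauge u (angle_after l u) * angle_gauge v (angle_after l v) * turn_sign u v"
proof -
  have nz: "l \<noteq> 0" "u \<noteq> 0" "v \<noteq> 0" using l by (auto simp: collinear_lemma)
  define x y where "x = angle_after l u" and "y = angle_after l v"
  have x: "has_angle u x" "Arg l < x" "x < Arg l + 2 * pi" "x \<noteq> Arg l + pi"
    using has_angle_after angle_after_bounds[OF l(1)] nz by (auto simp: x_def)
  have y: "has_angle v y" "Arg l < y" "y < Arg l + 2 * pi" "y \<noteq> Arg l + pi"
    using has_angle_after angle_after_bounds[OF l(2)] nz by (auto simp: y_def)
  have la: "has_angle l (Arg l)" using has_angle_Arg nz by simp
  have sx: "sin (Arg l - x) < 0 \<longleftrightarrow> x < Arg l + pi" "sin (Arg l - x) > 0 \<longleftrightarrow> x > Arg l + pi"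
    using x sin_sign_iff[of "x - Arg l"] sin_minus[of "x - Arg l"] by auto
  have sy: "sin (y - Arg l) > 0 \<longleftrightarrow> y < Arg l + pi" "sin (y - Arg l) < 0 \<longleftrightarrow> y > Arg l + pi"
    using y sin_sign_iff[of "y - Arg l"] by auto
  have nopp: "\<bar>y - x\<bar> \<noteq> pi" using non_opposite_angles[OF uv x(1) y(1)] .
  have inn: "l \<in> interior (convex_cone hull {u, v}) \<longleftrightarrow>
     (sin (y - x) > 0 \<and> x > Arg l + pi \<and> y < Arg l + pi) \<or> (sin (y - x) < 0 \<and> x < Arg l + pi \<and> y > Arg l + pi)"
  proof -
    have "Im (cnj u * l) \<noteq> 0" "Im (cnj l * v) \<noteq> 0"
      using sx sy x y Im_cnj_mult_pos_iff[OF x(1) la] Im_cnj_mult_pos_iff[OF la y(1)] by linarith+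
    then show ?thesis
      using interior_convex_cone_hull_two[of u l v] Im_cnj_mult_pos_iff[OF x(1) la] Im_cnj_mult_pos_iff[OF la y(1)]
        Im_cnj_mult_pos_iff[OF x(1) y(1)] sx sy
      by (auto simp: zero_less_mult_iff)
  qed
  \<comment> \<open>Both angles lie in an interval of length \<open>2 * pi\<close>; a difference
    larger than \<open>pi\<close> forces them onto different sides of its midpoint
    \<open>Arg l + pi\<close>.\<close>
  also have "\<dots> \<longleftrightarrow> \<bar>y - x\<bar> > pi"
  proof (cases "x > Arg l + pi \<and> y < Arg l + pi")
    case True
    then have "0 < x - y" "x - y < 2 * pi" "x - y \<noteq> pi" using x y nopp by auto
    then have "sin (y - x) > 0 \<longleftrightarrow> x - y > pi"
      using sin_sign_iff[of "x - y"] sin_minus[of "x - y"] by auto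
    then show ?thesis using True \<open>0 < x - y\<close> by auto
  next
    case F1: False
    show ?thesis
    proof (cases "x < Arg l + pi \<and> y > Arg l + pi")
      case True
      then have "0 < y - x" "y - x < 2 * pi" "y - x \<noteq> pi" using x y nopp by auto
      then have "sin (y - x) < 0 \<longleftrightarrow> y - x > pi"
        using sin_sign_iff[of "y - x"] by auto
      then show ?thesis using True \<open>0 < y - x\<close> by auto
    next
      case False
      then have "\<bar>y - x\<bar> < pi" using F1 x y by (auto simp: abs_if not_less)
      then show ?thesis using F1 False by auto
    qed
  qed
  finally have i: "l \<in> interior (convex_cone hull {u, v}) \<longleftrightarrow> \<bar>y - x\<bar> > pi" .
  show ?thesis
  proof (cases "\<bar>y - x\<bar> > pi")
    case True
    then have "turn_sign u v = - (angle_gauge u x * angle_gauge v y)"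
      using x y by (intro turn_sign_far) auto
    then show ?thesis using i True by (simp add: x_def[symmetric] y_def[symmetric] algebra_simps)
  next
    case False
    then have "turn_sign u v = angle_gauge u x * angle_gauge v y"
      using x y nopp by (intro turn_sign_near) auto
    then show ?thesis using i False by (simp add: x_def[symmetric] y_def[symmetric] algebra_simps)
  qed
qed

section \<open>Direction lists of curves and the parity of \<open>c(C)\<close>\<close>

fun dirs :: "complex list \<Rightarrow> complex list" where
  "dirs (p # q # r) = (q - p) # dirs (q # r)"
| "dirs _ = []"

fun path_sign :: "complex list \<Rightarrow> int" where
  "path_sign (u # v # ds) = turn_sign u v * path_sign (v # ds)"
| "path_sign _ = 1"

lemma length_dirs [simp]: "length (dirs r) = length r - 1"
  by (induction r rule: dirs.induct) auto

lemma nth_dirs: "Suc t < length r \<Longrightarrow> dirs r ! t = r ! Suc t - r ! t"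
proof (induction r arbitrary: t rule: dirs.induct)
  case (1 p q r)
  then show ?case by (cases t) auto
qed auto

lemma dirs_eq_Nil_iff [simp]: "dirs r = [] \<longleftrightarrow> length r \<le> 1"
  by (metis length_0_conv length_dirs diff_is_0_eq)

lemma dirs_append: "dirs (xs @ p # ys) = dirs (xs @ [p]) @ dirs (p # ys)"
proof (induction xs rule: dirs.induct)
  case ("2_2" v)
  then show ?case by (cases ys) auto
qed auto

lemma path_sign_append:
  "xs \<noteq> [] \<Longrightarrow> ys \<noteq> [] \<Longrightarrow> path_sign (xs @ ys) = path_sign xs * turn_sign (last xs) (hd ys) * path_sign ys"
proof (induction xs rule: path_sign.induct)
  case ("2_2" v)
  then show ?case by (cases ys) auto
qed auto

lemma sides_eq_dirs:
  assumes "C \<noteq> []"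
  shows "sides C = dirs (C @ [hd C])"
proof (rule nth_equalityI)
  show "length (sides C) = length (dirs (C @ [hd C]))" by (simp add: sides_def)
  fix t assume "t < length (sides C)"
  then have t: "t < length C" by (simp add: sides_def)
  have "(C @ [hd C]) ! Suc t = C ! (Suc t mod length C)"
    using t assms by (cases "Suc t = length C") (auto simp: nth_append hd_conv_nth)
  moreover have "(C @ [hd C]) ! t = C ! t" using t by (simp add: nth_append)
  ultimately show "sides C ! t = dirs (C @ [hd C]) ! t"
    using t by (simp add: sides_def nth_dirs)
qed

lemma path_sign_prod: "path_sign ds = (\<Prod>t\<in>{t. Suc t < length ds}. turn_sign (ds ! t) (ds ! Suc t))"
proof (induction ds rule: path_sign.induct)
  case (1 u v ds)
  have "{t. Suc t < length (u # v # ds)} = insert 0 (Suc ` {t. Suc t < length (v # ds)})"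
    by (auto simp: image_iff) (metis Suc_less_eq Suc_pred neq0_conv)
  moreover have "finite {t. Suc t < length (v # ds)}"
    by (rule finite_subset[of _ "{..<length (v # ds)}"]) auto
  ultimately show ?case using 1 by (simp add: prod.reindex)
qed auto

lemma exists_transversal_direction:
  assumes "finite D" "0 \<notin> D"
  shows "\<exists>l::complex. \<forall>s\<in>D. \<not> collinear {0, l, s}"
proof -
  \<comment> \<open>A slope different from all slopes in \<open>D\<close>. Vertical directions yield
    the slope \<open>0\<close> by the convention for division by zero, which only excludes one more
    value, since \<open>Complex 1 k\<close> is never vertical.\<close>
  obtain k where k: "k \<notin> (\<lambda>s. Im s / Re s) ` D"
    using ex_new_if_finite[of "(\<lambda>s. Im s / Re s) ` D"] assms infinite_UNIV_char_0 by auto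
  have "\<not> collinear {0, Complex 1 k, s}" if "s \<in> D" for s
  proof
    assume "collinear {0, Complex 1 k, s}"
    then obtain r where s: "s = r *\<^sub>R Complex 1 k"
      using that assms by (auto simp: collinear_lemma Complex_eq_0)
    then have "r \<noteq> 0" using that assms by auto
    then have "k = Im s / Re s" using s by simp
    then show False using k that by blast
  qed
  then show ?thesis by blast
qed

lemma prod_neg_one_of_bool: "finite A \<Longrightarrow> (- 1 :: int) ^ card {t\<in>A. B t} = (\<Prod>t\<in>A. (- 1) ^ of_bool (B t))"
proof (induction A rule: finite_induct)
  case (insert x A)
  have "{t \<in> insert x A. B t} = (if B x then insert x {t\<in>A. B t} else {t\<in>A. B t})" by auto
  then show ?case using insert by auto
qed simp

lemma prod_cyclic_shift:
  fixes f :: "nat \<Rightarrow> int"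
  assumes "0 < m"
  shows "(\<Prod>t<m. f (Suc t mod m)) = (\<Prod>t<m. f t)"
proof -
  obtain k where m: "m = Suc k" using assms by (cases m) auto
  have "(\<Prod>t<m. f (Suc t mod m)) = (\<Prod>t<k. f (Suc t mod m)) * f 0" by (simp add: m)
  also have "(\<Prod>t<k. f (Suc t mod m)) = (\<Prod>t<k. f (Suc t))" by (rule prod.cong) (auto simp: m)
  also have "\<dots> * f 0 = (\<Prod>t<m. f t)" unfolding m by (subst prod.lessThan_Suc_shift) (simp add: mult.commute)
  finally show ?thesis .
qed

text \<open>Every side takes part in two consecutive turns, so its gauge with respect to the chosen
  \<open>l\<close> occurs twice and cancels around the closed curve. The first direction is appended
  at the end to include the turn at the starting point.\<close>

theorem neg_one_pow_conc:
  assumes C: "C \<noteq> []" and turns: "successively non_opposite (dirs (C @ [hd C]) @ [hd (dirs (C @ [hd C]))])"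
  shows "(- 1) ^ conc C = path_sign (dirs (C @ [hd C]) @ [hd (dirs (C @ [hd C]))])"
proof -
  define d where "d = sides C"
  define m where "m = length d"
  define l where "l = (SOME l. \<forall>s\<in>set d. \<not> collinear {0, l, s})"
  have d: "d = dirs (C @ [hd C])" by (simp add: d_def sides_eq_dirs C)
  have m: "m > 0" "d \<noteq> []" using C by (auto simp: m_def d_def sides_def)
  have nth: "(d @ [hd d]) ! t = d ! t" "(d @ [hd d]) ! Suc t = d ! (Suc t mod m)" if "t < m" for t
    using that m by (cases "Suc t = m"; auto simp: nth_append m_def hd_conv_nth)+
  have no: "non_opposite (d ! t) (d ! (Suc t mod m))" if "t < m" for t
  proof -
    have "non_opposite ((d @ [hd d]) ! t) ((d @ [hd d]) ! Suc t)"
      using turns that unfolding d[symmetric] by (auto simp: successively_conv_nth m_def)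
    then show ?thesis using nth[OF that] by simp
  qed
  have "0 \<notin> set d" using no by (auto simp: in_set_conv_nth m_def non_opposite_def)
  then have "\<exists>l. \<forall>s\<in>set d. \<not> collinear {0, l, s}" using exists_transversal_direction[of "set d"] by auto
  from someI_ex[OF this] have l: "\<forall>s\<in>set d. \<not> collinear {0, l, s}" unfolding l_def .
  define g where "g t = angle_gauge (d ! t) (angle_after l (d ! t))" for t
  have "conc C = card {t\<in>{..<m}. l \<in> interior (convex_cone hull {d ! t, d ! (Suc t mod m)})}"
    unfolding conc_def Let_def d_def[symmetric] m_def[symmetric] l_def ..
  then have "(- 1) ^ conc C = (\<Prod>t<m. (- 1 :: int) ^ of_bool (l \<in> interior (convex_cone hull {d ! t, d ! (Suc t mod m)})))"
    by (simp only: prod_neg_one_of_bool[OF finite_lessThan])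
  also have "\<dots> = (\<Prod>t<m. g t * g (Suc t mod m) * turn_sign (d ! t) (d ! (Suc t mod m)))"
  proof (rule prod.cong[OF refl])
    fix t assume "t \<in> {..<m}"
    then have "t < m" "Suc t mod m < m" using m by auto
    then show "(- 1 :: int) ^ of_bool (l \<in> interior (convex_cone hull {d ! t, d ! (Suc t mod m)})) =
        g t * g (Suc t mod m) * turn_sign (d ! t) (d ! (Suc t mod m))"
      unfolding g_def using l no by (intro turn_sign_eq_cone) (auto simp: m_def)
  qed
  also have "\<dots> = (\<Prod>t<m. g t) * (\<Prod>t<m. g (Suc t mod m)) * (\<Prod>t<m. turn_sign (d ! t) (d ! (Suc t mod m)))"
    by (simp add: prod.distrib)
  also have "\<dots> = (\<Prod>t<m. g t * g t) * (\<Prod>t<m. turn_sign (d ! t) (d ! (Suc t mod m)))"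
    unfolding prod_cyclic_shift[OF m(1)] by (simp add: prod.distrib)
  also have "(\<Prod>t<m. g t * g t) = 1" by (simp add: g_def)
  also have "(\<Prod>t<m. turn_sign (d ! t) (d ! (Suc t mod m))) =
     (\<Prod>t\<in>{t. Suc t < length (d @ [hd d])}. turn_sign ((d @ [hd d]) ! t) ((d @ [hd d]) ! Suc t))"
    by (rule prod.cong) (auto simp: nth m_def)
  finally show ?thesis by (simp add: path_sign_prod d)
qed

lemma has_angle_add_2pi_nat: "has_angle u x \<Longrightarrow> has_angle u (x + 2 * pi * real k)"
proof (induction k)
  case (Suc k)
  then show ?case using has_angle_add_2pi[of u "x + 2 * pi * real k"] by (simp add: algebra_simps)
qed simp

lemma exists_has_angle:
  assumes "v \<noteq> 0"
  shows "\<exists>x. c \<le> x \<and> x < c + 2 * pi \<and> has_angle v x"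
proof (intro exI conjI)
  have "v / cis c = of_real (cmod (v / cis c)) * cis (Arg2pi (v / cis c))"
    using Arg2pi_eq[of "v / cis c"] by (simp add: cis_conv_exp)
  then have "v = of_real (cmod v) * (cis c * cis (Arg2pi (v / cis c)))"
    by (simp add: norm_divide field_simps)
  then show "has_angle v (c + Arg2pi (v / cis c))"
    using assms by (intro has_angleI[of "cmod v"]) (auto simp: cis_mult)
qed (use Arg2pi_ge_0[of "v / cis c"] Arg2pi_lt_2pi[of "v / cis c"] in auto)

text \<open>A full turn of the angle is half a turn of the square root, which exchanges the two
  lifts.\<close>

lemma angle_gauge_add_2pi:
  assumes "has_angle u x"
  shows "angle_gauge u (x + 2 * pi) = - angle_gauge u x"
proof -
  have *: "cis ((x + 2 * pi) / 2) = - cis (x / 2)"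
    by (simp add: add_divide_distrib cis_mult [symmetric])
  have "cis (x / 2) \<noteq> 0" by simp
  moreover have "- z = z \<longleftrightarrow> z = 0" for z :: complex by auto
  ultimately show ?thesis using cis_half_Arg[OF assms] by (auto simp: angle_gauge_def *)
qed

lemma non_opposite_Im: "Im (cnj u * v) \<noteq> 0 \<Longrightarrow> non_opposite u v"
  by (auto simp: non_opposite_def)

lemma angle_between:
  assumes "has_angle s x" "Im (cnj s * u) > 0"
  obtains y where "has_angle u y" "x < y" "y < x + pi"
proof -
  have "u \<noteq> 0" using assms by auto
  then obtain y where y: "x \<le> y" "y < x + 2 * pi" "has_angle u y"
    using exists_has_angle by blast
  have "sin (y - x) > 0" using Im_cnj_mult_pos_iff[OF assms(1) y(3)] assms(2) by simp
  then have "y - x \<noteq> 0" "y - x \<noteq> pi" "\<not> pi < y - x"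
    using sin_neg_between[of "y - x"] y by auto
  then show thesis using y that by auto
qed

text \<open>The directions to the left of \<open>s\<close> have angles in an open interval of length
  \<open>pi\<close> that begins at the angle of \<open>s\<close>. Any two of these angles, also
  together with that of \<open>s\<close>, are less than \<open>pi\<close> apart, so the gauge of
  \<open>u\<close> cancels.\<close>

lemma turn_sign_halfplane:
  assumes "Im (cnj s * u) > 0" "Im (cnj s * v) > 0"
  shows "turn_sign s v = turn_sign s u * turn_sign u v"
proof -
  have s: "has_angle s (Arg s)" using assms(1) by (intro has_angle_Arg) auto
  obtain y where y: "has_angle u y" "Arg s < y" "y < Arg s + pi" using angle_between[OF s assms(1)] .
  obtain z where z: "has_angle v z" "Arg s < z" "z < Arg s + pi" using angle_between[OF s assms(2)] .
  show ?thesis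
    using turn_sign_near[OF s z(1)] turn_sign_near[OF s y(1)] turn_sign_near[OF y(1) z(1)] y z
    by (auto simp: algebra_simps angle_gauge_def)
qed

lemma turn_sign_halfplane_neg:
  assumes "Im (cnj s * u) < 0" "Im (cnj s * v) < 0"
  shows "turn_sign s v = turn_sign s u * turn_sign u v"
proof -
  have nz: "u \<noteq> 0" "s \<noteq> 0" "v \<noteq> 0" using assms by auto
  \<comment> \<open>Measured from \<open>- s\<close>, the directions to the right of
    \<open>s\<close> fill the open interval that ends at the angle \<open>x + pi\<close> of
    \<open>s\<close>.\<close>
  obtain x where x': "has_angle (- s) x" using has_angle_Arg nz by (metis neg_equal_0_iff_equal)
  then have x: "has_angle s (x + pi)" using has_angle_uminus by fastforce
  obtain y where y: "has_angle u y" "x < y" "y < x + pi" using angle_between[OF x', of u] assms by auto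
  obtain z where z: "has_angle v z" "x < z" "z < x + pi" using angle_between[OF x', of v] assms by auto
  show ?thesis
    using turn_sign_near[OF x z(1)] turn_sign_near[OF x y(1)] turn_sign_near[OF y(1) z(1)] y z
    by (auto simp: algebra_simps angle_gauge_def)
qed

section \<open>Convex polygons around the origin\<close>

locale disk =
  fixes Q :: "complex list"
  assumes convex: "convex_polygon Q" and center: "0 \<in> interior (convex hull set Q)"
begin

abbreviation "L \<equiv> length Q"

text \<open>Indices are taken modulo the number of corners, so that the boundary can be followed
  through corner \<open>0\<close> without a case distinction.\<close>

definition corner :: "nat \<Rightarrow> complex" where "corner q = Q ! (q mod L)"
definition side :: "nat \<Rightarrow> complex" where "side q = corner (Suc q) - corner q"

lemma L: "3 \<le> L" "0 < L"
  using convex by (auto simp: convex_polygon_def)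

lemma corner_less: "q < L \<Longrightarrow> corner q = Q ! q"
  by (simp add: corner_def)

lemma corner_add_L [simp]: "corner (q + L) = corner q"
  by (simp add: corner_def)

lemma side_add_L [simp]: "side (q + L) = side q"
  by (metis side_def corner_add_L add_Suc)

lemma triple: "a < b \<Longrightarrow> b < c \<Longrightarrow> c < L \<Longrightarrow> Im (cnj (Q ! b - Q ! a) * (Q ! c - Q ! a)) > 0"
  using convex by (auto simp: convex_polygon_def)

lemma area_rotate: "Im (cnj (b - a) * (c - a)) = Im (cnj (c - b) * (a - b))" for a b c :: complex
  by (simp add: algebra_simps)

text \<open>\<open>convex_polygon\<close> only speaks of increasing triples; the cyclic symmetry of
  the orientation covers a third corner with a smaller index and the side that closes the
  polygon.\<close>

lemma side_corner_less:
  assumes "q < L" "k < L" "k \<noteq> q" "k \<noteq> Suc q mod L"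
  shows "Im (cnj (side q) * (Q ! k - corner q)) > 0"
proof (cases "Suc q < L")
  case True
  then have s: "side q = Q ! Suc q - Q ! q" "corner q = Q ! q" by (auto simp: side_def corner_def)
  show ?thesis
  proof (cases "k < q")
    case True
    then have "Im (cnj (Q ! q - Q ! k) * (Q ! Suc q - Q ! k)) > 0" using triple \<open>Suc q < L\<close> by auto
    then show ?thesis unfolding s using area_rotate by metis
  next
    case False
    then show ?thesis unfolding s using triple True assms by auto
  qed
next
  case False
  then have q: "Suc q = L" using assms by auto
  then have s: "side q = Q ! 0 - Q ! q" "corner q = Q ! q" using assms by (auto simp: side_def corner_def)
  have "0 < k" "k < q" using assms q by (auto intro: Nat.gr0I)
  then have "Im (cnj (Q ! k - Q ! 0) * (Q ! q - Q ! 0)) > 0" using triple assms by auto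
  then show ?thesis unfolding s using area_rotate by metis
qed

lemma side_corner:
  assumes "k mod L \<noteq> q mod L" "k mod L \<noteq> Suc q mod L"
  shows "Im (cnj (side q) * (corner k - corner q)) > 0"
proof -
  have "side q = side (q mod L)" by (simp add: side_def corner_def mod_Suc_eq)
  moreover have "Im (cnj (side (q mod L)) * (Q ! (k mod L) - corner (q mod L))) > 0"
    using assms L by (intro side_corner_less) (auto simp: mod_Suc_eq)
  ultimately show ?thesis by (simp add: corner_def)
qed

lemma mod_add_eq_imp:
  assumes "(q + d) mod L = q mod L" "d < L"
  shows "d = 0"
proof (rule ccontr)
  assume "d \<noteq> 0"
  have "L dvd q + d - q" by (rule iffD1[OF mod_eq_dvd_iff_nat]) (simp_all only: assms le_add1)
  then have "L dvd d" by simp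
  then show False using assms \<open>d \<noteq> 0\<close> nat_dvd_not_less by blast
qed

lemma side_nonzero: "side q \<noteq> 0"
proof -
  define k where "k = q + 2"
  have "k mod L \<noteq> q mod L" "k mod L \<noteq> Suc q mod L"
    using L mod_add_eq_imp[of q 2] mod_add_eq_imp[of "Suc q" 1] unfolding k_def by fastforce+
  from side_corner[OF this] show ?thesis by auto
qed

text \<open>All corners lie in the closed half-plane to the left of the side, hence so does the
  hull, and the interior of the hull lies in the open half-plane.\<close>

lemma side_interior:
  assumes "p \<in> interior (convex hull set Q)"
  shows "Im (cnj (side q) * (p - corner q)) > 0"
proof -
  \<comment> \<open>The inner normal of the side: the inner product with \<open>a\<close> is the
    cross product with the side.\<close>
  define a where "a = \<i> * side q"
  have a: "a \<bullet> z = Im (cnj (side q) * z)" for z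
    by (simp add: a_def inner_complex_def)
  have "set Q \<subseteq> {z. a \<bullet> z \<ge> a \<bullet> corner q}"
  proof
    fix z assume "z \<in> set Q"
    then obtain k where k: "k < L" "z = Q ! k" by (auto simp: in_set_conv_nth)
    show "z \<in> {z. a \<bullet> z \<ge> a \<bullet> corner q}"
    proof (cases "k mod L = q mod L \<or> k mod L = Suc q mod L")
      case True
      then have "z = corner q \<or> z = corner q + side q" using k by (auto simp: corner_def side_def)
      then show ?thesis unfolding mem_Collect_eq a by (auto simp: algebra_simps)
    next
      case False
      then show ?thesis using side_corner[of k q] k by (auto simp: a corner_less algebra_simps)
    qed
  qed
  then have "convex hull set Q \<subseteq> {z. a \<bullet> z \<ge> a \<bullet> corner q}"
    by (intro hull_minimal) (auto simp: convex_halfspace_ge)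
  then have "interior (convex hull set Q) \<subseteq> interior {z. a \<bullet> z \<ge> a \<bullet> corner q}"
    by (rule interior_mono)
  moreover have "a \<noteq> 0" using side_nonzero by (simp add: a_def)
  ultimately have "a \<bullet> corner q < a \<bullet> p" using assms by (auto simp: interior_halfspace_ge)
  then show ?thesis by (simp add: a right_diff_distrib)
qed

text \<open>This is twice the signed area of the triangle spanned by the side and the origin, which
  lies strictly to the left of the side.\<close>

lemma corner_cross: "Im (cnj (corner q) * corner (Suc q)) > 0"
proof -
  have "Im (cnj (side q) * (0 - corner q)) = Im (cnj (corner q) * corner (Suc q))"
    by (simp add: side_def algebra_simps)
  then show ?thesis using side_interior[OF center, of q] by linarith
qed

lemma corner_nonzero: "corner q \<noteq> 0"
  using corner_cross[of q] by auto

text \<open>A lift of the angle of the corners that will increase along the whole boundary; each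
  passage through corner \<open>0\<close> adds a full turn.\<close>

definition theta :: "nat \<Rightarrow> real" where
  "theta q = angle_after (Q ! 0) (corner q) + 2 * pi * real (q div L)"

lemma has_angle_theta: "has_angle (corner q) (theta q)"
proof -
  have "Q ! 0 \<noteq> 0" using corner_nonzero[of 0] by (simp add: corner_def)
  then have "has_angle (corner q) (angle_after (Q ! 0) (corner q))"
    using has_angle_after corner_nonzero by auto
  then show ?thesis unfolding theta_def by (rule has_angle_add_2pi_nat)
qed

lemma theta_add_L [simp]: "theta (q + L) = theta q + 2 * pi"
proof -
  have "(q + L) div L = Suc (q div L)" using L by simp
  then show ?thesis by (simp add: theta_def algebra_simps)
qed

lemma theta_0: "theta 0 = Arg (Q ! 0)"
proof -
  have "Q ! 0 / Q ! 0 = 1" using corner_nonzero[of 0] by (simp add: corner_def)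
  then show ?thesis using Arg2pi_of_real[of 1] by (simp add: theta_def angle_after_def corner_def)
qed

lemma theta_bounds: "q < L \<Longrightarrow> theta 0 \<le> theta q \<and> theta q < theta 0 + 2 * pi"
  using Arg2pi_ge_0[of "corner q / Q ! 0"] Arg2pi_lt_2pi[of "corner q / Q ! 0"]
  unfolding theta_0 by (simp add: theta_def angle_after_def)

lemma sin_theta_Suc: "sin (theta (Suc q) - theta q) > 0"
  using Im_cnj_mult_pos_iff[OF has_angle_theta has_angle_theta] corner_cross by blast

text \<open>If the angle decreased from one corner to the next, corner \<open>0\<close> would lie in the triangle
  spanned by these two corners and the origin.\<close>

lemma theta_Suc_less:
  assumes q: "Suc q < L"
  shows "theta q < theta (Suc q) \<and> theta (Suc q) < theta q + pi"
proof (rule ccontr)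
  define x y A where "x = theta q" and "y = theta (Suc q)" and "A = theta 0"
  have b: "A \<le> x" "x < A + 2 * pi" "A \<le> y" "y < A + 2 * pi"
    using theta_bounds[of q] theta_bounds[OF q] q by (auto simp: x_def y_def A_def)
  have s: "sin (y - x) > 0" using sin_theta_Suc by (simp add: x_def y_def)
  assume "\<not> ?thesis"
  then have *: "y \<le> x \<or> x + pi \<le> y" by (auto simp: x_def y_def)
  have "\<not> x + pi \<le> y"
    using s sin_neg_between[of "y - x"] b by (cases "y - x = pi") auto
  then have "y \<le> x" using * by simp
  then have yx: "y < x - pi"
    using s sin_ge_zero[of "x - y"] sin_minus[of "x - y"] by (cases "x - y \<le> pi") auto
  have "q \<noteq> 0"
  proof
    assume "q = 0"
    then have "x = A" by (simp add: x_def A_def)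
    then show False using yx b pi_gt_zero by linarith
  qed
  define u v w where "u = Q ! q" and "v = Q ! Suc q" and "w = Q ! 0"
  have ang: "has_angle u x" "has_angle v y" "has_angle w A"
    using has_angle_theta[of q] has_angle_theta[of "Suc q"] has_angle_theta[of 0] q L
    by (auto simp: u_def v_def w_def x_def y_def A_def corner_less)
  define D c1 c2 where "D = Im (cnj u * v)" and "c1 = Im (cnj w * v)" and "c2 = Im (cnj u * w)"
  have D: "D > 0" using corner_cross[of q] q by (simp add: D_def u_def v_def corner_less)
  have c1: "c1 \<ge> 0"
  proof -
    have "sin (y - A) \<ge> 0" using yx b by (intro sin_ge_zero) auto
    then show ?thesis unfolding c1_def Im_cnj_mult_has_angle[OF ang(3,2)] by simp
  qed
  have c2: "c2 > 0"
  proof -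
    have "sin (A - x + 2 * pi) > 0" using yx b by (intro sin_gt_zero) auto
    then show ?thesis using Im_cnj_mult_pos_iff[OF ang(1,3)] by (simp add: c2_def)
  qed
  have "Im (cnj (u - w) * (v - w)) > 0"
    using triple[of 0 q "Suc q"] \<open>q \<noteq> 0\<close> q by (auto simp: u_def v_def w_def)
  then have lt: "c1 + c2 < D" by (simp add: D_def c1_def c2_def algebra_simps)
  \<comment> \<open>The affine function \<open>f\<close> vanishes at \<open>w\<close>, is positive
    at the origin and nonnegative at all corners. The identity below writes \<open>w\<close> in
    barycentric coordinates of \<open>u\<close>, \<open>v\<close> and \<open>0\<close>, scaled by
    \<open>D\<close>; the coefficient of \<open>0\<close> is positive and the others are
    nonnegative, so \<open>f w\<close> would be positive.\<close>
  define f where "f z = Im (cnj (Q ! 1 - w) * (z - w))" for z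
  have f0: "f 0 > 0" using side_interior[OF center, of 0] L by (simp add: f_def w_def side_def corner_less)
  have fn: "f (Q ! k) \<ge> 0" if "k < L" for k
  proof (cases "k \<le> 1")
    case True
    then have "k = 0 \<or> k = 1" by auto
    then show ?thesis by (auto simp: f_def w_def algebra_simps)
  next
    case False
    then show ?thesis using triple[of 0 1 k] that L by (auto simp: f_def w_def)
  qed
  have "D * f w = c1 * f u + c2 * f v + (D - c1 - c2) * f 0"
    unfolding D_def c1_def c2_def f_def by (simp add: algebra_simps)
  moreover have "f w = 0" by (simp add: f_def)
  moreover have "c1 * f u \<ge> 0" "c2 * f v \<ge> 0" using c1 c2 fn q by (auto simp: u_def v_def)
  moreover have "(D - c1 - c2) * f 0 > 0" using lt f0 by simp
  ultimately show False by simp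
qed

lemma theta_Suc: "theta q < theta (Suc q)" "theta (Suc q) < theta q + pi"
proof -
  have less: "theta q < theta (Suc q) \<and> theta (Suc q) < theta q + pi" if q: "q < L" for q
  proof (cases "Suc q < L")
    case False
    then have "Suc q = 0 + L" using q by simp
    then have e: "theta (Suc q) = theta 0 + 2 * pi" by (metis theta_add_L)
    then have "0 < theta (Suc q) - theta q" "theta (Suc q) - theta q \<le> 2 * pi" 
      using theta_bounds[OF q] by auto
    moreover have "\<not> pi \<le> theta (Suc q) - theta q"
      using sin_theta_Suc[of q] sin_neg_between[of "theta (Suc q) - theta q"] \<open>theta (Suc q) - theta q \<le> 2 * pi\<close>
      by (cases "theta (Suc q) - theta q = pi \<or> theta (Suc q) - theta q = 2 * pi") auto
    ultimately show ?thesis by simp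
  qed (rule theta_Suc_less)
  have per: "theta (q + L * k) = theta q + 2 * pi * real k" for q k
  proof (induction k)
    case (Suc k)
    have "theta (q + L * Suc k) = theta (q + L * k + L)" by (simp add: add.commute add.left_commute)
    then show ?case using Suc unfolding theta_add_L by (simp add: algebra_simps)
  qed simp
  have "theta q = theta (q mod L) + 2 * pi * real (q div L)" 
    "theta (Suc q) = theta (Suc (q mod L)) + 2 * pi * real (q div L)"
    using per[of "q mod L" "q div L"] per[of "Suc (q mod L)" "q div L"] by simp_all
  then show "theta q < theta (Suc q)" "theta (Suc q) < theta q + pi"
    using less[of "q mod L"] L by auto
qed

text \<open>The side points to the left of both radial directions, which leaves for its angle the
  intersection of two intervals of length \<open>pi\<close>.\<close>

lemma exists_side_angle: "\<exists>x. has_angle (side q) x \<and> theta (Suc q) < x \<and> x < theta q + pi"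
proof -
  have "Im (cnj (corner q) * side q) > 0" "Im (cnj (corner (Suc q)) * side q) > 0"
    using corner_cross[of q] by (simp_all add: side_def algebra_simps)
  from angle_between[OF has_angle_theta this(1)] obtain x
    where x: "has_angle (side q) x" "theta q < x" "x < theta q + pi" .
  have "sin (x - theta (Suc q)) > 0"
    using Im_cnj_mult_pos_iff[OF has_angle_theta x(1)] \<open>Im (cnj (corner (Suc q)) * side q) > 0\<close> by blast
  moreover have "x - theta (Suc q) > - pi" using x theta_Suc[of q] by auto
  ultimately have "theta (Suc q) < x"
    using sin_ge_zero[of "theta (Suc q) - x"] sin_minus[of "theta (Suc q) - x"] by force
  then show ?thesis using x by blast
qed

definition side_angle :: "nat \<Rightarrow> real" where
  "side_angle q = (SOME x. has_angle (side q) x \<and> theta (Suc q) < x \<and> x < theta q + pi)"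

lemma side_angle: "has_angle (side q) (side_angle q)" "theta (Suc q) < side_angle q" "side_angle q < theta q + pi"
  using someI_ex[OF exists_side_angle[of q]] by (auto simp: side_angle_def)

text \<open>Consecutive angles along this counterclockwise chain stay less than \<open>pi\<close>
  apart, so the product telescopes to the gauges of its two ends, taken with the lifted
  angles.\<close>

lemma turn_sign_sides: "0 < k \<Longrightarrow> turn_sign (corner j) (side j) * path_sign (map side [j..<j + k])
   = angle_gauge (corner j) (theta j) * angle_gauge (side (j + k - 1)) (side_angle (j + k - 1))"
proof (induction k)
  case (Suc k)
  show ?case
  proof (cases k)
    case 0
    have "turn_sign (corner j) (side j) = angle_gauge (corner j) (theta j) * angle_gauge (side j) (side_angle j)"
      using side_angle[of j] theta_Suc[of j] by (intro turn_sign_near has_angle_theta) auto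
    then show ?thesis using 0 by simp
  next
    case (Suc l)
    define r where "r = j + l"
    have "turn_sign (side r) (side (Suc r)) =
      angle_gauge (side r) (side_angle r) * angle_gauge (side (Suc r)) (side_angle (Suc r))"
      using side_angle[of r] side_angle[of "Suc r"] theta_Suc[of r] theta_Suc[of "Suc r"]
      by (intro turn_sign_near) (auto simp: abs_if)
    moreover have "path_sign (map side [j..<j + Suc k]) = path_sign (map side [j..<j + k]) * turn_sign (side r) (side (Suc r))"
    proof -
      have "map side [j..<j + Suc k] = map side [j..<j + k] @ [side (Suc r)]"
        using Suc by (simp add: r_def)
      moreover have "last (map side [j..<j + k]) = side r" using Suc by (simp add: last_map r_def)
      moreover have "map side [j..<j + k] \<noteq> []" using Suc by simp
      ultimately show ?thesis by (simp only: path_sign_append not_Cons_self2 list.sel(1) path_sign.simps mult_1_right not_False_eq_True)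
    qed
    moreover have "turn_sign (corner j) (side j) * path_sign (map side [j..<j + k])
       = angle_gauge (corner j) (theta j) * angle_gauge (side r) (side_angle r)"
      using Suc.IH Suc by (simp add: r_def)
    ultimately show ?thesis using Suc
      by (simp add: r_def mult.assoc[symmetric] del: upt_Suc)
  qed
qed simp

end

lemma dirs_scaleR: "dirs (map (\<lambda>z. c *\<^sub>R z) r) = map (\<lambda>z. c *\<^sub>R z) (dirs r)"
  by (induction r rule: dirs.induct) (auto simp: scaleR_diff_right)

lemma path_sign_scaleR: "0 < c \<Longrightarrow> path_sign (map (\<lambda>z. c *\<^sub>R z) ds) = path_sign ds"
  by (induction ds rule: path_sign.induct) (auto simp: turn_sign_scaleR)

lemma non_opposite_scaleR:
  assumes "0 < a" "0 < b"
  shows "non_opposite (a *\<^sub>R u) (b *\<^sub>R v) \<longleftrightarrow> non_opposite u v"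
proof -
  have *: "\<exists>c>0. y = - (c *\<^sub>R x)" if "\<exists>c>0. r *\<^sub>R y = - (c *\<^sub>R s *\<^sub>R x)" "0 < r" "0 < s"
    for r s :: real and x y :: complex
  proof -
    from that obtain c where c: "0 < c" "r *\<^sub>R y = - (c *\<^sub>R s *\<^sub>R x)" by auto
    have "y = inverse r *\<^sub>R r *\<^sub>R y" using that by simp
    also have "\<dots> = - ((inverse r * c * s) *\<^sub>R x)" unfolding c by simp
    finally show ?thesis using c that by (intro exI[of _ "inverse r * c * s"]) simp
  qed
  have **: "u = inverse a *\<^sub>R a *\<^sub>R u" "v = inverse b *\<^sub>R b *\<^sub>R v" using assms by simp_all
  have "(\<exists>c>0. b *\<^sub>R v = - (c *\<^sub>R a *\<^sub>R u)) \<longleftrightarrow> (\<exists>c>0. v = - (c *\<^sub>R u))"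
    using *[of b v a u] *[of "inverse b" "b *\<^sub>R v" "inverse a" "a *\<^sub>R u"] assms by auto
  then show ?thesis using assms by (auto simp: non_opposite_def)
qed

context disk
begin

lemma non_opposite_sides: "non_opposite (side q) (side (Suc q))"
proof (rule non_opposite_Im)
  have "Suc (Suc q) mod L \<noteq> q mod L" "Suc (Suc q) mod L \<noteq> Suc q mod L"
    using L mod_add_eq_imp[of q 2] mod_add_eq_imp[of "Suc q" 1] by fastforce+
  from side_corner[OF this]
  have "0 < Im (cnj (side q) * (corner (Suc (Suc q)) - corner q))" .
  also have "\<dots> = Im (cnj (side q) * side (Suc q))" by (simp add: side_def algebra_simps)
  finally show "Im (cnj (side q) * side (Suc q)) \<noteq> 0" by simp
qed

text \<open>The factor \<open>c\<close> allows for the dilated polygon of the glued network;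
  positive scaling of directions changes no turn sign.\<close>

lemma dirs_boundary_path:
  fixes c :: real
  assumes "i < L" "j < L"
  shows "dirs (boundary_path (map (\<lambda>z. c *\<^sub>R z) Q) j i @ [c *\<^sub>R Q ! i])
     = map (\<lambda>z. c *\<^sub>R z) (map side [j..<j + (i + L - j) mod L])"
proof -
  define k where "k = (i + L - j) mod L"
  have "(j + k) mod L = (j + (i + L - j)) mod L" unfolding k_def by (simp add: mod_add_right_eq)
  then have i: "(j + k) mod L = i" using assms by simp
  have *: "boundary_path (map (\<lambda>z. c *\<^sub>R z) Q) j i @ [c *\<^sub>R Q ! i] = map (\<lambda>z. c *\<^sub>R z) (map corner [j..<Suc (j + k)])"
  proof (rule nth_equalityI)
    show "length (boundary_path (map (\<lambda>z. c *\<^sub>R z) Q) j i @ [c *\<^sub>R Q ! i]) =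
        length (map (\<lambda>z. c *\<^sub>R z) (map corner [j..<Suc (j + k)]))"
      by (simp add: boundary_path_def k_def)
    fix t assume "t < length (boundary_path (map (\<lambda>z. c *\<^sub>R z) Q) j i @ [c *\<^sub>R Q ! i])"
    then have t: "t < Suc k" by (simp add: boundary_path_def k_def)
    show "(boundary_path (map (\<lambda>z. c *\<^sub>R z) Q) j i @ [c *\<^sub>R Q ! i]) ! t = map (\<lambda>z. c *\<^sub>R z) (map corner [j..<Suc (j + k)]) ! t"
    proof (cases "t = k")
      case True
      then show ?thesis using i by (simp add: boundary_path_def k_def[symmetric] corner_def nth_append del: upt_Suc)
    next
      case False
      then show ?thesis using t L by (simp add: boundary_path_def k_def[symmetric] corner_def nth_append del: upt_Suc)
    qed
  qed
  have "dirs (map corner [j..<Suc (j + k)]) = map side [j..<j + k]"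
    by (rule nth_equalityI) (auto simp: nth_dirs side_def simp del: upt_Suc)
  then show ?thesis unfolding * dirs_scaleR k_def by simp
qed

text \<open>Going counterclockwise from corner \<open>j\<close> to corner \<open>i\<close>, the angle of the radial direction
  passes the branch point \<open>theta 0\<close> exactly when \<open>i < j\<close>; this contributes the sign.\<close>

lemma turn_sign_boundary:
  assumes ij: "i < L" "j < L" "i \<noteq> j"
    and z: "Im (cnj (side j) * z) < 0" and a: "Im (cnj (side (i + L - 1)) * a) > 0"
  defines "bd \<equiv> map side [j..<j + (i + L - j) mod L]"
  shows "turn_sign z (hd bd) * path_sign bd * turn_sign (last bd) a
     = (if j < i then 1 else - 1) * angle_gauge (corner j) (theta j) * angle_gauge (- corner i) (theta i + pi)
       * turn_sign z (corner j) * turn_sign (- corner i) a"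
    and "successively non_opposite (z # bd @ [a])" "bd \<noteq> []"
proof -
  define k where "k = (i + L - j) mod L"
  have k_cases: "k = (if j < i then i - j else i + L - j)"
    using ij by (auto simp: k_def mod_if)
  have k: "0 < k" using ij by (auto simp: k_cases)
  have bd: "bd = map side [j..<j + k]" by (simp add: bd_def k_def)
  show "bd \<noteq> []" using k by (simp add: bd)
  have hd: "hd bd = side j" using k by (simp add: bd upt_rec)
  have last: "last bd = side (j + k - 1)" using k by (simp add: bd last_map)
  have r: "side (j + k - 1) = side (i + L - 1)"
  proof (cases "j < i")
    case True
    then have "j + k - 1 + L = i + L - 1" by (simp add: k_cases)
    then show ?thesis by (metis side_add_L)
  next
    case False
    then have "j + k = i + L" using ij by (simp add: k_cases)
    then show ?thesis by simp
  qed
  have cz: "Im (cnj (side j) * corner j) < 0"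
    using corner_cross[of j] by (simp add: side_def algebra_simps)
  \<comment> \<open>The final direction \<open>z\<close> and the outward radial direction both point
    to the right of the side that leaves corner \<open>j\<close>, so \<open>z\<close> can be
    exchanged for the radial direction, whose angle is known.\<close>
  have 1: "turn_sign z (hd bd) = turn_sign z (corner j) * turn_sign (corner j) (side j)"
    unfolding hd using turn_sign_halfplane_neg[OF cz z] turn_sign_commute by (metis mult.commute)
  \<comment> \<open>The side with index \<open>i + L - 1\<close> is the one that ends at corner
    \<open>i\<close>; adding \<open>L\<close> avoids a subtraction from \<open>0\<close>. The inward
    radial direction and \<open>a\<close> both point to its left.\<close>
  have e: "corner (Suc (i + L - 1)) = corner i" using L by simp
  have "Im (cnj (side (i + L - 1)) * (- corner i)) = Im (cnj (corner (i + L - 1)) * corner i)"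
    unfolding side_def e by (simp add: algebra_simps)
  then have ci: "Im (cnj (side (i + L - 1)) * (- corner i)) > 0"
    using corner_cross[of "i + L - 1"] e by simp
  have 2: "turn_sign (last bd) a = turn_sign (side (j + k - 1)) (- corner i) * turn_sign (- corner i) a"
    unfolding last r by (rule turn_sign_halfplane[OF ci a])
  have jk: "corner (j + k) = corner i" 
    "theta (j + k) = theta i + (if j < i then 0 else 2 * pi)"
    using ij by (auto simp: k_cases)
  have gp: "angle_gauge (- corner i) (theta (j + k) + pi) = (if j < i then 1 else - 1) * angle_gauge (- corner i) (theta i + pi)"
    using angle_gauge_add_2pi[OF has_angle_uminus[OF has_angle_theta[of i]]] by (auto simp: jk algebra_simps)
  have 3: "turn_sign (side (j + k - 1)) (- corner i)
     = angle_gauge (side (j + k - 1)) (side_angle (j + k - 1)) * angle_gauge (- corner i) (theta (j + k) + pi)"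
  proof (rule turn_sign_near)
    show "has_angle (side (j + k - 1)) (side_angle (j + k - 1))" by (rule side_angle)
    show "has_angle (- corner i) (theta (j + k) + pi)" using has_angle_uminus[OF has_angle_theta] jk by metis
    have "theta (j + k) < side_angle (j + k - 1)" "side_angle (j + k - 1) < theta (j + k - 1) + pi"
      "theta (j + k - 1) < theta (j + k)"
      using side_angle[of "j + k - 1"] theta_Suc[of "j + k - 1"] k by simp_all
    then show "\<bar>theta (j + k) + pi - side_angle (j + k - 1)\<bar> < pi" by auto
  qed
  show "turn_sign z (hd bd) * path_sign bd * turn_sign (last bd) a
     = (if j < i then 1 else - 1) * angle_gauge (corner j) (theta j) * angle_gauge (- corner i) (theta i + pi)
       * turn_sign z (corner j) * turn_sign (- corner i) a"
  proof -
    have "turn_sign z (hd bd) * path_sign bd * turn_sign (last bd) a =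
      turn_sign z (corner j) * (turn_sign (corner j) (side j) * path_sign (map side [j..<j + k])) *
       turn_sign (side (j + k - 1)) (- corner i) * turn_sign (- corner i) a"
      unfolding 1 2 by (simp add: bd)
    also have "\<dots> = turn_sign z (corner j) * angle_gauge (corner j) (theta j) * 
        angle_gauge (- corner i) (theta (j + k) + pi) * turn_sign (- corner i) a"
      unfolding turn_sign_sides[OF k] 3 by (simp add: angle_gauge_def)
    finally show ?thesis unfolding gp by (simp add: mult_ac)
  qed
  have "successively non_opposite bd"
    unfolding successively_conv_nth bd using non_opposite_sides by auto
  moreover have "non_opposite z (hd bd)" unfolding hd
    by (rule non_opposite_Im) (use z in \<open>simp add: algebra_simps\<close>)
  moreover have "non_opposite (last bd) a" unfolding last r
    by (rule non_opposite_Im) (use a in auto)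
  ultimately show "successively non_opposite (z # bd @ [a])"
    using \<open>bd \<noteq> []\<close> by (simp add: successively_append_iff successively_Cons)
qed

text \<open>The sign of a path is separated into a factor that depends only on its end points and
  the turn signs of the path itself, continued by radial directions at both ends. Only the second
  part varies with the path, and it is a product over its corners.\<close>

lemma conc_closed_walk:
  fixes c :: real and r :: "complex list"
  assumes ij: "i < L" "j < L" "i \<noteq> j" and c: "0 < c"
    and r: "2 \<le> length r" "hd r = c *\<^sub>R corner i" "last r = c *\<^sub>R corner j"
    and z: "Im (cnj (side j) * last (dirs r)) < 0" and a: "Im (cnj (side (i + L - 1)) * hd (dirs r)) > 0"
    and turns: "successively non_opposite (dirs r)"
  shows "(- 1) ^ (conc (butlast r @ boundary_path (map (\<lambda>z. c *\<^sub>R z) Q) j i) + 1)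
     = (if j < i then - 1 else 1) * angle_gauge (corner j) (theta j) * angle_gauge (- corner i) (theta i + pi)
       * turn_sign (- corner i) (hd (dirs r)) * path_sign (dirs r) * turn_sign (last (dirs r)) (corner j)"
proof -
  define bp where "bp = boundary_path (map (\<lambda>z. c *\<^sub>R z) Q) j i"
  define bd where "bd = map side [j..<j + (i + L - j) mod L]"
  define cbd where "cbd = map (\<lambda>z. c *\<^sub>R z) bd"
  define C where "C = butlast r @ bp"
  note B = turn_sign_boundary[OF ij z a, folded bd_def]
  have r0: "r \<noteq> []" "dirs r \<noteq> []" using r by auto
  have d: "dirs (bp @ [c *\<^sub>R Q ! i]) = cbd"
    unfolding bp_def cbd_def bd_def using dirs_boundary_path ij by simp
  have "bp \<noteq> []" using B(3) by (auto simp: bp_def bd_def boundary_path_def)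
  have hdbp: "hd bp = c *\<^sub>R corner j"
  proof -
    have "hd bp = bp ! 0" using \<open>bp \<noteq> []\<close> by (simp add: hd_conv_nth)
    also have "\<dots> = c *\<^sub>R corner j"
      using \<open>bp \<noteq> []\<close> ij L by (auto simp: bp_def boundary_path_def corner_def)
    finally show ?thesis .
  qed
  have "hd C = c *\<^sub>R Q ! i"
  proof -
    have "butlast r \<noteq> []" using r by (cases r; cases "tl r") auto
    then have "hd C = hd r" by (cases r) (auto simp: C_def)
    then show ?thesis using r ij by (simp add: corner_def)
  qed
  then have "C @ [hd C] = butlast r @ bp @ [c *\<^sub>R Q ! i]" by (simp add: C_def)
  also have "\<dots> = butlast r @ last r # tl (bp @ [c *\<^sub>R Q ! i])"
    using \<open>bp \<noteq> []\<close> hdbp r by (metis append_Cons list.collapse tl_append2)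
  finally have CC: "dirs (C @ [hd C]) = dirs r @ cbd"
    using dirs_append[of "butlast r" "last r" "tl (bp @ [c *\<^sub>R Q ! i])"] r0 d \<open>bp \<noteq> []\<close> hdbp r(3)
    by (metis append_butlast_last_id append_Cons list.collapse tl_append2)
  have hdC: "hd (dirs (C @ [hd C])) = hd (dirs r)" using CC r0 by simp
  have cbd: "cbd \<noteq> []" "hd cbd = c *\<^sub>R hd bd" "last cbd = c *\<^sub>R last bd"
    using B(3) by (auto simp: cbd_def hd_map last_map)
  have "successively non_opposite (last (dirs r) # cbd @ [hd (dirs r)])"
  proof -
    have "successively non_opposite bd" "non_opposite (last (dirs r)) (hd bd)" "non_opposite (last bd) (hd (dirs r))"
      using B(2,3) by (auto simp: successively_append_iff successively_Cons)
    moreover have "successively non_opposite cbd"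
      unfolding cbd_def successively_map using non_opposite_scaleR[OF c c] \<open>successively non_opposite bd\<close> by simp
    moreover have "non_opposite (last (dirs r)) (hd cbd)" "non_opposite (last cbd) (hd (dirs r))"
      using cbd non_opposite_scaleR[of 1 c "last (dirs r)" "hd bd"] non_opposite_scaleR[of c 1 "last bd" "hd (dirs r)"] c calculation by simp_all
    ultimately show ?thesis using cbd by (simp add: successively_append_iff successively_Cons)
  qed
  then have S: "successively non_opposite (dirs r @ cbd @ [hd (dirs r)])"
    using turns cbd r0 by (auto simp: successively_append_iff successively_Cons)
  have "C \<noteq> []" using \<open>bp \<noteq> []\<close> by (simp add: C_def)
  then have "(- 1) ^ conc C = path_sign (dirs r @ cbd @ [hd (dirs r)])"
    using neg_one_pow_conc[of C] S unfolding hdC unfolding CC by simp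
  also have "\<dots> = path_sign (dirs r) * (turn_sign (last (dirs r)) (hd cbd) * path_sign cbd * turn_sign (last cbd) (hd (dirs r)))"
    using r0 cbd by (simp add: path_sign_append)
  also have "\<dots> = path_sign (dirs r) * (turn_sign (last (dirs r)) (hd bd) * path_sign bd * turn_sign (last bd) (hd (dirs r)))"
    using cbd c by (simp add: turn_sign_scaleR cbd_def path_sign_scaleR)
  finally show ?thesis unfolding B(1) C_def bp_def by (simp add: mult_ac)
qed

end

section \<open>Series in one variable and their values\<close>

definition fls_of_poly :: "'a::field poly \<Rightarrow> 'a fls" where
  "fls_of_poly p = fps_to_fls (fps_of_poly p)"

text \<open>A relation, because a series with a pole at \<open>1\<close> has no value and other
  series are not rational at all. The existence of a denominator that does not vanish at
  \<open>1\<close> is preserved by sums and products.\<close>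

definition has_value :: "'a::field fls \<Rightarrow> 'a \<Rightarrow> bool" where
  "has_value g x \<longleftrightarrow> (\<exists>p q. poly q 1 \<noteq> 0 \<and> fls_of_poly q * g = fls_of_poly p \<and> x = poly p 1 / poly q 1)"

lemma fls_of_poly_mult: "fls_of_poly (p * q) = fls_of_poly p * fls_of_poly q"
  by (simp add: fls_of_poly_def fps_of_poly_mult fls_times_fps_to_fls)

lemma fls_of_poly_add: "fls_of_poly (p + q) = fls_of_poly p + fls_of_poly q"
  by (simp add: fls_of_poly_def fps_of_poly_add)

lemma fls_of_poly_eq_iff: "fls_of_poly p = fls_of_poly q \<longleftrightarrow> p = q"
  by (simp add: fls_of_poly_def fps_of_poly_eq_iff)

lemma fls_of_poly_1 [simp]: "fls_of_poly 1 = 1"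
  by (simp add: fls_of_poly_def)

lemma has_valueI: "poly q 1 \<noteq> 0 \<Longrightarrow> fls_of_poly q * g = fls_of_poly p \<Longrightarrow> has_value g (poly p 1 / poly q 1)"
  unfolding has_value_def by blast

lemma has_value_unique:
  assumes "has_value g x" "has_value g y"
  shows "x = y"
proof -
  from assms obtain p q r s where *: "poly q 1 \<noteq> 0" "fls_of_poly q * g = fls_of_poly p" "x = poly p 1 / poly q 1"
    "poly s 1 \<noteq> 0" "fls_of_poly s * g = fls_of_poly r" "y = poly r 1 / poly s 1"
    unfolding has_value_def by blast
  have "fls_of_poly (p * s) = fls_of_poly (r * q)"
    unfolding fls_of_poly_mult *(2,5)[symmetric] by (simp add: mult_ac)
  then have "p * s = r * q" by (simp only: fls_of_poly_eq_iff)
  then have "poly p 1 * poly s 1 = poly r 1 * poly q 1" by (metis poly_mult)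
  then show ?thesis using *(1,4) unfolding *(3,6) by (simp add: frac_eq_eq)
qed

lemma has_value_poly: "has_value (fls_of_poly p) (poly p 1)"
  using has_valueI[of 1 "fls_of_poly p" p] by simp

lemma has_value_const: "has_value (fls_const c) c"
  using has_value_poly[of "[:c:]"] by (simp add: fls_of_poly_def fps_of_poly_const)

lemma has_value_0: "has_value 0 0"
  using has_value_const[of 0] by simp

lemma has_value_1: "has_value 1 1"
  using has_value_const[of 1] by simp

lemma has_value_X: "has_value fls_X 1"
  using has_value_poly[of "[:0, 1:]"] by (simp add: fls_of_poly_def fps_of_poly_fps_X)

lemma has_value_inverse_X: "has_value (inverse fls_X) 1"
proof -
  have "fls_of_poly [:0, 1:] * inverse fls_X = (fls_of_poly 1 :: 'a fls)"
    by (simp add: fls_of_poly_def fps_of_poly_fps_X)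
  then show ?thesis using has_valueI[of "[:0, 1:]" "inverse fls_X" 1] by simp
qed

lemma has_value_add:
  assumes "has_value g x" "has_value h y"
  shows "has_value (g + h) (x + y)"
proof -
  from assms obtain p q r s where *: "poly q 1 \<noteq> 0" "fls_of_poly q * g = fls_of_poly p" "x = poly p 1 / poly q 1"
    "poly s 1 \<noteq> 0" "fls_of_poly s * h = fls_of_poly r" "y = poly r 1 / poly s 1"
    unfolding has_value_def by blast
  have "fls_of_poly (q * s) * (g + h) = fls_of_poly (p * s + r * q)"
    unfolding fls_of_poly_mult fls_of_poly_add *(2,5)[symmetric] by (simp add: algebra_simps)
  from has_valueI[OF _ this] *(1,4) show ?thesis unfolding *(3,6) by (simp add: add_frac_eq mult.commute)
qed

lemma has_value_mult:
  assumes "has_value g x" "has_value h y"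
  shows "has_value (g * h) (x * y)"
proof -
  from assms obtain p q r s where *: "poly q 1 \<noteq> 0" "fls_of_poly q * g = fls_of_poly p" "x = poly p 1 / poly q 1"
    "poly s 1 \<noteq> 0" "fls_of_poly s * h = fls_of_poly r" "y = poly r 1 / poly s 1"
    unfolding has_value_def by blast
  have "fls_of_poly (q * s) * (g * h) = fls_of_poly (p * r)"
    unfolding fls_of_poly_mult *(2,5)[symmetric] by (simp add: mult_ac)
  from has_valueI[OF _ this] * show ?thesis by simp
qed

lemma has_value_of_int: "has_value (of_int c) (of_int c)"
  using has_value_const[of "of_int c"] by (simp add: fls_of_int)

lemma has_value_sum:
  "finite A \<Longrightarrow> (\<And>a. a \<in> A \<Longrightarrow> has_value (g a) (x a)) \<Longrightarrow> has_value (sum g A) (sum x A)"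
  by (induction A rule: finite_induct) (auto intro: has_value_add has_value_0)

section \<open>Specialising the edge variables to powers of one variable\<close>

definition edge_degree :: "'k edge \<Rightarrow> nat" where
  "edge_degree e = length (fst e) - 1"

definition mset_degree :: "'k edge multiset \<Rightarrow> nat" where
  "mset_degree m = (\<Sum>e\<in>#m. edge_degree e)"

definition mset_weight :: "'k::field edge multiset \<Rightarrow> 'k" where
  "mset_weight m = (\<Prod>e\<in>#m. snd e)"

text \<open>The image of a formal series under the substitution of \<open>w t^s\<close> for the
  variable of an edge. A coefficient to which infinitely many monomials contribute would be
  \<open>0\<close> by the convention for sums; \<open>finite_degrees\<close> rules this out.\<close>

definition series_at :: "('k::field edge multiset \<Rightarrow> int) \<Rightarrow> 'k fps" where
  "series_at g = Abs_fps (\<lambda>n. \<Sum>m\<in>{m. g m \<noteq> 0 \<and> mset_degree m = n}. of_int (g m) * mset_weight m)"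

definition finite_degrees :: "('k::field edge multiset \<Rightarrow> int) \<Rightarrow> bool" where
  "finite_degrees g \<longleftrightarrow> (\<forall>n. finite {m. g m \<noteq> 0 \<and> mset_degree m = n})"

lemma mset_degree_add: "mset_degree (a + b) = mset_degree a + mset_degree b"
  by (simp add: mset_degree_def)

lemma mset_weight_add: "mset_weight (a + b) = mset_weight a * mset_weight b"
  by (simp add: mset_weight_def)

lemma finite_degrees_poly: "finite_degrees (Poly_Mapping.lookup p)"
proof -
  have "finite {m. Poly_Mapping.lookup p m \<noteq> 0 \<and> mset_degree m = n}" for n
    by (rule finite_subset[of _ "Poly_Mapping.keys p"]) (auto simp: in_keys_iff)
  then show ?thesis by (simp add: finite_degrees_def)
qed

lemma series_at_poly:
  obtains P where "series_at (Poly_Mapping.lookup p) = fps_of_poly P" "poly P 1 = weight_eval p"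
proof -
  define P where "P = (\<Sum>m\<in>Poly_Mapping.keys p. monom (of_int (Poly_Mapping.lookup p m) * mset_weight m) (mset_degree m))"
  have "series_at (Poly_Mapping.lookup p) = fps_of_poly P"
  proof (rule fps_ext)
    fix n
    have "fps_nth (fps_of_poly P) n = (\<Sum>m\<in>Poly_Mapping.keys p. if mset_degree m = n then of_int (Poly_Mapping.lookup p m) * mset_weight m else 0)"
      by (simp add: P_def coeff_sum)
    also have "\<dots> = (\<Sum>m\<in>{m\<in>Poly_Mapping.keys p. mset_degree m = n}. of_int (Poly_Mapping.lookup p m) * mset_weight m)"
      by (rule sum.inter_filter[symmetric]) simp
    also have "{m\<in>Poly_Mapping.keys p. mset_degree m = n} = {m. Poly_Mapping.lookup p m \<noteq> 0 \<and> mset_degree m = n}"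
      by (auto simp: in_keys_iff)
    finally show "fps_nth (series_at (Poly_Mapping.lookup p)) n = fps_nth (fps_of_poly P) n"
      by (simp add: series_at_def)
  qed
  moreover have "poly P 1 = weight_eval p"
    by (simp add: P_def poly_sum poly_monom weight_eval_def mset_weight_def)
  ultimately show thesis by (rule that)
qed

lemma finite_submultisets: "finite {a. a \<subseteq># m}"
proof (rule finite_surj)
  show "{a. a \<subseteq># m} \<subseteq> mset ` {xs. set xs \<subseteq> set_mset m \<and> length xs \<le> size m}"
  proof
    fix a assume a: "a \<in> {a. a \<subseteq># m}"
    obtain xs where xs: "a = mset xs" by (metis ex_mset)
    then have "set xs \<subseteq> set_mset m" "length xs \<le> size m"
      using a set_mset_mono[of a m] size_mset_mono[of a m] by auto
    then show "a \<in> mset ` {xs. set xs \<subseteq> set_mset m \<and> length xs \<le> size m}" using xs by blast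
  qed
qed (simp add: finite_lists_length_le)

text \<open>The substitution respects products: pairs of monomials are grouped once by their product
  \<open>m\<close> and once by the degree \<open>i\<close> of the first factor.\<close>

lemma series_at_mult:
  assumes q: "finite_degrees q" and g: "finite_degrees g"
    and p: "\<And>m. (\<Sum>a\<in>{a. a \<subseteq># m}. q a * g (m - a)) = p m"
  shows "series_at p = series_at q * series_at g"
proof (rule fps_ext)
  fix n
  define A where "A i = {m. q m \<noteq> 0 \<and> mset_degree m = i}" for i
  define B where "B i = {m. g m \<noteq> 0 \<and> mset_degree m = i}" for i
  define T where "T = Sigma {0..n} (\<lambda>i. A i \<times> B (n - i))"
  define f where "f a b = of_int (q a * g b) * mset_weight (a + b)" for a b
  define S where "S m = {a. a \<subseteq># m \<and> q a \<noteq> 0 \<and> g (m - a) \<noteq> 0}" for m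
  define F where "F = {m. mset_degree m = n \<and> S m \<noteq> {}}"
  have fA: "finite (A i)" "finite (B i)" for i using q g by (auto simp: finite_degrees_def A_def B_def)
  have fT: "finite T" unfolding T_def using fA by auto
  have "F \<subseteq> (\<lambda>(i, a, b). a + b) ` T"
  proof
    fix m assume "m \<in> F"
    then obtain a where a: "a \<subseteq># m" "q a \<noteq> 0" "g (m - a) \<noteq> 0" "mset_degree m = n" by (auto simp: F_def S_def)
    then have "m = a + (m - a)" by simp
    moreover from this have "mset_degree a + mset_degree (m - a) = n" using a(4) mset_degree_add by metis
    ultimately show "m \<in> (\<lambda>(i, a, b). a + b) ` T" using a
      by (intro image_eqI[of _ _ "(mset_degree a, a, m - a)"]) (auto simp: T_def A_def B_def)
  qed
  then have fF: "finite F" using fT finite_surj by blast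
  have fS: "finite (S m)" for m
  proof (rule finite_subset)
    show "S m \<subseteq> (\<Union>i\<le>mset_degree m. A i)"
    proof
      fix a assume a: "a \<in> S m"
      then have "m = a + (m - a)" by (simp add: S_def)
      then have "mset_degree a \<le> mset_degree m" using mset_degree_add by (metis le_add1)
      then show "a \<in> (\<Union>i\<le>mset_degree m. A i)" using a by (auto simp: S_def A_def)
    qed
    show "finite (\<Union>i\<le>mset_degree m. A i)" using fA by auto
  qed
  have pS: "of_int (p m) * mset_weight m = (\<Sum>a\<in>S m. f a (m - a))" for m
  proof -
    have "finite {a. a \<subseteq># m}" by (rule finite_submultisets)
    then have "(\<Sum>a\<in>{a. a \<subseteq># m}. q a * g (m - a)) = (\<Sum>a\<in>S m. q a * g (m - a))"
      by (intro sum.mono_neutral_right) (auto simp: S_def)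
    then have "of_int (p m) * mset_weight m = (\<Sum>a\<in>S m. of_int (q a * g (m - a)) * mset_weight m)"
      unfolding p[symmetric] by (simp add: sum_distrib_right)
    also have "\<dots> = (\<Sum>a\<in>S m. f a (m - a))"
      by (rule sum.cong) (auto simp: f_def S_def)
    finally show ?thesis .
  qed
  have "fps_nth (series_at p) n = (\<Sum>m\<in>F. of_int (p m) * mset_weight m)"
    unfolding series_at_def fps_nth_Abs_fps
  proof (rule sum.mono_neutral_left[OF fF])
    show "{m. p m \<noteq> 0 \<and> mset_degree m = n} \<subseteq> F"
    proof
      fix m assume m: "m \<in> {m. p m \<noteq> 0 \<and> mset_degree m = n}"
      then have "(\<Sum>a\<in>{a. a \<subseteq># m}. q a * g (m - a)) \<noteq> 0" unfolding p by simp
      then obtain a where "a \<subseteq># m" "q a * g (m - a) \<noteq> 0" by (metis (mono_tags, lifting) mem_Collect_eq sum.neutral)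
      then show "m \<in> F" using m by (auto simp: F_def S_def)
    qed
  qed (auto simp: F_def)
  also have "\<dots> = (\<Sum>(m, a)\<in>Sigma F S. f a (m - a))"
    unfolding pS by (rule sum.Sigma) (use fF fS in auto)
  also have "\<dots> = (\<Sum>(i, a, b)\<in>T. f a b)"
  proof (rule sum.reindex_bij_witness[of _ "\<lambda>(i, a, b). (a + b, a)" "\<lambda>(m, a). (mset_degree a, a, m - a)"])
    fix x assume "x \<in> Sigma F S"
    then obtain m a where x: "x = (m, a)" "m \<in> F" "a \<in> S m" by auto
    then have m: "a + (m - a) = m" "mset_degree m = n" by (auto simp: S_def F_def)
    then have "mset_degree a + mset_degree (m - a) = n" by (metis mset_degree_add)
    then show "(case x of (m, a) \<Rightarrow> (mset_degree a, a, m - a)) \<in> T" using x by (auto simp: T_def A_def B_def S_def)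
    show "(case case x of (m, a) \<Rightarrow> (mset_degree a, a, m - a) of (i, a, b) \<Rightarrow> (a + b, a)) = x" using x m by simp
    show "(case case x of (m, a) \<Rightarrow> (mset_degree a, a, m - a) of (i, a, b) \<Rightarrow> f a b) = (case x of (m, a) \<Rightarrow> f a (m - a))"
      using x by simp
  next
    fix y assume "y \<in> T"
    then obtain i a b where y: "y = (i, a, b)" "i \<le> n" "a \<in> A i" "b \<in> B (n - i)" by (auto simp: T_def)
    then have "a \<in> S (a + b)" "mset_degree (a + b) = n" by (auto simp: S_def A_def B_def mset_degree_add)
    then show "(case y of (i, a, b) \<Rightarrow> (a + b, a)) \<in> Sigma F S"
      using y(1) by (auto simp: F_def)
    show "(case case y of (i, a, b) \<Rightarrow> (a + b, a) of (m, a) \<Rightarrow> (mset_degree a, a, m - a)) = y"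
      using y by (auto simp: A_def)
  qed
  also have "\<dots> = (\<Sum>i=0..n. \<Sum>x\<in>A i \<times> B (n - i). f (fst x) (snd x))"
    unfolding T_def by (subst sum.Sigma) (use fA in \<open>auto simp: case_prod_unfold\<close>)
  also have "\<dots> = (\<Sum>i=0..n. (\<Sum>a\<in>A i. of_int (q a) * mset_weight a) * (\<Sum>b\<in>B (n - i). of_int (g b) * mset_weight b))"
    by (intro sum.cong refl) (simp add: sum_product sum.cartesian_product f_def mset_weight_add case_prod_unfold mult_ac)
  finally show "fps_nth (series_at p) n = fps_nth (series_at q * series_at g) n"
    by (simp add: fps_mult_nth series_at_def A_def B_def)
qed

text \<open>The equation \<open>q g = p\<close> of formal series becomes one between a power series
  and two polynomials in \<open>t\<close>, and at \<open>t = 1\<close> the substituted weights are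
  the actual ones.\<close>

lemma has_value_series_at:
  assumes "finite_degrees g" "represents_fraction g p q" "weight_eval q \<noteq> 0"
  shows "has_value (fps_to_fls (series_at g)) (weight_eval p / weight_eval q)"
proof -
  obtain P where P: "series_at (Poly_Mapping.lookup p) = fps_of_poly P" "poly P 1 = weight_eval p"
    by (rule series_at_poly)
  obtain Q where Q: "series_at (Poly_Mapping.lookup q) = fps_of_poly Q" "poly Q 1 = weight_eval q"
    by (rule series_at_poly)
  have "series_at (Poly_Mapping.lookup p) = series_at (Poly_Mapping.lookup q) * series_at g"
    using assms(2) by (intro series_at_mult finite_degrees_poly assms(1)) (auto simp: represents_fraction_def)
  then have "fls_of_poly Q * fps_to_fls (series_at g) = fls_of_poly P"
    by (simp add: P Q fls_of_poly_def fls_times_fps_to_fls)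
  from has_valueI[OF _ this] show ?thesis using assms(3) P Q by simp
qed

definition walk_degree :: "'k edge list \<Rightarrow> nat" where
  "walk_degree P = sum_list (map edge_degree P)"

definition walk_weight :: "'k::field edge list \<Rightarrow> 'k" where
  "walk_weight P = prod_list (map snd P)"

text \<open>Every edge has at least one segment. Hence the degree bounds the length of a walk, and
  in a finite network only finitely many walks contribute to one power of \<open>t\<close>.\<close>

lemma walk_degree_ge:
  "(\<And>e. e \<in> set P \<Longrightarrow> 2 \<le> length (fst e)) \<Longrightarrow> length P \<le> walk_degree P"
proof (induction P)
  case (Cons e P)
  then have "length P \<le> walk_degree P" "1 \<le> edge_degree e" 
    by (auto simp: edge_degree_def numeral_2_eq_2 Suc_le_eq)
  then show ?case by (simp add: walk_degree_def)
qed (simp add: walk_degree_def)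

lemma finite_walks_degree:
  assumes "finite E" "\<And>e. e \<in> E \<Longrightarrow> 2 \<le> length (fst e)"
  shows "finite {P. walk E P \<and> walk_degree P = n}"
proof (rule finite_subset)
  show "{P. walk E P \<and> walk_degree P = n} \<subseteq> {P. set P \<subseteq> E \<and> length P \<le> n}"
    using walk_degree_ge assms(2) by (auto simp: walk_def)
  show "finite {P. set P \<subseteq> E \<and> length P \<le> n}" by (rule finite_lists_length_le[OF assms(1)])
qed

definition path_series :: "'k::field network \<Rightarrow> nat \<Rightarrow> nat \<Rightarrow> 'k fps" where
  "path_series N i j = Abs_fps (\<lambda>n. \<Sum>P\<in>{P \<in> paths N i j. walk_degree P = n}.
     of_int ((- 1) ^ (conc (closed_path N i j P) + 1)) * walk_weight P)"

text \<open>Paths with the same multiset of edges have the same weight and the same degree, so the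
  sum over multisets is a regrouping of the sum over paths.\<close>

lemma series_at_measurement:
  assumes E: "finite (edges N)" "\<And>e. e \<in> edges N \<Longrightarrow> 2 \<le> length (fst e)"
  shows "finite_degrees (measurement_series N i j)" "series_at (measurement_series N i j) = path_series N i j"
proof -
  define g where "g = measurement_series N i j"
  define sg :: "'a edge list \<Rightarrow> int" where "sg P = (- 1) ^ (conc (closed_path N i j P) + 1)" for P
  define A where "A n = {P \<in> paths N i j. walk_degree P = n}" for n
  have fA: "finite (A n)" for n
    by (rule finite_subset[OF _ finite_walks_degree[OF E, of n]]) (auto simp: A_def paths_def)
  have dg: "mset_degree (mset P) = walk_degree P" "mset_weight (mset P) = walk_weight P" for P :: "'a edge list"
    by (simp_all add: mset_degree_def walk_degree_def mset_weight_def walk_weight_def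
        sum_mset_sum_list prod_mset_prod_list flip: mset_map) 
  have gA: "g m = (\<Sum>P\<in>{P \<in> A (mset_degree m). mset P = m}. sg P)" for m
    unfolding g_def measurement_series_def sg_def by (rule sum.cong) (auto simp: A_def dg)
  have sub: "{m. g m \<noteq> 0 \<and> mset_degree m = n} \<subseteq> mset ` A n" for n
  proof
    fix m assume m: "m \<in> {m. g m \<noteq> 0 \<and> mset_degree m = n}"
    then have "{P \<in> A n. mset P = m} \<noteq> {}" using gA[of m] by (auto simp del: Collect_empty_eq)
    then show "m \<in> mset ` A n" by auto
  qed
  then have "finite {m. g m \<noteq> 0 \<and> mset_degree m = n}" for n
    using fA finite_subset by blast
  then show "finite_degrees (measurement_series N i j)" by (simp add: finite_degrees_def g_def)
  show "series_at (measurement_series N i j) = path_series N i j"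
  proof (rule fps_ext)
    fix n
    have "fps_nth (series_at g) n = (\<Sum>m\<in>mset ` A n. of_int (g m) * mset_weight m)"
      unfolding series_at_def fps_nth_Abs_fps
      by (rule sum.mono_neutral_left) (use fA sub in \<open>auto simp: A_def dg\<close>)
    also have "\<dots> = (\<Sum>m\<in>mset ` A n. \<Sum>P\<in>{P \<in> A n. mset P = m}. of_int (sg P) * walk_weight P)"
    proof (rule sum.cong[OF refl])
      fix m assume "m \<in> mset ` A n"
      then have "mset_degree m = n" by (auto simp: A_def dg)
      then show "of_int (g m) * mset_weight m = (\<Sum>P\<in>{P \<in> A n. mset P = m}. of_int (sg P) * walk_weight P)"
        unfolding gA by (auto simp: sum_distrib_right dg intro!: sum.cong)
    qed
    also have "\<dots> = (\<Sum>P\<in>A n. of_int (sg P) * walk_weight P)"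
      using sum.image_gen[OF fA, of "\<lambda>P. of_int (sg P) * walk_weight P" n mset] by simp
    finally show "fps_nth (series_at (measurement_series N i j)) n = fps_nth (path_series N i j) n"
      by (simp add: path_series_def g_def A_def sg_def)
  qed
qed

text \<open>The uniqueness of values of series also shows that the definite description in
  \<open>measurement\<close> denotes the given \<open>x\<close>.\<close>

lemma has_value_measurement:
  assumes E: "finite (edges N)" "\<And>e. e \<in> edges N \<Longrightarrow> 2 \<le> length (fst e)"
    and x: "has_measurement N i j x"
  shows "has_value (fps_to_fls (path_series N i j)) (measurement N i j)"
proof -
  have v: "has_value (fps_to_fls (path_series N i j)) y" if "has_measurement N i j y" for y
  proof -
    have "finite_degrees (measurement_series N i j)" "series_at (measurement_series N i j) = path_series N i j"
      using series_at_measurement E by blast+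
    then show ?thesis
      using that has_value_series_at[of "measurement_series N i j"] by (auto simp: has_measurement_def)
  qed
  then have "measurement N i j = x"
    unfolding measurement_def using x has_value_unique by blast
  then show ?thesis using v x by simp
qed

section \<open>Currents\<close>

lemma route_Cons: "P \<noteq> [] \<Longrightarrow> fst e \<noteq> [] \<Longrightarrow> head e = tail (hd P) \<Longrightarrow> route (e # P) = fst e @ tl (route P)"
  by (cases "fst e") (auto simp: route_def)

lemma route_single: "2 \<le> length (fst e) \<Longrightarrow> route [e] = fst e"
  by (cases "fst e") (auto simp: route_def)

lemma route_append: "P \<noteq> [] \<Longrightarrow> route (P @ Q) = route P @ concat (map (\<lambda>e. tl (fst e)) Q)"
  by (simp add: route_def)

lemma last_route:
  assumes "P \<noteq> []" "\<And>e. e \<in> set P \<Longrightarrow> 2 \<le> length (fst e)"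
  shows "last (route P) = head (last P)"
proof -
  obtain P' e where P: "P = P' @ [e]" using assms(1) by (metis rev_exhaust)
  have l: "2 \<le> length (fst e)" using assms(2) P by simp
  then have "tl (fst e) \<noteq> []" by (cases "fst e") auto
  then have "last (route P) = last (tl (fst e))" by (simp add: P route_def)
  then show ?thesis using l P by (simp add: last_tl \<open>tl (fst e) \<noteq> []\<close>)
qed

lemma walk_append_single: "walk E (P @ [e]) \<longleftrightarrow> e \<in> E \<and> (P = [] \<or> walk E P \<and> head (last P) = tail e)"
  by (auto simp: walk_def successively_append_iff)

abbreviation first_dir :: "'k edge \<Rightarrow> complex" where
  "first_dir e \<equiv> hd (dirs (fst e))"

abbreviation last_dir :: "'k edge \<Rightarrow> complex" where
  "last_dir e \<equiv> last (dirs (fst e))"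

definition arcs :: "'k edge set \<Rightarrow> bool" where
  "arcs E \<longleftrightarrow> (\<forall>e\<in>E. 2 \<le> length (fst e))"

lemma arcsD: "arcs E \<Longrightarrow> e \<in> E \<Longrightarrow> 2 \<le> length (fst e)"
  by (simp add: arcs_def)

lemma arcs_dirs: "2 \<le> length (fst e) \<Longrightarrow> dirs (fst e) \<noteq> []"
  by auto

lemma walk_edges: "walk E P \<Longrightarrow> e \<in> set P \<Longrightarrow> e \<in> E"
  by (auto simp: walk_def)

lemma dirs_route_append:
  assumes "P \<noteq> []" "\<And>f. f \<in> set P \<Longrightarrow> 2 \<le> length (fst f)" "2 \<le> length (fst e)" "head (last P) = tail e"
  shows "dirs (route (P @ [e])) = dirs (route P) @ dirs (fst e)"
proof -
  have r: "route P \<noteq> []" by (simp add: route_def)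
  have "route (P @ [e]) = butlast (route P) @ last (route P) # tl (fst e)"
    using r assms(1) by (simp add: route_append)
  also have "last (route P) # tl (fst e) = fst e"
    using last_route[OF assms(1,2)] assms(3,4) by (cases "fst e") auto
  finally have "dirs (route (P @ [e])) = dirs (butlast (route P) @ tail e # tl (fst e))"
    using assms(3) by (cases "fst e") auto
  also have "\<dots> = dirs (butlast (route P) @ [last (route P)]) @ dirs (fst e)"
    using last_route[OF assms(1,2)] assms(3,4) by (subst dirs_append) (cases "fst e"; simp)
  finally show ?thesis using r by simp
qed

lemma dirs_route_nonempty: "P \<noteq> [] \<Longrightarrow> (\<And>f. f \<in> set P \<Longrightarrow> 2 \<le> length (fst f)) \<Longrightarrow> dirs (route P) \<noteq> []"
proof -
  assume P: "P \<noteq> []" "\<And>f. f \<in> set P \<Longrightarrow> 2 \<le> length (fst f)"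
  then have "2 \<le> length (fst (hd P))" by simp
  then show ?thesis using P(1) by (cases P; cases "fst (hd P)"; cases "tl (fst (hd P))") (auto simp: route_def)
qed

lemma dirs_route_ends:
  assumes "walk E P" "arcs E"
  shows "hd (dirs (route P)) = first_dir (hd P)" "last (dirs (route P)) = last_dir (last P)"
  using assms
proof (induction P rule: rev_induct)
  case (snoc e P)
  {
    case 1
    show ?case
    proof (cases "P = []")
      case True
      then show ?thesis using 1 by (auto simp: route_single walk_def arcs_def)
    next
      case False
      then have w: "walk E P" "e \<in> E" "head (last P) = tail e" using 1 by (auto simp: walk_append_single)
      have "dirs (route P) \<noteq> []" using dirs_route_nonempty[OF False] w 1 by (auto simp: walk_def arcs_def)
      then show ?thesis
        using snoc.IH(1)[OF w(1) 1(2)] False w 1(2) dirs_route_append[of P e] walk_edges[OF w(1)]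
        by (auto simp: arcs_def)
    qed
  next
    case 2
    show ?case
    proof (cases "P = []")
      case True
      then show ?thesis using 2 by (auto simp: route_single walk_def arcs_def)
    next
      case False
      then have w: "walk E P" "e \<in> E" "head (last P) = tail e" using 2 by (auto simp: walk_append_single)
      then show ?thesis
        using False w 2(2) dirs_route_append[of P e] walk_edges[OF w(1)] arcs_dirs[of e]
        by (auto simp: arcs_def)
    qed
  }
qed (auto simp: walk_def)

lemma walk_degree_append [simp]: "walk_degree (P @ [e]) = walk_degree P + edge_degree e"
  by (simp add: walk_degree_def)

lemma walk_weight_append [simp]: "walk_weight (P @ [e]) = walk_weight P * snd e"
  by (simp add: walk_weight_def)

text \<open>The start \<open>v\<close> is entered in direction \<open>d\<close>. The exponent counts straight segments rather
  than edges, so that it does not change when edges are merged.\<close>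

definition walks_to :: "'k edge set \<Rightarrow> complex \<Rightarrow> 'k edge \<Rightarrow> nat \<Rightarrow> 'k edge list set" where
  "walks_to E v e n = {P. walk E P \<and> tail (hd P) = v \<and> last P = e \<and> walk_degree P = n}"

text \<open>The last edge of a walk is included but the turn out of it is not; the turn into the
  first edge is measured from \<open>d\<close>.\<close>

definition current :: "'k::field edge set \<Rightarrow> complex \<Rightarrow> complex \<Rightarrow> 'k edge \<Rightarrow> 'k fps" where
  "current E v d e = Abs_fps (\<lambda>n. \<Sum>P\<in>walks_to E v e n. of_int (path_sign (d # dirs (route P))) * walk_weight P)"

definition edge_factor :: "'k::field edge \<Rightarrow> 'k fps" where
  "edge_factor e = fps_const (of_int (path_sign (dirs (fst e))) * snd e) * fps_X ^ edge_degree e"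

text \<open>The first summand accounts for the empty walk, which is at \<open>v\<close> before any
  edge has been traversed.\<close>

definition vertex_current :: "'k::field edge set \<Rightarrow> complex \<Rightarrow> complex \<Rightarrow> complex \<Rightarrow> complex \<Rightarrow> 'k fps" where
  "vertex_current E v d u c = (if u = v then of_int (turn_sign d c) else 0) +
     (\<Sum>f\<in>{f \<in> E. head f = u}. current E v d f * of_int (turn_sign (last_dir f) c))"

lemma finite_walks_to:
  assumes "finite E" "arcs E"
  shows "finite (walks_to E v e n)"
  by (rule finite_subset[OF _ finite_walks_degree[OF assms(1), of n]])
    (use assms(2) in \<open>auto simp: walks_to_def arcs_def\<close>)

lemma fps_nth_edge_factor_mult:
  "fps_nth (edge_factor e * g) n =
     (if n < edge_degree e then 0 else of_int (path_sign (dirs (fst e))) * snd e * fps_nth g (n - edge_degree e))"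
  by (simp add: edge_factor_def mult.assoc fps_X_power_mult_nth)

lemma fps_nth_current: "fps_nth (current E v d e) n = (\<Sum>P\<in>walks_to E v e n. of_int (path_sign (d # dirs (route P))) * walk_weight P)"
  by (simp add: current_def)

lemma path_sign_Cons: "ds \<noteq> [] \<Longrightarrow> path_sign (d # ds) = turn_sign d (hd ds) * path_sign ds"
  by (cases ds) auto

lemma walks_to_split:
  assumes "arcs E" "e \<in> E"
  shows "walks_to E v e n = (if tail e = v \<and> edge_degree e = n then {[e]} else {}) \<union>
    (if n < edge_degree e then {} else (\<Union>f\<in>{f\<in>E. head f = tail e}. (\<lambda>P. P @ [e]) ` walks_to E v f (n - edge_degree e)))"
proof (intro equalityI subsetI)
  fix P assume P: "P \<in> walks_to E v e n"
  then have "P \<noteq> []" "last P = e" by (auto simp: walks_to_def walk_def)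
  then obtain P' where P': "P = P' @ [e]" by (metis append_butlast_last_id)
  show "P \<in> (if tail e = v \<and> edge_degree e = n then {[e]} else {}) \<union>
    (if n < edge_degree e then {} else (\<Union>f\<in>{f\<in>E. head f = tail e}. (\<lambda>P. P @ [e]) ` walks_to E v f (n - edge_degree e)))"
  proof (cases "P' = []")
    case True
    then show ?thesis using P P' by (auto simp: walks_to_def walk_degree_def)
  next
    case False
    then have w: "walk E P'" "head (last P') = tail e" "walk_degree P' + edge_degree e = n" "tail (hd P') = v"
      using P by (auto simp: walks_to_def P' walk_append_single)
    then have "last P' \<in> E" using False by (auto simp: walk_def)
    moreover have "P' \<in> walks_to E v (last P') (n - edge_degree e)"
      using w by (auto simp: walks_to_def)
    moreover have "\<not> n < edge_degree e" using w by linarith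
    moreover have "P \<in> (\<Union>f\<in>{f\<in>E. head f = tail e}. (\<lambda>P. P @ [e]) ` walks_to E v f (n - edge_degree e))"
      using calculation w(2) by (intro UN_I[of "last P'"]) (auto simp: P')
    ultimately show ?thesis by simp
  qed
next
  fix P assume P: "P \<in> (if tail e = v \<and> edge_degree e = n then {[e]} else {}) \<union>
    (if n < edge_degree e then {} else (\<Union>f\<in>{f\<in>E. head f = tail e}. (\<lambda>P. P @ [e]) ` walks_to E v f (n - edge_degree e)))"
  then consider "P = [e]" "tail e = v" "edge_degree e = n"
    | f P' where "f \<in> E" "head f = tail e" "P = P' @ [e]" "P' \<in> walks_to E v f (n - edge_degree e)" "edge_degree e \<le> n"
    by (auto split: if_splits)
  then show "P \<in> walks_to E v e n"
  proof cases
    case 1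
    then show ?thesis using assms by (auto simp: walks_to_def walk_def walk_degree_def)
  next
    case 2
    then have "P' \<noteq> []" by (auto simp: walks_to_def walk_def)
    then show ?thesis using 2 assms by (auto simp: walks_to_def walk_append_single)
  qed
qed

text \<open>Removal of the last edge: either it is the whole walk, or it is preceded by a walk that
  ends at its tail. Since walks may run through cycles, this is a linear system rather than a
  recursion over the network.\<close>

lemma current_eq:
  assumes E: "finite E" "arcs E" and e: "e \<in> E"
  shows "current E v d e = edge_factor e * vertex_current E v d (tail e) (first_dir e)"
proof (rule fps_ext)
  fix n
  define t where "t P = (of_int (path_sign (d # dirs (route P))) * walk_weight P)" for P :: "'a edge list"
  define F where "F = {f\<in>E. head f = tail e}"
  define k where "k = edge_degree e"
  define c where "c = of_int (path_sign (dirs (fst e))) * snd e"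
  have fF: "finite F" using E by (simp add: F_def)
  have le: "2 \<le> length (fst e)" using E e by (simp add: arcs_def)
  have k: "k \<ge> 1" using le by (auto simp: k_def edge_degree_def)
  have t_ext: "t (P @ [e]) = t P * of_int (turn_sign (last_dir f) (first_dir e)) * c"
    if "f \<in> F" "P \<in> walks_to E v f m" for f P m
  proof -
    have P: "walk E P" "last P = f" "P \<noteq> []" "head (last P) = tail e" using that by (auto simp: walks_to_def walk_def F_def)
    have ed: "\<And>g. g \<in> set P \<Longrightarrow> 2 \<le> length (fst g)" using P(1) E(2) by (auto simp: walk_def arcs_def)
    have "dirs (route (P @ [e])) = dirs (route P) @ dirs (fst e)"
      using dirs_route_append[OF P(3) ed le P(4)] .
    moreover have "path_sign ((d # dirs (route P)) @ dirs (fst e)) = 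
       path_sign (d # dirs (route P)) * turn_sign (last_dir f) (first_dir e) * path_sign (dirs (fst e))"
      using arcs_dirs[OF le] dirs_route_nonempty[OF P(3) ed] dirs_route_ends(2)[OF P(1) E(2)] P(2)
      by (subst path_sign_append) auto
    ultimately show ?thesis by (simp add: t_def c_def)
  qed
  have t1: "t [e] = of_int (turn_sign d (first_dir e)) * c"
    using arcs_dirs[OF le] by (simp add: t_def c_def route_single[OF le] path_sign_Cons walk_weight_def)
  define S1 where "S1 = (if tail e = v \<and> k = n then {[e]} else {})"
  define S2 where "S2 = (if n < k then {} else (\<Union>f\<in>F. (\<lambda>P. P @ [e]) ` walks_to E v f (n - k)))"
  have S: "walks_to E v e n = S1 \<union> S2"
    using walks_to_split[OF E(2) e] by (simp add: S1_def S2_def F_def k_def)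
  have "S1 \<inter> S2 = {}" by (auto simp: S1_def S2_def walks_to_def walk_def)
  moreover have "finite S1" "finite S2" using fF finite_walks_to[OF E] by (auto simp: S1_def S2_def)
  ultimately have "fps_nth (current E v d e) n = sum t S1 + sum t S2"
    unfolding fps_nth_current t_def[symmetric] S by (simp add: sum.union_disjoint)
  also have "sum t S1 = (if n < k then 0 else c * fps_nth (if tail e = v then of_int (turn_sign d (first_dir e)) else 0) (n - k))"
    using t1 by (auto simp: S1_def fps_of_int[symmetric] simp del: fps_of_int)
  also have "sum t S2 = (if n < k then 0 else c * fps_nth (\<Sum>f\<in>F. current E v d f * of_int (turn_sign (last_dir f) (first_dir e))) (n - k))"
  proof (cases "n < k")
    case False
    have "sum t S2 = (\<Sum>f\<in>F. sum t ((\<lambda>P. P @ [e]) ` walks_to E v f (n - k)))"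
      unfolding S2_def using False fF finite_walks_to[OF E]
      by (simp, subst sum.UNION_disjoint) (auto simp: walks_to_def)
    also have "\<dots> = (\<Sum>f\<in>F. \<Sum>P\<in>walks_to E v f (n - k). t (P @ [e]))"
      by (rule sum.cong[OF refl], subst sum.reindex) (auto simp: inj_on_def)
    also have "\<dots> = (\<Sum>f\<in>F. \<Sum>P\<in>walks_to E v f (n - k). t P * of_int (turn_sign (last_dir f) (first_dir e)) * c)"
      by (intro sum.cong refl t_ext)
    also have "\<dots> = c * fps_nth (\<Sum>f\<in>F. current E v d f * of_int (turn_sign (last_dir f) (first_dir e))) (n - k)"
      by (simp add: fps_sum_nth fps_nth_current t_def sum_distrib_left sum_distrib_right mult_ac
          fps_of_int[symmetric] del: fps_of_int)
    finally show ?thesis using False by simp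
  qed (simp add: S2_def)
  finally show "fps_nth (current E v d e) n = fps_nth (edge_factor e * vertex_current E v d (tail e) (first_dir e)) n"
    unfolding fps_nth_edge_factor_mult vertex_current_def F_def[symmetric] k_def[symmetric] c_def[symmetric]
    by (simp add: distrib_left)
qed

text \<open>An edge factor is divisible by the variable, so the coefficient of order
  \<open>n\<close> of \<open>D e\<close> involves only coefficients of smaller order, and all of
  them vanish by induction. Hence currents are the only solution of their linear system, cycles or
  not.\<close>

lemma homogeneous_current_zero:
  fixes D :: "'k::field edge \<Rightarrow> 'k fps"
  assumes E: "arcs S" and D: "\<And>e. e \<in> S \<Longrightarrow> D e = edge_factor e * (\<Sum>f\<in>{f\<in>S. head f = tail e}. D f * T f e)"
    and "e \<in> S"
  shows "D e = 0"
proof -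
  have "\<forall>e\<in>S. fps_nth (D e) n = 0" for n
  proof (induction n rule: less_induct)
    case (less n)
    show ?case
    proof
      fix e assume e: "e \<in> S"
      then have k: "edge_degree e \<ge> 1" using E by (force simp: arcs_def edge_degree_def)
      show "fps_nth (D e) n = 0"
      proof (cases "n < edge_degree e")
        case True
        then show ?thesis by (subst D[OF e]) (simp add: fps_nth_edge_factor_mult)
      next
        case False
        have "fps_nth (D f * T f e) (n - edge_degree e) = 0" if "f \<in> S" for f
          unfolding fps_mult_nth using less k False that by (intro sum.neutral) auto
        then have "fps_nth (\<Sum>f\<in>{f\<in>S. head f = tail e}. D f * T f e) (n - edge_degree e) = 0"
          by (simp add: fps_sum_nth)
        then show ?thesis by (subst D[OF e]) (simp add: fps_nth_edge_factor_mult)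
      qed
    qed
  qed
  then show ?thesis using \<open>e \<in> S\<close> by (intro fps_ext) auto
qed

definition walk_series :: "'k::field edge set \<Rightarrow> complex \<Rightarrow> complex \<Rightarrow> complex \<Rightarrow> complex \<Rightarrow> 'k fps" where
  "walk_series E u d v c = Abs_fps (\<lambda>n.
     \<Sum>P\<in>{P. walk E P \<and> tail (hd P) = u \<and> head (last P) = v \<and> walk_degree P = n}.
       of_int (path_sign (d # dirs (route P) @ [c])) * walk_weight P)"

text \<open>The walks are grouped by their last edge; for \<open>u = v\<close> the right side would
  count the empty walk in addition.\<close>

lemma walk_series_eq:
  assumes E: "finite E" "arcs E" and "u \<noteq> v"
  shows "walk_series E u d v c = vertex_current E u d v c"
proof (rule fps_ext)
  fix n
  define F where "F = {f\<in>E. head f = v}"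
  have fF: "finite F" using E by (simp add: F_def)
  have *: "{P. walk E P \<and> tail (hd P) = u \<and> head (last P) = v \<and> walk_degree P = n} = (\<Union>f\<in>F. walks_to E u f n)"
    by (auto simp: walks_to_def F_def walk_def) (meson last_in_set subsetD)
  have s: "path_sign (d # dirs (route P) @ [c]) = path_sign (d # dirs (route P)) * turn_sign (last_dir f) c"
    if "P \<in> walks_to E u f n" for P f
  proof -
    have P: "walk E P" "last P = f" "P \<noteq> []" using that by (auto simp: walks_to_def walk_def)
    then have "dirs (route P) \<noteq> []" using dirs_route_nonempty[OF P(3)] E(2) by (auto simp: walk_def arcs_def)
    then show ?thesis using path_sign_append[of "d # dirs (route P)" "[c]"] dirs_route_ends(2)[OF P(1) E(2)] P(2) by simp
  qed
  have "fps_nth (walk_series E u d v c) n = (\<Sum>f\<in>F. \<Sum>P\<in>walks_to E u f n. of_int (path_sign (d # dirs (route P) @ [c])) * walk_weight P)"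
    unfolding walk_series_def fps_nth_Abs_fps * using fF finite_walks_to[OF E]
    by (subst sum.UNION_disjoint) (auto simp: walks_to_def)
  also have "\<dots> = (\<Sum>f\<in>F. \<Sum>P\<in>walks_to E u f n. of_int (path_sign (d # dirs (route P))) * walk_weight P * of_int (turn_sign (last_dir f) c))"
    by (intro sum.cong refl) (simp add: s mult_ac)
  also have "\<dots> = fps_nth (vertex_current E u d v c) n"
    using \<open>u \<noteq> v\<close> by (simp add: vertex_current_def F_def[symmetric] fps_sum_nth fps_nth_current sum_distrib_right
      fps_of_int[symmetric] del: fps_of_int)
  finally show "fps_nth (walk_series E u d v c) n = fps_nth (vertex_current E u d v c) n" .
qed

section \<open>Merging edges\<close>

lemma subset_image_map:
  assumes "set ys \<subseteq> f ` A"
  shows "\<exists>xs. ys = map f xs \<and> set xs \<subseteq> A"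
  using assms
proof (induction ys)
  case (Cons y ys)
  then obtain x xs where "y = f x" "x \<in> A" "ys = map f xs" "set xs \<subseteq> A" by auto
  then show ?case by (intro exI[of _ "x # xs"]) auto
qed simp

definition contract :: "'k::field edge list \<Rightarrow> 'k edge" where
  "contract P = (route P, walk_weight P)"

text \<open>The walks that become single edges. They are kept as lists because \<open>merge\<close>
  is a set, in which two strands with equal route and weight would coincide; \<open>contract\<close>
  has to be injective before sums can be transported.\<close>

definition strands :: "complex set \<Rightarrow> 'k::field edge set \<Rightarrow> 'k edge list set" where
  "strands G E = {P. walk E P \<and> tail (hd P) \<notin> G \<and> head (last P) \<notin> G \<and> head ` set (butlast P) \<subseteq> G}"

lemma merge_eq: "merge G E = contract ` strands G E"
  by (auto simp: merge_def strands_def contract_def walk_weight_def)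

lemma tl_route: "tl (route P) = concat (map (\<lambda>e. tl (fst e)) P)"
  by (simp add: route_def)

lemma hd_route [simp]: "hd (route P) = tail (hd P)"
  by (simp add: route_def)

lemma tail_contract [simp]: "tail (contract P) = tail (hd P)"
  by (simp add: contract_def)

lemma head_contract: "P \<noteq> [] \<Longrightarrow> (\<And>e. e \<in> set P \<Longrightarrow> 2 \<le> length (fst e)) \<Longrightarrow> head (contract P) = head (last P)"
  by (simp add: contract_def last_route)

lemma route_contract:
  assumes "PP \<noteq> []" "[] \<notin> set PP"
  shows "route (map contract PP) = route (concat PP)"
proof -
  have "tail (hd (map contract PP)) = tail (hd (concat PP))" using assms by (cases PP) auto
  moreover have "concat (map (\<lambda>e. tl (fst e)) (map contract PP)) = concat (map (\<lambda>e. tl (fst e)) (concat PP))"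
    by (induction PP) (auto simp: contract_def tl_route)
  ultimately show ?thesis by (simp add: route_def)
qed

lemma walk_weight_contract: "walk_weight (map contract PP) = walk_weight (concat PP)"
  by (induction PP) (auto simp: walk_weight_def contract_def)

lemma length_route: "P \<noteq> [] \<Longrightarrow> length (route P) = Suc (walk_degree P)"
proof -
  have "length (concat (map (\<lambda>e. tl (fst e)) P)) = walk_degree P"
    by (induction P) (auto simp: walk_degree_def edge_degree_def)
  then show ?thesis by (simp add: route_def)
qed

lemma walk_degree_contract: "[] \<notin> set PP \<Longrightarrow> walk_degree (map contract PP) = walk_degree (concat PP)"
proof (induction PP)
  case (Cons P PP)
  then have "P \<noteq> []" by auto
  then have "edge_degree (contract P) = walk_degree P" by (simp add: contract_def edge_degree_def length_route)
  then show ?case using Cons by (simp add: walk_degree_def)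
qed (simp add: walk_degree_def)

lemma walk_append:
  "P \<noteq> [] \<Longrightarrow> Q \<noteq> [] \<Longrightarrow> walk E (P @ Q) \<longleftrightarrow> walk E P \<and> walk E Q \<and> head (last P) = tail (hd Q)"
  by (auto simp: walk_def successively_append_iff)

lemma walk_concat:
  assumes "arcs E" "PP \<noteq> []" "\<And>P. P \<in> set PP \<Longrightarrow> walk E P"
  shows "walk E (concat PP) \<longleftrightarrow> successively (\<lambda>P Q. head (last P) = tail (hd Q)) PP"
  using assms(2,3)
proof (induction PP)
  case (Cons P PP)
  show ?case
  proof (cases "PP = []")
    case True
    then show ?thesis using Cons by simp
  next
    case False
    then obtain Q QQ where PP: "PP = Q # QQ" by (cases PP) auto
    have "P \<noteq> []" "Q \<noteq> []" using Cons.prems PP by (auto simp: walk_def)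
    then show ?thesis using Cons by (auto simp: PP walk_append)
  qed
qed simp

lemma strands_walk: "P \<in> strands G E \<Longrightarrow> walk E P"
  by (simp add: strands_def)

lemma strands_nonempty: "P \<in> strands G E \<Longrightarrow> P \<noteq> []"
  by (simp add: strands_def walk_def)

lemma walk_contract_iff:
  assumes E: "arcs E" and PP: "PP \<noteq> []" "set PP \<subseteq> strands G E"
  shows "walk (merge G E) (map contract PP) \<longleftrightarrow> walk E (concat PP)"
proof -
  have h: "head (contract P) = head (last P)" if "P \<in> set PP" for P
  proof (rule head_contract)
    show "P \<noteq> []" using that PP strands_nonempty by blast
    show "2 \<le> length (fst e)" if "e \<in> set P" for e
      using walk_edges[OF strands_walk that] \<open>P \<in> set PP\<close> PP E by (auto simp: arcs_def)
  qed
  have "walk (merge G E) (map contract PP) \<longleftrightarrow> successively (\<lambda>P Q. head (contract P) = tail (contract Q)) PP"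
    using PP by (auto simp: walk_def merge_eq successively_map)
  also have "\<dots> \<longleftrightarrow> successively (\<lambda>P Q. head (last P) = tail (hd Q)) PP"
    by (rule successively_cong) (auto simp: h)
  also have "\<dots> \<longleftrightarrow> walk E (concat PP)"
    using walk_concat[OF E PP(1)] PP(2) strands_walk by blast
  finally show ?thesis .
qed

text \<open>The walk is cut after each edge whose head lies outside \<open>G\<close>; the
  assumptions on its two ends make the first and the last piece strands as well.\<close>

lemma exists_strands:
  assumes "walk E P" "tail (hd P) \<notin> G" "head (last P) \<notin> G"
  shows "\<exists>PP. PP \<noteq> [] \<and> set PP \<subseteq> strands G E \<and> concat PP = P"
  using assms
proof (induction "length P" arbitrary: P rule: less_induct)
  case less
  then have "\<exists>e\<in>set P. head e \<notin> G" by (metis last_in_set walk_def)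
  then obtain A e C where P: "P = A @ e # C" "head e \<notin> G" "\<forall>f\<in>set A. head f \<in> G"
    using split_list_first_prop[of P "\<lambda>e. head e \<notin> G"] by auto
  have wA: "walk E (A @ [e])" using less.prems P
    by (cases "C = []") (auto simp: walk_append[of "A @ [e]" C, simplified])
  then have Ae: "A @ [e] \<in> strands G E" using less.prems P
    by (cases A) (auto simp: strands_def)
  show ?case
  proof (cases "C = []")
    case True
    then show ?thesis using Ae P by (intro exI[of _ "[A @ [e]]"]) auto
  next
    case False
    then have "walk E C" "head e = tail (hd C)"
      using less.prems(1) P walk_append[of "A @ [e]" C E] by auto
    moreover have "head (last C) \<notin> G" using less.prems P False by auto
    ultimately obtain PP where "PP \<noteq> []" "set PP \<subseteq> strands G E" "concat PP = C"
      using less.hyps[of C] P by auto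
    then show ?thesis using Ae P by (intro exI[of _ "(A @ [e]) # PP"]) auto
  qed
qed

lemma concat_ends:
  assumes "PP \<noteq> []" "[] \<notin> set PP"
  shows "hd (concat PP) = hd (hd PP)" "last (concat PP) = last (last PP)"
    "set (butlast (concat PP)) = last ` set (butlast PP) \<union> (\<Union>P\<in>set PP. set (butlast P))"
proof -
  show "hd (concat PP) = hd (hd PP)" using assms by (cases PP) auto
  have ne: "concat QQ \<noteq> []" if "QQ \<noteq> []" "[] \<notin> set QQ" for QQ :: "'a list list"
    using that by (cases QQ) auto
  show "last (concat PP) = last (last PP)" using assms
  proof (induction PP)
    case (Cons P PP)
    then show ?case using ne[of PP] by (cases "PP = []") (simp_all add: last_append del: concat_eq_Nil_conv)
  qed simp
  show "set (butlast (concat PP)) = last ` set (butlast PP) \<union> (\<Union>P\<in>set PP. set (butlast P))"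
    using assms
  proof (induction PP)
    case (Cons P PP)
    show ?case
    proof (cases "PP = []")
      case False
      have "P \<noteq> []" using Cons.prems by auto
      then have "set (butlast P @ [last P]) = set P" by simp
      then have "set P = insert (last P) (set (butlast P))" by auto
      moreover have "butlast (concat (P # PP)) = P @ butlast (concat PP)"
        using ne[OF False] Cons.prems by (simp add: butlast_append del: concat_eq_Nil_conv)
      moreover have "set (butlast (concat PP)) = last ` set (butlast PP) \<union> (\<Union>P\<in>set PP. set (butlast P))"
        using Cons False by simp
      ultimately show ?thesis using False by auto
    qed simp
  qed simp
qed

text \<open>This allows a strand to be read off from its route: the first two points identify the
  first edge, whose arc then tells where the next edge begins.\<close>

definition two_point_determined :: "'k edge set \<Rightarrow> bool" where
  "two_point_determined E \<longleftrightarrow> (\<forall>e\<in>E. \<forall>f\<in>E. tail e = tail f \<and> fst e ! 1 = fst f ! 1 \<longrightarrow> e = f)"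

lemma inj_on_route_aux:
  assumes E: "arcs E" "two_point_determined E"
  shows "walk E P \<Longrightarrow> head (last P) \<notin> G \<Longrightarrow> head ` set (butlast P) \<subseteq> G \<Longrightarrow>
    walk E Q \<Longrightarrow> head (last Q) \<notin> G \<Longrightarrow> head ` set (butlast Q) \<subseteq> G \<Longrightarrow> route P = route Q \<Longrightarrow> P = Q"
proof (induction P arbitrary: Q)
  case (Cons e P)
  obtain f Q' where Q: "Q = f # Q'" using Cons.prems by (cases Q) (auto simp: walk_def)
  have ef: "e \<in> E" "f \<in> E" using Cons.prems Q by (auto simp: walk_def)
  have len: "2 \<le> length (fst e)" "2 \<le> length (fst f)" using ef E by (auto simp: arcs_def)
  have r: "route (g # R) ! 1 = fst g ! 1" if "2 \<le> length (fst g)" for g :: "'a edge" and R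
    using that by (cases "fst g"; cases "tl (fst g)") (auto simp: route_def)
  have "e = f"
  proof -
    have "tail e = tail f" using Cons.prems(7) Q by (metis hd_route list.sel(1))
    moreover have "fst e ! 1 = fst f ! 1" using Cons.prems(7) Q r len by metis
    ultimately show ?thesis using E(2) ef by (auto simp: two_point_determined_def)
  qed
  have nn: "P = [] \<longleftrightarrow> Q' = []" using Cons.prems Q \<open>e = f\<close>
    by (cases P; cases Q') auto
  show ?case
  proof (cases "P = []")
    case True
    then show ?thesis using nn Q \<open>e = f\<close> by simp
  next
    case False
    have wP: "walk E P" "head e = tail (hd P)" using Cons.prems(1) False walk_append[of "[e]" P E] by auto
    have wQ: "walk E Q'" "head e = tail (hd Q')" using Cons.prems(4) Q False nn \<open>e = f\<close> walk_append[of "[f]" Q' E] by auto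
    have "tl (route P) = tl (route Q')"
      using Cons.prems(7) Q \<open>e = f\<close> by (simp add: route_def)
    then have "route P = route Q'" using wP wQ by (metis hd_route list.expand route_def list.distinct(1))
    then have "P = Q'" using Cons.IH[of Q'] Cons.prems wP wQ False nn Q by (auto split: if_splits)
    then show ?thesis using Q \<open>e = f\<close> by simp
  qed
qed (simp add: walk_def)

lemma inj_on_contract:
  assumes "arcs E" "two_point_determined E"
  shows "inj_on contract (strands G E)"
proof (rule inj_onI)
  fix P Q assume "P \<in> strands G E" "Q \<in> strands G E" "contract P = contract Q"
  then show "P = Q" using inj_on_route_aux[OF assms, of P G Q] by (simp add: strands_def contract_def)
qed

text \<open>The last head of a strand lies outside \<open>G\<close> and all earlier heads lie in
  \<open>G\<close>, so no strand is a proper prefix of another and a walk has only one decomposition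
  into strands.\<close>

lemma strands_prefix:
  assumes "P @ R = Q @ S" "P \<in> strands G E" "Q \<in> strands G E"
  shows "P = Q"
proof -
  have *: False if P: "P \<in> strands G E" "P = Q @ T" "T \<noteq> []" and Q: "Q \<in> strands G E" for P Q T
  proof -
    have "last Q \<in> set (butlast P)" using P strands_nonempty[OF Q] by (simp add: butlast_append)
    then show False using P Q by (auto simp: strands_def)
  qed
  obtain T where "P = Q @ T \<or> Q = P @ T" using assms(1) append_eq_append_conv2 by metis
  then show ?thesis using *[of P Q T] *[of Q P T] assms by (cases "T = []") auto
qed

lemma inj_on_concat_strands: "inj_on concat {PP. set PP \<subseteq> strands G E}"
proof (rule inj_onI, goal_cases)
  case (1 PP QQ)
  then show ?case
  proof (induction PP arbitrary: QQ)
    case Nil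
    then show ?case using strands_nonempty by (cases QQ) auto
  next
    case (Cons P PP)
    then obtain Q QQ' where QQ: "QQ = Q # QQ'" using strands_nonempty by (cases QQ) auto
    then have "P = Q" using Cons.prems strands_prefix[of P "concat PP" Q "concat QQ'"] by auto
    then show ?case using Cons QQ by auto
  qed
qed

text \<open>Concatenation identifies the walks of the merged network with those walks of the
  original one that start and end outside \<open>G\<close>. Routes and weights are unchanged, and so
  is the degree because it counts segments.\<close>

lemma walk_series_merge:
  fixes E :: "'k::field edge set"
  assumes E: "arcs E" "two_point_determined E" and uv: "u \<notin> G" "v \<notin> G"
  shows "walk_series (merge G E) u d v c = walk_series E u d v c"
proof (rule fps_ext)
  fix n
  define t where "t P = of_int (path_sign (d # dirs (route P) @ [c])) * walk_weight P" for P :: "'k edge list"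
  define X where "X = {PP. PP \<noteq> [] \<and> set PP \<subseteq> strands G E \<and> walk E (concat PP) \<and>
     tail (hd (concat PP)) = u \<and> head (last (concat PP)) = v \<and> walk_degree (concat PP) = n}"
  have ne: "[] \<notin> set PP" "concat PP \<noteq> []" if "PP \<in> X" for PP
    using that strands_nonempty by (auto simp: X_def walk_def)
  have ends: "tail (hd (map contract PP)) = tail (hd (concat PP))" 
     "head (last (map contract PP)) = head (last (concat PP))"
    if "PP \<noteq> []" "set PP \<subseteq> strands G E" for PP
  proof -
    have n: "[] \<notin> set PP" using that strands_nonempty by blast
    then show "tail (hd (map contract PP)) = tail (hd (concat PP))" using that by (cases PP) auto
    have l: "last PP \<in> strands G E" using that by auto
    have "head (contract (last PP)) = head (last (last PP))"
      using walk_edges[OF strands_walk[OF l]] E(1) by (intro head_contract strands_nonempty[OF l]) (auto simp: arcs_def)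
    moreover have "last (concat PP) = last (last PP)"
      using that(1) n by (rule concat_ends)
    ultimately show "head (last (map contract PP)) = head (last (concat PP))"
      using that by (simp add: last_map)
  qed
  have 1: "{P. walk E P \<and> tail (hd P) = u \<and> head (last P) = v \<and> walk_degree P = n} = concat ` X"
  proof (intro equalityI subsetI)
    fix P assume P: "P \<in> {P. walk E P \<and> tail (hd P) = u \<and> head (last P) = v \<and> walk_degree P = n}"
    then obtain PP where "PP \<noteq> []" "set PP \<subseteq> strands G E" "concat PP = P"
      using exists_strands[of E P G] uv by blast
    then show "P \<in> concat ` X" using P unfolding X_def by blast
  qed (auto simp: X_def)
  have 2: "{P. walk (merge G E) P \<and> tail (hd P) = u \<and> head (last P) = v \<and> walk_degree P = n} = map contract ` X"
  proof (intro equalityI subsetI)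
    fix P assume P: "P \<in> {P. walk (merge G E) P \<and> tail (hd P) = u \<and> head (last P) = v \<and> walk_degree P = n}"
    then have "set P \<subseteq> contract ` strands G E" "P \<noteq> []" by (auto simp: walk_def merge_eq)
    then obtain PP where PP: "P = map contract PP" "set PP \<subseteq> strands G E"
      using subset_image_map by metis
    have "PP \<noteq> []" using PP \<open>P \<noteq> []\<close> by auto
    moreover have "[] \<notin> set PP" using PP(2) strands_nonempty by blast
    ultimately have "PP \<in> X"
      using P PP walk_contract_iff[OF E(1) _ PP(2)] ends[OF _ PP(2)] walk_degree_contract[of PP] strands_nonempty
      by (auto simp: X_def)
    then show "P \<in> map contract ` X" using PP by blast
  next
    fix P assume "P \<in> map contract ` X"
    then obtain PP where PP: "P = map contract PP" "PP \<in> X" by blast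
    then show "P \<in> {P. walk (merge G E) P \<and> tail (hd P) = u \<and> head (last P) = v \<and> walk_degree P = n}"
      using walk_contract_iff[OF E(1), of PP] ends[of PP] walk_degree_contract[of PP] ne[of PP]
      by (auto simp: X_def)
  qed
  have i1: "inj_on concat X" by (rule inj_on_subset[OF inj_on_concat_strands]) (auto simp: X_def)
  have i2: "inj_on (map contract) X"
  proof (rule inj_onI)
    fix PP QQ assume "PP \<in> X" "QQ \<in> X" and eq: "map contract PP = map contract QQ"
    then have "inj_on contract (set PP \<union> set QQ)"
      by (intro inj_on_subset[OF inj_on_contract[OF E, of G]]) (simp add: X_def)
    then show "PP = QQ" using eq map_inj_on by blast
  qed
  have "t (map contract PP) = t (concat PP)" if "PP \<in> X" for PP
    using that ne[OF that] unfolding t_def by (simp add: route_contract walk_weight_contract X_def)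
  then show "fps_nth (walk_series (merge G E) u d v c) n = fps_nth (walk_series E u d v c) n"
    unfolding walk_series_def fps_nth_Abs_fps t_def[symmetric] 1 2
    by (simp add: sum.reindex[OF i1] sum.reindex[OF i2])
qed

text \<open>At a point of \<open>G\<close> the continuation is forced, so the first edge determines
  the whole strand; merging a finite set of edges therefore gives a finite set.\<close>

lemma inj_on_hd_strands:
  assumes "\<And>e f. e \<in> E \<Longrightarrow> f \<in> E \<Longrightarrow> tail e = tail f \<Longrightarrow> tail e \<in> G \<Longrightarrow> e = f"
  shows "inj_on hd (strands G E)"
proof -
  have "walk E P \<Longrightarrow> head (last P) \<notin> G \<Longrightarrow> head ` set (butlast P) \<subseteq> G \<Longrightarrow>
    walk E Q \<Longrightarrow> head (last Q) \<notin> G \<Longrightarrow> head ` set (butlast Q) \<subseteq> G \<Longrightarrow> hd P = hd Q \<Longrightarrow> P = Q" for P Q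
  proof (induction P arbitrary: Q)
    case (Cons e P)
    then obtain Q' where Q: "Q = e # Q'" by (cases Q) (auto simp: walk_def)
    have nn: "P = [] \<longleftrightarrow> Q' = []" using Cons.prems Q by (cases P; cases Q') auto
    show ?case
    proof (cases "P = []")
      case False
      have wP: "walk E P" "head e = tail (hd P)" using Cons.prems(1) False walk_append[of "[e]" P E] by auto
      have wQ: "walk E Q'" "head e = tail (hd Q')" using Cons.prems(4) Q False nn walk_append[of "[e]" Q' E] by auto
      have "head e \<in> G" using Cons.prems(3) False by auto
      then have "hd P = hd Q'" using wP wQ False nn by (intro assms) (auto simp: walk_def)
      then have "P = Q'" using Cons.IH[of Q'] Cons.prems wP wQ False nn Q by (auto split: if_splits)
      then show ?thesis using Q by simp
    qed (use nn Q in simp)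
  qed (simp add: walk_def)
  note det = this
  show ?thesis
  proof (rule inj_onI)
    fix P Q assume "P \<in> strands G E" "Q \<in> strands G E" "hd P = hd Q"
    then show "P = Q" using det[of P Q] by (simp add: strands_def)
  qed
qed


lemma finite_merge:
  assumes "finite E" "\<And>e f. e \<in> E \<Longrightarrow> f \<in> E \<Longrightarrow> tail e = tail f \<Longrightarrow> tail e \<in> G \<Longrightarrow> e = f"
  shows "finite (merge G E)"
proof -
  have "hd ` strands G E \<subseteq> E" by (auto simp: strands_def walk_def)
  then have "finite (hd ` strands G E)" using assms(1) finite_subset by blast
  then have "finite (strands G E)" by (rule finite_imageD) (rule inj_on_hd_strands[OF assms(2)])
  then show ?thesis by (simp add: merge_eq)
qed

lemma arcs_merge: "arcs E \<Longrightarrow> arcs (merge G E)"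
  unfolding arcs_def merge_eq
proof (intro ballI)
  fix e assume E: "\<forall>e\<in>E. 2 \<le> length (fst e)" and "e \<in> contract ` strands G E"
  then obtain P where P: "P \<in> strands G E" "e = contract P" by auto
  have "length P \<le> walk_degree P"
    using walk_edges[OF strands_walk[OF P(1)]] E by (intro walk_degree_ge) auto
  then show "2 \<le> length (fst e)"
    using strands_nonempty[OF P(1)] by (cases P) (auto simp: P(2) contract_def length_route)
qed


text \<open>The squares are glued to each other before the result is glued to \<open>N\<close>. A
  strand composed of strands is a strand for the union of the gluing points, so both rounds can be
  performed at once.\<close>

lemma merge_merge:
  assumes E: "arcs E"
  shows "merge G2 (merge G1 E) = merge (G1 \<union> G2) E"
proof (intro equalityI subsetI)
  have h: "head (contract P) = head (last P)" if "P \<in> strands G1 E" for P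
    using walk_edges[OF strands_walk[OF that]] E strands_nonempty[OF that] by (intro head_contract) (auto simp: arcs_def)
  note ends = concat_ends
  {
    fix e assume "e \<in> merge G2 (merge G1 E)"
    then obtain P' where P': "P' \<in> strands G2 (merge G1 E)" "e = contract P'" by (auto simp: merge_eq)
    then have "set P' \<subseteq> contract ` strands G1 E" "P' \<noteq> []" by (auto simp: walk_def merge_eq strands_def)
    then obtain PP where PP: "P' = map contract PP" "set PP \<subseteq> strands G1 E"
      using subset_image_map by metis
    have ne: "PP \<noteq> []" "[] \<notin> set PP" using PP \<open>P' \<noteq> []\<close> strands_nonempty by auto
    have "contract P' = contract (concat PP)"
      using route_contract[OF ne] by (simp add: PP(1) walk_weight_contract contract_def[of "map contract PP"] contract_def[of "concat PP"])
    moreover have "concat PP \<in> strands (G1 \<union> G2) E"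
    proof -
      have "walk E (concat PP)" using P' PP walk_contract_iff[OF E ne(1) PP(2)] by (simp add: strands_def)
      moreover have "hd PP \<in> strands G1 E" "last PP \<in> strands G1 E" using ne PP by auto
      moreover have "tail (hd (hd PP)) \<notin> G2" using P' PP ne by (simp add: strands_def hd_map)
      moreover have "head (last (last PP)) \<notin> G2" using P' PP ne h[of "last PP"] calculation by (simp add: strands_def last_map)
      moreover have "head (last P) \<in> G2" if "P \<in> set (butlast PP)" for P
      proof -
        have "head (contract P) \<in> G2" using P' PP(1) that by (auto simp: strands_def map_butlast[symmetric])
        then show ?thesis using h PP that by (metis in_set_butlastD subsetD)
      qed
      moreover have "head ` set (butlast Q) \<subseteq> G1" if "Q \<in> set PP" for Q
        using that PP(2) by (auto simp: strands_def)
      ultimately show ?thesis unfolding strands_def mem_Collect_eq ends[OF ne] by blast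
    qed
    ultimately show "e \<in> merge (G1 \<union> G2) E" using P' by (auto simp: merge_eq)
  }
  {
    fix e assume "e \<in> merge (G1 \<union> G2) E"
    then obtain P where P: "P \<in> strands (G1 \<union> G2) E" "e = contract P" by (auto simp: merge_eq)
    then obtain PP where PP: "PP \<noteq> []" "set PP \<subseteq> strands G1 E" "concat PP = P"
      using exists_strands[of E P G1] by (auto simp: strands_def)
    have ne: "[] \<notin> set PP" using PP strands_nonempty by auto
    have "contract (map contract PP) = contract P"
      using route_contract[OF PP(1) ne] by (simp add: PP(3)[symmetric] walk_weight_contract contract_def[of "map contract PP"] contract_def[of "concat PP"])
    moreover have "map contract PP \<in> strands G2 (merge G1 E)"
    proof -
      have "walk (merge G1 E) (map contract PP)" using P PP walk_contract_iff[OF E PP(1,2)] by (simp add: strands_def)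
      moreover have "tail (hd (hd PP)) \<notin> G2" "head (last (last PP)) \<notin> G2"
        using P(1) unfolding strands_def PP(3)[symmetric] mem_Collect_eq ends[OF PP(1) ne] by blast+
      moreover have "last PP \<in> strands G1 E" using PP by auto
      moreover have "head (contract Q) \<in> G2" if "Q \<in> set (butlast PP)" for Q
      proof -
        have "head (last Q) \<in> G1 \<union> G2" using P(1) that unfolding strands_def PP(3)[symmetric] mem_Collect_eq ends[OF PP(1) ne] by blast
        moreover have Q: "Q \<in> strands G1 E" using that PP by (meson in_set_butlastD subsetD)
        moreover have "head (last Q) \<notin> G1" using Q by (simp add: strands_def)
        ultimately show ?thesis using h[of Q] by simp
      qed
      moreover have "tail (hd (map contract PP)) = tail (hd (hd PP))" "head (last (map contract PP)) = head (last (last PP))"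
        using PP(1) h[of "last PP"] calculation by (simp_all add: hd_map last_map)
      moreover have "head ` set (butlast (map contract PP)) = (head \<circ> contract) ` set (butlast PP)"
        by (simp add: map_butlast[symmetric] image_image)
      ultimately show ?thesis unfolding strands_def mem_Collect_eq by auto
    qed
    ultimately show "e \<in> merge G2 (merge G1 E)"
      unfolding merge_eq[of G2] P(2) by (intro image_eqI[of _ _ "map contract PP"]) simp_all
  }
qed


lemma contract_single: "2 \<le> length (fst e) \<Longrightarrow> contract [e] = e"
  by (simp add: contract_def route_single walk_weight_def)

lemma strands_touch:
  assumes "P \<in> strands G E" "e \<in> set P"
  shows "P = [e] \<or> tail e \<in> G \<or> head e \<in> G"
proof -
  obtain A C where P: "P = A @ e # C" using assms(2) by (meson split_list)
  show ?thesis
  proof (cases "C = []")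
    case False
    then show ?thesis using assms(1) P by (auto simp: strands_def butlast_append)
  next
    case C: True
    show ?thesis
    proof (cases "A = []")
      case False
      have "walk E (A @ [e])" using assms(1) P C by (simp add: strands_def)
      then have "head (last A) = tail e" using False by (simp add: walk_append_single)
      moreover have "last A \<in> set (butlast P)" using P C False by simp
      ultimately show ?thesis using assms(1) by (auto simp: strands_def)
    qed (use P C in simp)
  qed
qed

text \<open>An edge that does not touch \<open>G\<close> can neither continue a strand nor be
  continued, so it forms a strand alone.\<close>

lemma merge_Un:
  assumes N: "arcs M" "\<And>e. e \<in> M \<Longrightarrow> tail e \<notin> G \<and> head e \<notin> G"
  shows "merge G (M \<union> E) = M \<union> merge G E"
proof -
  have "strands G (M \<union> E) = (\<lambda>e. [e]) ` M \<union> strands G E"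
  proof (intro equalityI subsetI)
    fix P assume P: "P \<in> strands G (M \<union> E)"
    show "P \<in> (\<lambda>e. [e]) ` M \<union> strands G E"
    proof (cases "\<exists>e\<in>M. e \<in> set P")
      case True
      then obtain e where "e \<in> M" "e \<in> set P" by blast
      then have "P = [e]" using strands_touch[OF P \<open>e \<in> set P\<close>] N(2)[OF \<open>e \<in> M\<close>] by simp
      then show ?thesis using \<open>e \<in> M\<close> by simp
    next
      case False
      then have "set P \<subseteq> M \<union> E \<Longrightarrow> set P \<subseteq> E" by blast
      then have "P \<in> strands G E" using P unfolding strands_def walk_def mem_Collect_eq by simp
      then show ?thesis by simp
    qed
  next
    fix P assume "P \<in> (\<lambda>e. [e]) ` M \<union> strands G E"
    then show "P \<in> strands G (M \<union> E)"
    proof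
      assume "P \<in> (\<lambda>e. [e]) ` M"
      then obtain e where "P = [e]" "e \<in> M" by blast
      then show ?thesis using N(2)[of e] by (simp add: strands_def walk_def)
    next
      assume "P \<in> strands G E"
      then show ?thesis unfolding strands_def walk_def by blast
    qed
  qed
  moreover have "contract ` (\<lambda>e. [e]) ` M = M"
  proof -
    have "(\<lambda>e. contract [e]) ` M = (\<lambda>e. e) ` M"
      by (rule image_cong) (use N(1) in \<open>auto simp: arcs_def contract_single\<close>)
    then show ?thesis by (simp add: image_image)
  qed
  ultimately show ?thesis by (simp add: merge_eq image_Un)
qed

lemma tail_map_edge: "fst e \<noteq> [] \<Longrightarrow> tail (map_edge f e) = f (tail e)"
  by (simp add: map_edge_def hd_map)

lemma head_map_edge: "fst e \<noteq> [] \<Longrightarrow> head (map_edge f e) = f (head e)"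
  by (simp add: map_edge_def last_map)

lemma route_map_edge:
  assumes "P \<noteq> []" "\<And>e. e \<in> set P \<Longrightarrow> fst e \<noteq> []"
  shows "route (map (map_edge f) P) = map f (route P)"
proof -
  have "concat (map (\<lambda>e. tl (fst e)) (map (map_edge f) P)) = map f (concat (map (\<lambda>e. tl (fst e)) P))"
    by (induction P) (auto simp: map_edge_def map_tl)
  moreover have "tail (hd (map (map_edge f) P)) = f (tail (hd P))"
    using assms by (simp add: hd_map tail_map_edge)
  ultimately show ?thesis by (simp add: route_def)
qed

lemma contract_map_edge:
  assumes "P \<noteq> []" "\<And>e. e \<in> set P \<Longrightarrow> fst e \<noteq> []"
  shows "contract (map (map_edge f) P) = map_edge f (contract P)"
proof -
  have "walk_weight (map (map_edge f) P) = walk_weight P"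
    by (induction P) (auto simp: walk_weight_def map_edge_def)
  then show ?thesis using route_map_edge[OF assms] by (simp add: contract_def map_edge_def)
qed

text \<open>Injectivity is required only on a set \<open>S\<close> containing the points that occur,
  since \<open>wrap\<close> rounds the label of the line and is not injective on the whole
  plane.\<close>

lemma merge_map_edge:
  assumes E: "arcs E" "\<And>e. e \<in> E \<Longrightarrow> set (fst e) \<subseteq> S" and G: "G \<subseteq> S" and f: "inj_on f S"
  shows "map_edge f ` merge G E = merge (f ` G) (map_edge f ` E)"
proof -
  have ne: "fst e \<noteq> []" if "e \<in> E" for e using arcsD[OF E(1) that] by auto
  have S: "tail e \<in> S" "head e \<in> S" if "e \<in> E" for e using E(2)[OF that] ne[OF that] by auto
  have fG: "f z \<in> f ` G \<longleftrightarrow> z \<in> G" if "z \<in> S" for z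
    using inj_on_image_mem_iff[OF f that G] .
  have feq: "f z = f w \<longleftrightarrow> z = w" if "z \<in> S" "w \<in> S" for z w
    using inj_on_eq_iff[OF f that] .
  have iff: "map (map_edge f) P \<in> strands (f ` G) (map_edge f ` E) \<longleftrightarrow> P \<in> strands G E" if P: "set P \<subseteq> E" for P
  proof (cases "P = []")
    case False
    have PE: "e \<in> E" if "e \<in> set P" for e using that P by blast
    have t: "tail (map_edge f e) = f (tail e)" "head (map_edge f e) = f (head e)" if "e \<in> set P" for e
      using tail_map_edge[OF ne] head_map_edge[OF ne] that P by blast+
    have "successively (\<lambda>e g. head e = tail g) (map (map_edge f) P) \<longleftrightarrow> successively (\<lambda>e g. head e = tail g) P"
      unfolding successively_map
    proof (rule successively_cong)
      fix e g assume "e \<in> set P" "g \<in> set P"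
      then show "(head (map_edge f e) = tail (map_edge f g)) = (head e = tail g)"
        using t(2)[of e] t(1)[of g] feq[of "head e" "tail g"] S(2)[of e] S(1)[of g] PE by simp
    qed simp
    moreover have "set (map (map_edge f) P) \<subseteq> map_edge f ` E" using P by auto
    moreover have "head ` set (butlast (map (map_edge f) P)) \<subseteq> f ` G \<longleftrightarrow> head ` set (butlast P) \<subseteq> G"
    proof -
      have "head (map_edge f e) \<in> f ` G \<longleftrightarrow> head e \<in> G" if "e \<in> set (butlast P)" for e
        using t(2)[of e] fG[of "head e"] S(2)[of e] PE in_set_butlastD[OF that] by simp
      then show ?thesis unfolding map_butlast[symmetric] set_map image_subset_iff by simp
    qed
    moreover have "tail (hd (map (map_edge f) P)) \<in> f ` G \<longleftrightarrow> tail (hd P) \<in> G"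
      "head (last (map (map_edge f) P)) \<in> f ` G \<longleftrightarrow> head (last P) \<in> G"
      using False PE t[of "hd P"] t[of "last P"] fG[of "tail (hd P)"] fG[of "head (last P)"] S[of "hd P"] S[of "last P"]
      by (simp_all add: hd_map last_map)
    ultimately show ?thesis using P False by (auto simp: strands_def walk_def)
  qed (simp add: strands_def walk_def)
  have "strands (f ` G) (map_edge f ` E) = map (map_edge f) ` strands G E"
  proof (intro equalityI subsetI)
    fix Q assume Q: "Q \<in> strands (f ` G) (map_edge f ` E)"
    then have "set Q \<subseteq> map_edge f ` E" by (simp add: strands_def walk_def)
    then obtain P where "Q = map (map_edge f) P" "set P \<subseteq> E" using subset_image_map by metis
    then show "Q \<in> map (map_edge f) ` strands G E" using iff Q by auto
  next
    fix Q assume "Q \<in> map (map_edge f) ` strands G E"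
    then obtain P where "Q = map (map_edge f) P" "P \<in> strands G E" by blast
    moreover have "set P \<subseteq> E" using calculation by (simp add: strands_def walk_def)
    ultimately show "Q \<in> strands (f ` G) (map_edge f ` E)" using iff by simp
  qed
  moreover have "contract (map (map_edge f) P) = map_edge f (contract P)" if "P \<in> strands G E" for P
    using that ne strands_nonempty[OF that] by (intro contract_map_edge) (auto simp: strands_def walk_def)
  ultimately show ?thesis unfolding merge_eq by (simp add: image_image cong: image_cong)
qed

section \<open>Reversal of lines and its compatibility with merging\<close>

definition on_line :: "nat set \<Rightarrow> 'k edge \<Rightarrow> bool" where
  "on_line I e \<longleftrightarrow> (\<exists>i\<in>I. \<forall>z\<in>set (fst e). Im z = real i)"

definition reverse_edge :: "nat set \<Rightarrow> 'k::field edge \<Rightarrow> 'k edge" where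
  "reverse_edge I e = (if on_line I e then (rev (fst e), inverse (snd e)) else e)"

lemma on_line_iff:
  assumes "fst e \<noteq> []" "\<forall>z\<in>set (fst e). Im z = y"
  shows "on_line I e \<longleftrightarrow> (\<exists>i\<in>I. y = real i)"
proof
  assume "on_line I e"
  then obtain i where "i \<in> I" "\<forall>z\<in>set (fst e). Im z = real i" by (auto simp: on_line_def)
  moreover have "hd (fst e) \<in> set (fst e)" using assms(1) by simp
  ultimately show "\<exists>i\<in>I. y = real i" using assms(2) by metis
next
  assume "\<exists>i\<in>I. y = real i"
  then show "on_line I e" using assms(2) unfolding on_line_def by metis
qed

lemma reverse_paths_eq: "reverse_paths I E = reverse_edge I ` E"
  unfolding reverse_paths_def
proof (rule image_cong[OF refl])
  fix e :: "'a edge"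
  obtain r w where "e = (r, w)" by (cases e)
  then show "(case e of (r, w) \<Rightarrow> if \<exists>i\<in>I. \<forall>z\<in>set r. Im z = real i then (rev r, inverse w) else (r, w)) = reverse_edge I e"
    unfolding reverse_edge_def on_line_def by (simp only: prod.case fst_conv snd_conv)
qed

lemma on_line_reverse_edge [simp]: "on_line I (reverse_edge I e) = on_line I e"
  by (auto simp: reverse_edge_def on_line_def)

lemma reverse_edge_involutive [simp]: "reverse_edge I (reverse_edge I e) = e"
proof (cases "on_line I e")
  case True
  then have "on_line I (rev (fst e), inverse (snd e))" by (simp add: on_line_def)
  then show ?thesis using True by (simp add: reverse_edge_def)
qed (simp add: reverse_edge_def)

lemma set_fst_reverse_edge [simp]: "set (fst (reverse_edge I e)) = set (fst e)"
  by (simp add: reverse_edge_def)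

lemma length_fst_reverse_edge [simp]: "length (fst (reverse_edge I e)) = length (fst e)"
  by (simp add: reverse_edge_def)

lemma arcs_reverse: "arcs (reverse_edge I ` E) \<longleftrightarrow> arcs E"
  by (auto simp: arcs_def)

text \<open>Strands with several edges pass through \<open>G\<close>; this condition keeps each of
  them on a single horizontal line.\<close>

definition horizontal_at :: "complex set \<Rightarrow> 'k edge set \<Rightarrow> bool" where
  "horizontal_at G E \<longleftrightarrow> (\<forall>e\<in>E. tail e \<in> G \<or> head e \<in> G \<longrightarrow> (\<forall>z\<in>set (fst e). \<forall>w\<in>set (fst e). Im z = Im w))"

lemma horizontal_at_reverse:
  assumes "horizontal_at G E" "arcs E"
  shows "horizontal_at G (reverse_edge I ` E)"
  unfolding horizontal_at_def
proof (intro ballI impI)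
  fix e z w assume "e \<in> reverse_edge I ` E" "tail e \<in> G \<or> head e \<in> G" "z \<in> set (fst e)" "w \<in> set (fst e)"
  then obtain f where f: "e = reverse_edge I f" "f \<in> E" by blast
  then have "fst f \<noteq> []" using assms(2) by (auto simp: arcs_def)
  then have "tail f \<in> G \<or> head f \<in> G" using \<open>tail e \<in> G \<or> head e \<in> G\<close> f
    by (auto simp: reverse_edge_def hd_rev last_rev split: if_splits)
  moreover have "z \<in> set (fst f)" "w \<in> set (fst f)" using f \<open>z \<in> set (fst e)\<close> \<open>w \<in> set (fst e)\<close> by simp_all
  ultimately show "Im z = Im w" using assms(1) f(2) unfolding horizontal_at_def by blast
qed

lemma route_rev:
  assumes "successively (\<lambda>e f. head e = tail f) P" "P \<noteq> []" "\<And>e. e \<in> set P \<Longrightarrow> 2 \<le> length (fst e)"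
  shows "route (rev (map (\<lambda>e. (rev (fst e), g e)) P)) = rev (route P)"
  using assms
proof (induction P)
  case (Cons e P)
  have le: "2 \<le> length (fst e)" using Cons.prems(3) by simp
  then obtain p q where e: "fst e = p # q" "q \<noteq> []" by (cases "fst e"; cases "tl (fst e)") auto
  show ?case
  proof (cases "P = []")
    case True
    then show ?thesis using le by (simp add: route_single)
  next
    case False
    then have h: "head e = tail (hd P)" "successively (\<lambda>e f. head e = tail f) P" using Cons.prems(1)
      by (auto simp: successively_Cons)
    have IH: "route (rev (map (\<lambda>e. (rev (fst e), g e)) P)) = rev (route P)"
      using Cons.IH[OF h(2) False] Cons.prems(3) by simp
    have "route (rev (map (\<lambda>e. (rev (fst e), g e)) (e # P))) = rev (route P) @ tl (rev (fst e))"
      using False IH by (simp add: route_append)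
    also have "route P = last (fst e) # tl (route P)" using h(1) by (simp add: route_def)
    finally have "route (rev (map (\<lambda>e. (rev (fst e), g e)) (e # P))) = rev (tl (route P)) @ last (fst e) # tl (rev (fst e))"
      by simp
    moreover have "last (fst e) # tl (rev (fst e)) = rev (fst e)"
      using e by (metis hd_rev list.collapse rev_is_Nil_conv list.distinct(1))
    moreover have "route (e # P) = fst e @ tl (route P)"
      using route_Cons[OF False _ h(1)] e by simp
    ultimately show ?thesis by simp
  qed
qed simp

text \<open>The reversal is prescribed for merged edges but is easier to follow on unmerged ones. A
  strand with several edges stays on one line, so either all of its edges are reversed or none, and
  reversing all of them reverses their concatenation.\<close>

lemma merge_reverse_subset:
  assumes E: "arcs E" and h: "horizontal_at G E"
  shows "reverse_edge I ` merge G E \<subseteq> merge G (reverse_edge I ` E)"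
proof
  fix x assume "x \<in> reverse_edge I ` merge G E"
  then obtain P where P: "P \<in> strands G E" "x = reverse_edge I (contract P)" by (auto simp: merge_eq)
  have wP: "walk E P" "P \<noteq> []" using strands_walk[OF P(1)] strands_nonempty[OF P(1)] by auto
  have len: "2 \<le> length (fst e)" if "e \<in> set P" for e using walk_edges[OF wP(1) that] E by (simp add: arcs_def)
  have "(\<exists>y. \<forall>e\<in>set P. \<forall>z\<in>set (fst e). Im z = y) \<or> (\<exists>e. P = [e])"
  proof (cases "\<exists>e. P = [e]")
    case False
    have hor: "\<forall>z\<in>set (fst e). \<forall>w\<in>set (fst e). Im z = Im w" if "e \<in> set P" for e
      using strands_touch[OF P(1) that] False walk_edges[OF wP(1) that] h unfolding horizontal_at_def by blast
    have "\<forall>e\<in>set Q. \<forall>z\<in>set (fst e). Im z = Im (tail (hd Q))"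
      if "successively (\<lambda>e f. head e = tail f) Q" "set Q \<subseteq> set P" for Q
      using that
    proof (induction Q)
      case (Cons e Q)
      have "2 \<le> length (fst e)" using len Cons.prems by auto
      then have e: "fst e \<noteq> []" by auto
      have "e \<in> set P" using Cons.prems(2) by simp
      then have he: "\<forall>z\<in>set (fst e). Im z = Im (tail e)" using hor hd_in_set[OF e] by blast
      show ?case
      proof (cases "Q = []")
        case False
        then have "head e = tail (hd Q)" using Cons.prems by (simp add: successively_Cons)
        then have "Im (tail (hd Q)) = Im (tail e)" using he last_in_set[OF e] by simp
        moreover have "\<forall>f\<in>set Q. \<forall>z\<in>set (fst f). Im z = Im (tail (hd Q))"
          using Cons.IH Cons.prems False by (simp add: successively_Cons)
        ultimately show ?thesis using he by simp
      qed (use he in simp)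
    qed simp
    then show ?thesis using wP(1) unfolding walk_def by blast
  qed simp
  moreover have "set (route P) \<subseteq> (\<Union>e\<in>set P. set (fst e))"
  proof
    fix z assume "z \<in> set (route P)"
    then consider "z = tail (hd P)" | e where "e \<in> set P" "z \<in> set (tl (fst e))" by (auto simp: route_def)
    then show "z \<in> (\<Union>e\<in>set P. set (fst e))"
    proof cases
      case 1
      have "hd P \<in> set P" using wP(2) by simp
      moreover have "fst (hd P) \<noteq> []" using len[OF \<open>hd P \<in> set P\<close>] by auto
      ultimately show ?thesis using 1 by (intro UN_I[of "hd P"]) simp_all
    next
      case 2
      then show ?thesis by (intro UN_I[of e]) (cases "fst e"; simp)+
    qed
  qed
  moreover have r: "tail (hd P) \<in> set (route P)" by (simp add: route_def)
  have H: "on_line I e \<longleftrightarrow> on_line I (contract P)" if e: "e \<in> set P" for e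
  proof (cases "\<exists>e. P = [e]")
    case True
    then show ?thesis using e contract_single[OF len[OF e]] by auto
  next
    case False
    then obtain y where y: "\<forall>e\<in>set P. \<forall>z\<in>set (fst e). Im z = y"
      using calculation by blast
    then have "\<forall>z\<in>set (route P). Im z = y" using calculation(2) by blast
    moreover have "fst e \<noteq> []" using len[OF e] by auto
    moreover have "fst (contract P) \<noteq> []" by (simp add: contract_def route_def)
    ultimately show ?thesis using y e on_line_iff[of e y I] on_line_iff[of "contract P" y I] by (simp add: contract_def)
  qed
  show "x \<in> merge G (reverse_edge I ` E)"
  proof (cases "on_line I (contract P)")
    case False
    then have id: "reverse_edge I e = e" if "e \<in> set P" for e using H that by (simp add: reverse_edge_def)
    have "set P \<subseteq> reverse_edge I ` E"
    proof
      fix e assume "e \<in> set P"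
      then show "e \<in> reverse_edge I ` E" using id[of e] walk_edges[OF wP(1)] by (intro image_eqI[of _ _ e]) simp_all
    qed
    then have "P \<in> strands G (reverse_edge I ` E)" using P(1) by (simp add: strands_def walk_def)
    then show ?thesis using P False by (auto simp: merge_eq reverse_edge_def)
  next
    case True
    define R where "R = rev (map (\<lambda>e. (rev (fst e), inverse (snd e))) P)"
    have R: "R = rev (map (reverse_edge I) P)" unfolding R_def using H True by (simp add: reverse_edge_def)
    have ht: "tail (reverse_edge I e) = head e" "head (reverse_edge I e) = tail e" if "e \<in> set P" for e
      using H[OF that] True len[OF that] by (auto simp: reverse_edge_def hd_rev last_rev)
    have suc: "successively (\<lambda>e f. head e = tail f) P" using wP by (simp add: walk_def)
    have "successively (\<lambda>e f. head e = tail f) R"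
    proof -
      have "successively (\<lambda>x y. head (reverse_edge I y) = tail (reverse_edge I x)) P \<longleftrightarrow> successively (\<lambda>e f. head e = tail f) P"
        by (rule successively_cong) (use ht in auto)
      then show ?thesis unfolding R successively_rev successively_map using suc by simp
    qed
    moreover have "set R \<subseteq> reverse_edge I ` E" unfolding R using wP(1) by (auto simp: walk_def)
    moreover have "R \<noteq> []" using wP by (simp add: R)
    moreover have "tail (hd R) = head (last P)" "head (last R) = tail (hd P)"
      using wP ht by (simp_all add: R hd_rev last_rev last_map hd_map)
    moreover have "head ` set (butlast R) \<subseteq> G"
    proof -
      have "butlast R = rev (map (reverse_edge I) (tl P))" by (simp add: R map_tl butlast_rev)
      moreover have "head (reverse_edge I e) \<in> G" if "e \<in> set (tl P)" for e
      proof -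
        obtain A C where AC: "tl P = A @ e # C" using split_list[OF \<open>e \<in> set (tl P)\<close>] by blast
        obtain p where "P = (p # A) @ e # C" using AC wP(2) by (cases P) auto
        then obtain A' where A': "P = A' @ e # C" "A' \<noteq> []" by blast
        then have "head (last A') = tail e" using suc by (auto simp: successively_append_iff)
        moreover have "head (last A') \<in> G" using P(1) A' by (auto simp: strands_def butlast_append)
        ultimately show ?thesis using ht(2)[of e] A'(1) by simp
      qed
      ultimately show ?thesis by auto
    qed
    ultimately have "R \<in> strands G (reverse_edge I ` E)" using P(1) by (simp add: strands_def walk_def)
    moreover have "contract R = x"
    proof -
      have "walk_weight R = inverse (walk_weight P)"
        unfolding R_def walk_weight_def by (induction P) (auto simp: prod_list.append mult.commute)
      then show ?thesis using route_rev[OF suc wP(2) len] True P(2)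
        by (simp add: contract_def R_def reverse_edge_def)
    qed
    ultimately show ?thesis by (auto simp: merge_eq)
  qed
qed

text \<open>The second inclusion is the first one for the reversed edges, because reversal is an
  involution.\<close>

lemma merge_reverse:
  assumes E: "arcs E" and h: "horizontal_at G E"
  shows "reverse_edge I ` merge G E = merge G (reverse_edge I ` E)"
proof
  have inv: "reverse_edge I ` reverse_edge I ` F = F" for F :: "'a edge set" by (simp add: image_image)
  have "reverse_edge I ` merge G (reverse_edge I ` E) \<subseteq> merge G (reverse_edge I ` reverse_edge I ` E)"
    using E h by (intro merge_reverse_subset) (auto simp: arcs_reverse horizontal_at_reverse)
  then have "reverse_edge I ` reverse_edge I ` merge G (reverse_edge I ` E) \<subseteq> reverse_edge I ` merge G E"
    unfolding inv[of E] by (rule image_mono)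
  then show "merge G (reverse_edge I ` E) \<subseteq> reverse_edge I ` merge G E"
    unfolding inv .
qed (rule merge_reverse_subset[OF E h])

context disk
begin

lemma side_corner_cross: "Im (cnj (side q) * corner q) < 0" "Im (cnj (side q) * corner (Suc q)) < 0"
  "Im (cnj (corner q) * side q) > 0" "Im (cnj (corner (Suc q)) * side q) > 0"
  using corner_cross[of q] by (simp_all add: side_def algebra_simps)

text \<open>A corner on the ray of corner \<open>j\<close>, at least as far out as \<open>j\<close>,
  would fail to lie to the left of the side that leaves \<open>j\<close>; the end point of that side
  is not on the ray because the cross product of neighbouring corners is positive.\<close>

lemma corner_not_parallel_aux:
  assumes "j mod L \<noteq> k mod L" "corner k = s *\<^sub>R corner j"
  shows "s < 1"
proof (rule ccontr)
  assume "\<not> s < 1"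
  have "Im (cnj (side j) * (corner k - corner j)) = (s - 1) * Im (cnj (side j) * corner j)"
    by (simp add: assms(2) algebra_simps)
  then have le: "Im (cnj (side j) * (corner k - corner j)) \<le> 0"
    using \<open>\<not> s < 1\<close> side_corner_cross(1)[of j] by (simp add: mult_nonneg_nonpos)
  show False
  proof (cases "k mod L = Suc j mod L")
    case True
    then have "corner k = corner (Suc j)" by (simp add: corner_def)
    then have "corner (Suc j) = s *\<^sub>R corner j" using assms(2) by simp
    then show False using corner_cross[of j] by simp
  next
    case False
    then show False using side_corner[of k j] assms(1) le by auto
  qed
qed

text \<open>Applied to the two corners in both orders, the bound gives \<open>s < 1\<close> and
  \<open>inverse s < 1\<close>.\<close>

lemma corner_not_parallel:
  assumes "j mod L \<noteq> k mod L" "0 < s"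
  shows "corner k \<noteq> s *\<^sub>R corner j"
proof
  assume *: "corner k = s *\<^sub>R corner j"
  then have "corner j = inverse s *\<^sub>R corner k" using assms(2) by simp
  then have "inverse s < 1" using corner_not_parallel_aux[of k j "inverse s"] assms(1) by metis
  moreover have "s < 1" using corner_not_parallel_aux[OF assms(1) *] .
  ultimately show False using assms(2) one_less_inverse_iff[of s] by auto
qed

end

text \<open>The level \<open>k\<close> counts half layers: layer \<open>t\<close> lies between the levels \<open>2 t\<close> and
  \<open>2 t + 2\<close>, with the end points of its additional edge at level \<open>2 t + 1\<close>.\<close>

definition node :: "complex list \<Rightarrow> nat \<Rightarrow> nat \<Rightarrow> complex" where
  "node Q k j = (1 + real k / 2) *\<^sub>R Q ! j"

context disk
begin

lemma node_corner: "j < L \<Longrightarrow> node Q k j = (1 + real k / 2) *\<^sub>R corner j"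
  by (simp add: node_def corner_def)

lemma node_eq_iff:
  assumes "i < L" "j < L"
  shows "node Q k i = node Q l j \<longleftrightarrow> k = l \<and> i = j"
proof
  assume *: "node Q k i = node Q l j"
  define a b where "a = 1 + real k / 2" and "b = 1 + real l / 2"
  have ab: "a > 0" "b > 0" by (simp_all add: a_def b_def add_pos_nonneg)
  have e: "a *\<^sub>R corner i = b *\<^sub>R corner j" using * assms by (simp add: node_corner a_def b_def)
  then have "inverse a *\<^sub>R a *\<^sub>R corner i = inverse a *\<^sub>R b *\<^sub>R corner j" by simp
  then have "corner i = (b / a) *\<^sub>R corner j" using ab by (simp add: divide_inverse mult.commute)
  then have "i = j" using corner_not_parallel[of j i "b / a"] ab assms by (metis divide_pos_pos mod_less)
  moreover from this have "a = b" using e corner_nonzero[of j] by simp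
  ultimately show "k = l \<and> i = j" by (simp add: a_def b_def)
qed simp

text \<open>The node lies on the ray of corner \<open>j\<close>, at the corner or beyond it, hence
  not strictly to the left of the side that leaves \<open>j\<close>.\<close>

lemma node_not_interior:
  assumes "j < L"
  shows "node Q k j \<notin> interior (convex hull set Q)"
proof
  assume "node Q k j \<in> interior (convex hull set Q)"
  from side_interior[OF this, of j]
  have "0 < Im (cnj (side j) * (node Q k j - corner j))" .
  also have "\<dots> = (real k / 2) * Im (cnj (side j) * corner j)"
    by (simp add: node_corner[OF assms] algebra_simps)
  also have "\<dots> \<le> 0" using side_corner_cross(1)[of j] by (simp add: mult_nonneg_nonpos)
  finally show False by simp
qed

end

section \<open>The layers as drawn around the polygon\<close>

fun bridge :: "'k elementary \<Rightarrow> (nat \<times> nat \<times> 'k) option" where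
  "bridge (Diagonal d) = None"
| "bridge (Lower i l) = Some (i, i - 1, l)"
| "bridge (Upper j u) = Some (j - 1, j, u)"

fun diagonal_weight :: "'k::field elementary \<Rightarrow> nat \<Rightarrow> 'k" where
  "diagonal_weight (Diagonal d) j = d j"
| "diagonal_weight _ j = 1"

text \<open>A piece of line \<open>j\<close> between the levels \<open>a\<close> and
  \<open>b\<close>, with \<open>a\<close> the inner one. Lines of sources are directed inwards and
  carry inverse weights, as prescribed by the reversal.\<close>

definition spoke :: "complex list \<Rightarrow> nat set \<Rightarrow> nat \<Rightarrow> nat \<Rightarrow> nat \<Rightarrow> 'k::field \<Rightarrow> 'k edge" where
  "spoke Q I j a b w = (if j \<in> I then ([node Q b j, node Q a j], inverse w) else ([node Q a j, node Q b j], w))"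

text \<open>Through \<open>bridge\<close> the two triangular kinds are treated alike: it yields the
  start line, the end line and the weight of the additional edge. These two lines are subdivided at
  the odd level \<open>2 * t + 1\<close>.\<close>

definition layer :: "complex list \<Rightarrow> nat \<Rightarrow> nat set \<Rightarrow> nat \<Rightarrow> 'k::field elementary \<Rightarrow> 'k edge set" where
  "layer Q n I t x = (case bridge x of
     None \<Rightarrow> (\<lambda>j. spoke Q I j (2 * t) (2 * t + 2) (diagonal_weight x j)) ` {..<n}
   | Some (a, h, l) \<Rightarrow>
      (\<lambda>j. spoke Q I j (2 * t) (2 * t + 2) 1) ` ({..<n} - {a, h}) \<union>
      (\<lambda>j. spoke Q I j (2 * t) (2 * t + 1) 1) ` {a, h} \<union>
      (\<lambda>j. spoke Q I j (2 * t + 1) (2 * t + 2) 1) ` {a, h} \<union>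
      {([node Q (2 * t + 1) a, node Q (2 * t + 1) h], l)})"

text \<open>The order of the operations is that of the construction: shifting into the strip,
  reversal, wrapping.\<close>

definition placed_edge :: "complex list \<Rightarrow> nat set \<Rightarrow> nat \<Rightarrow> 'k::field edge \<Rightarrow> 'k edge" where
  "placed_edge Q I t e = map_edge (wrap Q) (reverse_edge I (map_edge (\<lambda>z. z + of_nat t) e))"

lemma point_eq_iff [simp]: "point s i = point s' j \<longleftrightarrow> s = s' \<and> i = j"
  by (simp add: point_def complex_eq_iff)

lemma wrap_point: "wrap Q (point x j) = (1 + x) *\<^sub>R Q ! j"
  by (simp add: wrap_def point_def)

lemma point_shift: "point x j + of_nat t = point (x + real t) j"
  by (simp add: point_def complex_eq_iff)

lemma placed_spoke:
  assumes "real a = 2 * (x + real t)" "real b = 2 * (y + real t)"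
  shows "placed_edge Q I t ([point x j, point y j], w) = spoke Q I j a b w"
proof -
  have "on_line I ([point (x + real t) j, point (y + real t) j], w) \<longleftrightarrow> j \<in> I" by (auto simp: on_line_def point_def)
  then show ?thesis
    using assms by (auto simp: placed_edge_def map_edge_def reverse_edge_def point_shift wrap_point spoke_def node_def)
qed

lemma placed_chord:
  assumes "a \<noteq> h"
  shows "placed_edge Q I t ([point (1/2) a, point (1/2) h], l) = ([node Q (2 * t + 1) a, node Q (2 * t + 1) h], l)"
proof -
  have "\<not> on_line I ([point (1/2 + real t) a, point (1/2 + real t) h], l)" using assms by (auto simp: on_line_def point_def)
  then show ?thesis
    by (simp add: placed_edge_def map_edge_def reverse_edge_def point_shift wrap_point node_def add_divide_distrib)
qed

lemma placed_ladder:
  "placed_edge Q I t ` ladder n i =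
      (\<lambda>j. spoke Q I j (2 * t) (2 * t + 2) 1) ` ({..<n} - {i - 1, i}) \<union>
      (\<lambda>j. spoke Q I j (2 * t) (2 * t + 1) 1) ` {i - 1, i} \<union>
      (\<lambda>j. spoke Q I j (2 * t + 1) (2 * t + 2) 1) ` {i - 1, i}"
  unfolding ladder_def image_Un image_image
  by (intro arg_cong2[of _ _ _ _ "(\<union>)"] image_cong refl placed_spoke) simp_all

lemma placed_elementary:
  assumes "is_elementary n x"
  shows "placed_edge Q I t ` elementary_net n x = layer Q n I t x"
proof (cases x)
  case (Diagonal d)
  then show ?thesis unfolding layer_def by (simp add: image_image) (intro image_cong refl placed_spoke; simp)
next
  case (Lower i l)
  then have "i \<noteq> i - 1" using assms by auto
  then show ?thesis using Lower unfolding layer_def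
    by (simp add: placed_ladder placed_chord) (auto simp: insert_commute)
next
  case (Upper j u)
  then have "j - 1 \<noteq> j" using assms by auto
  then show ?thesis using Upper unfolding layer_def
    by (simp add: placed_ladder placed_chord)
qed

lemma boundary_vertices_node: "boundary_vertices n N = {node (corners N) 0 j | j. j < n}"
  by (auto simp: boundary_vertices_def node_def)

lemma arcs_elementary_net: "arcs (elementary_net n x)"
  by (cases x) (auto simp: arcs_def ladder_def)

lemma ladder_cases:
  assumes "e \<in> ladder n i" "1 \<le> i" "i < n"
  shows "\<exists>s s' j w. 0 \<le> s \<and> 0 \<le> s' \<and> j < n \<and> e = ([point s j, point s' j], w)"
proof -
  have "i - 1 < n" using assms by simp
  then consider j where "j < n" "e = ([point 0 j, point 1 j], 1)"
    | j where "j < n" "e = ([point 0 j, point (1/2) j], 1)"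
    | j where "j < n" "e = ([point (1/2) j, point 1 j], 1)"
    using assms by (auto simp: ladder_def)
  then show ?thesis
  proof cases
    case 1
    then show ?thesis by (intro exI[of _ 0] exI[of _ 1] exI[of _ j] exI[of _ 1]) simp
  next
    case 2
    then show ?thesis by (intro exI[of _ 0] exI[of _ "1/2"] exI[of _ j] exI[of _ 1]) simp
  next
    case 3
    then show ?thesis by (intro exI[of _ "1/2"] exI[of _ 1] exI[of _ j] exI[of _ 1]) simp
  qed
qed

lemma elementary_net_cases:
  assumes x: "is_elementary n x" and e: "e \<in> elementary_net n x"
  shows "(\<exists>s s' j w. 0 \<le> s \<and> 0 \<le> s' \<and> j < n \<and> e = ([point s j, point s' j], w)) \<or>
    (\<exists>a h l. a < n \<and> h < n \<and> e = ([point (1/2) a, point (1/2) h], l))"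
proof (cases x)
  case (Diagonal d)
  then obtain j where "j < n" "e = ([point 0 j, point 1 j], d j)" using e by auto
  then show ?thesis by (intro disjI1 exI[of _ 0] exI[of _ 1] exI[of _ j] exI[of _ "d j"]) simp
next
  case (Lower i l)
  then consider "e = ([point (1/2) i, point (1/2) (i - 1)], l)" | "e \<in> ladder n i" using e by auto
  then show ?thesis
  proof cases
    case 1
    moreover have "i < n" "i - 1 < n" using x Lower by auto
    ultimately show ?thesis by blast
  next
    case 2
    then show ?thesis using ladder_cases[of e n i] x Lower by simp
  qed
next
  case (Upper i l)
  then consider "e = ([point (1/2) (i - 1), point (1/2) i], l)" | "e \<in> ladder n i" using e by auto
  then show ?thesis
  proof cases
    case 1
    moreover have "i < n" "i - 1 < n" using x Upper by auto
    ultimately show ?thesis by blast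
  next
    case 2
    then show ?thesis using ladder_cases[of e n i] x Upper by simp
  qed
qed

section \<open>The glued network\<close>

locale glued_network =
  fixes n :: nat and I :: "nat set" and N :: "'k::field network" and xs :: "'k elementary list"
  assumes N: "Net n I N" and xs: "xs \<noteq> []" "\<forall>x\<in>set xs. is_elementary n x"

sublocale glued_network \<subseteq> disk "corners N"
  using N by unfold_locales (auto simp: Net_def)

context glued_network
begin

abbreviation "Q \<equiv> corners N"
abbreviation "m \<equiv> length xs"

lemma n_le_L: "n \<le> L" and I_subset: "I \<subseteq> {..<n}" and finite_N: "finite (edges N)"
  using N by (auto simp: Net_def)

lemma less_L: "j < n \<Longrightarrow> j < L"
  using n_le_L by simp

lemma N_arc: "e \<in> edges N \<Longrightarrow> simple_arc (fst e)"
  "e \<in> edges N \<Longrightarrow> polyline (fst e) - {tail e, head e} \<subseteq> interior (convex hull set Q)"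
  using N unfolding Net_def by (auto simp: case_prod_unfold)

lemma N_disjoint:
  "e \<in> edges N \<Longrightarrow> f \<in> edges N \<Longrightarrow> e \<noteq> f \<Longrightarrow> polyline (fst e) \<inter> polyline (fst f) \<subseteq> {tail e, head e} \<inter> {tail f, head f}"
  using N unfolding Net_def by blast

lemma arcs_N: "arcs (edges N)"
  using N_arc by (auto simp: arcs_def simple_arc_def)

lemma N_vertex:
  assumes "e \<in> edges N" "v = tail e \<or> v = head e"
  shows "v \<in> interior (convex hull set Q) \<or> (\<exists>j<n. v = node Q 0 j)"
proof (cases "v \<in> boundary_vertices n N")
  case False
  then have "v \<in> internal_vertices n N" using assms by (auto simp: internal_vertices_def)
  then show ?thesis using N unfolding Net_def by blast
qed (auto simp: boundary_vertices_node)

lemma N_source: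
  assumes "i \<in> I"
  shows "\<exists>e. {e\<in>edges N. tail e = node Q 0 i} = {e}" "{e\<in>edges N. head e = node Q 0 i} = {}"
proof -
  have "i < n" using I_subset assms by auto
  then have "card (outgoing N (Q ! i)) = 1 \<and> incoming N (Q ! i) = {}" using N assms unfolding Net_def by auto
  then show "\<exists>e. {e\<in>edges N. tail e = node Q 0 i} = {e}" "{e\<in>edges N. head e = node Q 0 i} = {}"
    by (auto simp: outgoing_def incoming_def node_def card_1_singleton_iff)
qed

lemma N_sink:
  assumes "j < n" "j \<notin> I"
  shows "{e\<in>edges N. tail e = node Q 0 j} = {}"
proof -
  have "outgoing N (Q ! j) = {}" using N assms unfolding Net_def by auto
  then show ?thesis by (auto simp: outgoing_def node_def)
qed

lemma node_eq: "i < n \<Longrightarrow> j < n \<Longrightarrow> node Q k i = node Q l j \<longleftrightarrow> k = l \<and> i = j"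
  using node_eq_iff less_L by blast

lemma N_vertex_not_node: "e \<in> edges N \<Longrightarrow> v = tail e \<or> v = head e \<Longrightarrow> j < n \<Longrightarrow> 0 < k \<Longrightarrow> v \<noteq> node Q k j"
  using N_vertex[of e v] node_not_interior[of j k] node_eq[of _ j 0 k] less_L[of j] by auto

definition outer :: "'k edge set" where
  "outer = (\<Union>t<m. layer Q n I t (xs ! t))"

definition whole :: "'k edge set" where
  "whole = edges N \<union> outer"

definition glue_points :: "complex set" where
  "glue_points = {node Q (2 * t) j | t j. t < m \<and> j < n}"

text \<open>All gluing is pulled to the outside: merging commutes with reversal and with wrapping,
  edges of \<open>N\<close> do not touch the gluing points of the outer levels, and successive
  mergings combine into one.\<close>

lemma edges_compose: "edges (compose_net n I N xs) = merge glue_points whole"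
proof -
  define raw where "raw = (\<Union>t<m. map_edge (\<lambda>z. z + of_nat t) ` elementary_net n (xs ! t))"
  define G where "G = {point (real t) j |t j. 0 < t \<and> t < m \<and> j < n}"
  define S where "S = {point s j | s j. 0 \<le> s \<and> j < n}"
  have el: "is_elementary n (xs ! t)" if "t < m" for t using xs that by simp
  have arcs_raw: "arcs raw"
    unfolding arcs_def
  proof
    fix e assume "e \<in> raw"
    then obtain t f where "f \<in> elementary_net n (xs ! t)" "e = map_edge (\<lambda>z. z + of_nat t) f"
      by (auto simp: raw_def)
    then show "2 \<le> length (fst e)" using arcsD[OF arcs_elementary_net, of f n "xs ! t"] by (simp add: map_edge_def)
  qed
  have raw_S: "set (fst e) \<subseteq> S" if e: "e \<in> raw" for e
  proof -
    obtain t f where t: "t < m" and f: "f \<in> elementary_net n (xs ! t)" and ef: "e = map_edge (\<lambda>z. z + of_nat t) f"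
      using e by (auto simp: raw_def)
    have pS: "point s j + of_nat t \<in> S" if "0 \<le> s" "j < n" for s j
      unfolding S_def point_shift mem_Collect_eq using that by (intro exI[of _ "s + real t"] exI[of _ j]) simp
    show ?thesis using elementary_net_cases[OF el[OF t] f]
    proof (elim disjE exE conjE)
      fix s s' j w assume "0 \<le> s" "0 \<le> s'" "j < n" "f = ([point s j, point s' j], w)"
      then show ?thesis using pS by (simp add: ef map_edge_def)
    next
      fix a h l assume "a < n" "h < n" "f = ([point (1/2) a, point (1/2) h], l)"
      then show ?thesis using pS by (simp add: ef map_edge_def)
    qed
  qed
  have GS: "G \<subseteq> S" by (auto simp: G_def S_def)
  have hor: "horizontal_at G raw"
    unfolding horizontal_at_def
  proof (intro ballI impI)
    fix e z w assume e: "e \<in> raw" "tail e \<in> G \<or> head e \<in> G" and zw: "z \<in> set (fst e)" "w \<in> set (fst e)"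
    obtain t f where t: "t < m" and f: "f \<in> elementary_net n (xs ! t)" and ef: "e = map_edge (\<lambda>z. z + of_nat t) f"
      using e by (auto simp: raw_def)
    consider s s' j u where "f = ([point s j, point s' j], u)" | a h l where "f = ([point (1/2) a, point (1/2) h], l)"
      using elementary_net_cases[OF el[OF t] f] by blast
    then show "Im z = Im w"
    proof cases
      case 1
      then show ?thesis using zw by (auto simp: ef map_edge_def point_def)
    next
      case 2
      \<comment> \<open>The additional edges end halfway between two gluing lines, so they do not
        touch \<open>G\<close> and need not be horizontal; the claim is one of parity.\<close>
      have "1/2 + real t \<noteq> real t'" for t'
      proof
        assume "1/2 + real t = real t'"
        then have "real (1 + 2 * t) = real (2 * t')" by simp
        then have "1 + 2 * t = 2 * t'" by (simp only: of_nat_eq_iff)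
        then show False by presburger
      qed
      then have "point (1/2 + real t) k \<notin> G" for k by (simp add: G_def point_def complex_eq_iff) 
      then have False using e(2) by (simp add: ef 2 map_edge_def point_shift)
      then show ?thesis ..
    qed
  qed
  have inj: "inj_on (wrap Q) S"
  proof (rule inj_onI)
    fix z w assume "z \<in> S" "w \<in> S" and eq: "wrap Q z = wrap Q w"
    then obtain s i r j where z: "z = point s i" "0 \<le> s" "i < n" and w: "w = point r j" "0 \<le> r" "j < n"
      by (auto simp: S_def)
    have e: "(1 + s) *\<^sub>R corner i = (1 + r) *\<^sub>R corner j"
      using eq z w less_L by (simp add: wrap_point corner_def)
    then have "inverse (1 + s) *\<^sub>R (1 + s) *\<^sub>R corner i = inverse (1 + s) *\<^sub>R (1 + r) *\<^sub>R corner j" by simp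
    then have "corner i = ((1 + r) / (1 + s)) *\<^sub>R corner j"
      using z by (simp add: divide_inverse mult.commute)
    moreover have "0 < (1 + r) / (1 + s)" using z w by (simp add: add_pos_nonneg)
    moreover have "i mod L = i" "j mod L = j" using z w less_L by simp_all
    ultimately have "i = j" using corner_not_parallel[of j i "(1 + r) / (1 + s)"] by metis
    then show "z = w" using e corner_nonzero[of j] z w by simp
  qed
  have "map_edge (wrap Q) ` reverse_paths I (mat_net n xs) = map_edge (wrap Q) ` merge G (reverse_edge I ` raw)"
    unfolding reverse_paths_eq mat_net_def raw_def[symmetric] G_def[symmetric] by (simp only: merge_reverse[OF arcs_raw hor])
  also have "\<dots> = merge (wrap Q ` G) (map_edge (wrap Q) ` reverse_edge I ` raw)"
  proof (rule merge_map_edge[OF _ _ GS inj])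
    show "arcs (reverse_edge I ` raw)" using arcs_raw by (simp add: arcs_reverse)
    show "set (fst e) \<subseteq> S" if "e \<in> reverse_edge I ` raw" for e
    proof -
      obtain f where "f \<in> raw" "e = reverse_edge I f" using \<open>e \<in> reverse_edge I ` raw\<close> by blast
      then show ?thesis using raw_S[of f] by simp
    qed
  qed
  also have "map_edge (wrap Q) ` reverse_edge I ` raw = outer"
  proof -
    have "map_edge (wrap Q) ` reverse_edge I ` raw = (\<Union>t<m. placed_edge Q I t ` elementary_net n (xs ! t))"
      by (simp add: raw_def image_UN image_image placed_edge_def)
    then show ?thesis using placed_elementary[OF el] by (simp add: outer_def)
  qed
  also have "wrap Q ` G = {node Q (2 * t) j | t j. 0 < t \<and> t < m \<and> j < n}"
  proof (intro equalityI subsetI)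
    fix z assume "z \<in> wrap Q ` G"
    then obtain t j where "0 < t" "t < m" "j < n" "z = wrap Q (point (real t) j)" by (auto simp: G_def)
    then show "z \<in> {node Q (2 * t) j | t j. 0 < t \<and> t < m \<and> j < n}"
      by (auto simp: wrap_point node_def)
  next
    fix z assume "z \<in> {node Q (2 * t) j | t j. 0 < t \<and> t < m \<and> j < n}"
    then obtain t j where t: "0 < t" "t < m" "j < n" "z = node Q (2 * t) j" by auto
    then have "z = wrap Q (point (real t) j)" by (simp add: wrap_point node_def)
    then show "z \<in> wrap Q ` G" using t by (auto simp: G_def)
  qed
  finally have 1: "map_edge (wrap Q) ` reverse_paths I (mat_net n xs) = merge {node Q (2 * t) j | t j. 0 < t \<and> t < m \<and> j < n} outer"
    (is "_ = merge ?G outer") .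
  have "edges (compose_net n I N xs) = merge (boundary_vertices n N) (edges N \<union> merge ?G outer)"
    by (simp add: compose_net_def 1)
  also have "edges N \<union> merge ?G outer = merge ?G whole"
  proof -
    have "tail e \<notin> ?G \<and> head e \<notin> ?G" if "e \<in> edges N" for e
    proof -
      have "v \<notin> ?G" if v: "v = tail e \<or> v = head e" for v
      proof
        assume "v \<in> ?G"
        then obtain t j where "v = node Q (2 * t) j" "0 < 2 * t" "j < n" by auto
        then show False using N_vertex_not_node[OF \<open>e \<in> edges N\<close> v] by blast
      qed
      then show ?thesis by blast
    qed
    from merge_Un[OF arcs_N this] show ?thesis by (simp add: whole_def)
  qed
  also have "merge (boundary_vertices n N) (merge ?G whole) = merge (?G \<union> boundary_vertices n N) whole"
  proof (rule merge_merge)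
    have "arcs outer"
      unfolding \<open>map_edge (wrap Q) ` reverse_edge I ` raw = outer\<close>[symmetric]
      using arcs_raw unfolding arcs_reverse[of I raw, symmetric] unfolding arcs_def by (simp add: map_edge_def)
    then show "arcs whole" using arcs_N unfolding arcs_def whole_def by blast
  qed
  also have "?G \<union> boundary_vertices n N = glue_points"
  proof -
    have "0 < m" using xs by simp
    show ?thesis
    proof (intro equalityI subsetI)
      fix z assume "z \<in> ?G \<union> boundary_vertices n N"
      then consider j where "j < n" "z = node Q 0 j" | t j where "t < m" "j < n" "z = node Q (2 * t) j"
        unfolding boundary_vertices_node by blast
      then show "z \<in> glue_points"
      proof cases
        case 1
        then have "z = node Q (2 * 0) j" by simp
        then show ?thesis using \<open>0 < m\<close> 1(1) unfolding glue_points_def by blast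
      next
        case 2
        then show ?thesis unfolding glue_points_def by blast
      qed
    next
      fix z assume "z \<in> glue_points"
      then obtain t j where "z = node Q (2 * t) j" "t < m" "j < n" by (auto simp: glue_points_def)
      then show "z \<in> ?G \<union> boundary_vertices n N" unfolding boundary_vertices_node by (cases "t = 0") auto
    qed
  qed
  finally show ?thesis .
qed

end

section \<open>The edges entering and leaving a node\<close>

definition bridge_lines :: "'k elementary \<Rightarrow> nat set" where
  "bridge_lines x = (case bridge x of None \<Rightarrow> {} | Some (a, h, l) \<Rightarrow> {a, h})"

lemma bridge_elementary:
  assumes "is_elementary n x" "bridge x = Some (a, h, l)"
  shows "a < n" "h < n" "a \<noteq> h" "h = Suc a \<or> a = Suc h"
  using assms by (cases x; auto)+

lemma bridge_lines_Some: "bridge x = Some (a, h, l) \<Longrightarrow> bridge_lines x = {a, h}"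
  by (simp add: bridge_lines_def)

lemma diagonal_weight_bridge: "q \<in> bridge_lines x \<Longrightarrow> diagonal_weight x q = 1"
  by (cases x) (auto simp: bridge_lines_def)

lemma diagonal_weight_Some: "bridge x = Some b \<Longrightarrow> diagonal_weight x q = 1"
  by (cases x) auto

lemma bridge_lines_less: "is_elementary n x \<Longrightarrow> q \<in> bridge_lines x \<Longrightarrow> q < n"
  using bridge_elementary by (fastforce simp: bridge_lines_def split: option.splits)

lemma layer_iff:
  assumes "is_elementary n x"
  shows "e \<in> layer Q n I t x \<longleftrightarrow>
    (\<exists>j<n. j \<notin> bridge_lines x \<and> e = spoke Q I j (2 * t) (2 * t + 2) (diagonal_weight x j)) \<or>
    (\<exists>j\<in>bridge_lines x. e = spoke Q I j (2 * t) (2 * t + 1) 1) \<or>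
    (\<exists>j\<in>bridge_lines x. e = spoke Q I j (2 * t + 1) (2 * t + 2) 1) \<or>
    (\<exists>a h l. bridge x = Some (a, h, l) \<and> e = ([node Q (2 * t + 1) a, node Q (2 * t + 1) h], l))"
proof (cases "bridge x")
  case None
  then show ?thesis by (auto simp: layer_def bridge_lines_def)
next
  case (Some b)
  obtain a h l where b: "b = (a, h, l)" by (metis prod_cases3)
  show ?thesis using Some unfolding layer_def bridge_lines_def b
    by (simp only: option.case prod.case diagonal_weight_Some[OF Some] option.inject prod.inject) blast
qed

lemma head_spoke: "head (spoke Q I j a b w) = node Q (if j \<in> I then a else b) j"
  and tail_spoke: "tail (spoke Q I j a b w) = node Q (if j \<in> I then b else a) j"
  and length_spoke: "length (fst (spoke Q I j a b w)) = 2"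
  by (simp_all add: spoke_def)

context glued_network
begin

lemma elementary_nth: "t < m \<Longrightarrow> is_elementary n (xs ! t)"
  using xs by simp

text \<open>Even levels bound the layer and the odd level is its middle, so the level and the
  membership of \<open>q\<close> in \<open>I\<close> leave few possibilities. Subdivided and
  undivided lines are written uniformly by a conditional level, the weight being \<open>1\<close> on
  subdivided lines.\<close>

lemma layer_head:
  assumes x: "is_elementary n x" and e: "e \<in> layer Q n I t x" and q: "q < n" "head e = node Q k q"
  shows "(q \<in> I \<and> k = 2 * t \<and> e = spoke Q I q (2 * t) (if q \<in> bridge_lines x then 2 * t + 1 else 2 * t + 2) (diagonal_weight x q)) \<or>
    (q \<notin> I \<and> k = 2 * t + 2 \<and> e = spoke Q I q (if q \<in> bridge_lines x then 2 * t + 1 else 2 * t) (2 * t + 2) (diagonal_weight x q)) \<or>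
    (q \<in> bridge_lines x \<and> k = 2 * t + 1 \<and> e = (if q \<in> I then spoke Q I q (2 * t + 1) (2 * t + 2) 1 else spoke Q I q (2 * t) (2 * t + 1) 1)) \<or>
    (\<exists>a l. bridge x = Some (a, q, l) \<and> k = 2 * t + 1 \<and> e = ([node Q (2 * t + 1) a, node Q (2 * t + 1) q], l))"
  using e unfolding layer_iff[OF x]
proof (elim disjE exE bexE conjE)
  fix j assume "j < n" "j \<notin> bridge_lines x" "e = spoke Q I j (2 * t) (2 * t + 2) (diagonal_weight x j)"
  then show ?thesis using q by (auto simp: head_spoke node_eq split: if_splits)
next
  fix j assume "j \<in> bridge_lines x" "e = spoke Q I j (2 * t) (2 * t + 1) 1"
  then show ?thesis using q bridge_lines_less[OF x]
    by (auto simp: head_spoke node_eq diagonal_weight_bridge split: if_splits)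
next
  fix j assume "j \<in> bridge_lines x" "e = spoke Q I j (2 * t + 1) (2 * t + 2) 1"
  then show ?thesis using q bridge_lines_less[OF x]
    by (auto simp: head_spoke node_eq diagonal_weight_bridge split: if_splits)
next
  fix a h l assume "bridge x = Some (a, h, l)" "e = ([node Q (2 * t + 1) a, node Q (2 * t + 1) h], l)"
  then show ?thesis using q bridge_elementary(2)[OF x] by (auto simp: node_eq)
qed

lemma layer_tail:
  assumes x: "is_elementary n x" and e: "e \<in> layer Q n I t x" and q: "q < n" "tail e = node Q k q"
  shows "(q \<notin> I \<and> k = 2 * t \<and> e = spoke Q I q (2 * t) (if q \<in> bridge_lines x then 2 * t + 1 else 2 * t + 2) (diagonal_weight x q)) \<or>
    (q \<in> I \<and> k = 2 * t + 2 \<and> e = spoke Q I q (if q \<in> bridge_lines x then 2 * t + 1 else 2 * t) (2 * t + 2) (diagonal_weight x q)) \<or>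
    (q \<in> bridge_lines x \<and> k = 2 * t + 1 \<and> e = (if q \<in> I then spoke Q I q (2 * t) (2 * t + 1) 1 else spoke Q I q (2 * t + 1) (2 * t + 2) 1)) \<or>
    (\<exists>h l. bridge x = Some (q, h, l) \<and> k = 2 * t + 1 \<and> e = ([node Q (2 * t + 1) q, node Q (2 * t + 1) h], l))"
  using e unfolding layer_iff[OF x]
proof (elim disjE exE bexE conjE)
  fix j assume "j < n" "j \<notin> bridge_lines x" "e = spoke Q I j (2 * t) (2 * t + 2) (diagonal_weight x j)"
  then show ?thesis using q by (auto simp: tail_spoke node_eq split: if_splits)
next
  fix j assume "j \<in> bridge_lines x" "e = spoke Q I j (2 * t) (2 * t + 1) 1"
  then show ?thesis using q bridge_lines_less[OF x]
    by (auto simp: tail_spoke node_eq diagonal_weight_bridge split: if_splits)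
next
  fix j assume "j \<in> bridge_lines x" "e = spoke Q I j (2 * t + 1) (2 * t + 2) 1"
  then show ?thesis using q bridge_lines_less[OF x]
    by (auto simp: tail_spoke node_eq diagonal_weight_bridge split: if_splits)
next
  fix a h l assume "bridge x = Some (a, h, l)" "e = ([node Q (2 * t + 1) a, node Q (2 * t + 1) h], l)"
  then show ?thesis using q bridge_elementary(1)[OF x] by (auto simp: node_eq)
qed

lemma layer_memI:
  assumes x: "is_elementary n x"
  shows "q < n \<Longrightarrow> spoke Q I q (2 * t) (if q \<in> bridge_lines x then 2 * t + 1 else 2 * t + 2) (diagonal_weight x q) \<in> layer Q n I t x"
    and "q < n \<Longrightarrow> spoke Q I q (if q \<in> bridge_lines x then 2 * t + 1 else 2 * t) (2 * t + 2) (diagonal_weight x q) \<in> layer Q n I t x"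
    and "bridge x = Some (a, h, l) \<Longrightarrow> ([node Q (2 * t + 1) a, node Q (2 * t + 1) h], l) \<in> layer Q n I t x"
  unfolding layer_iff[OF x] by (auto simp: diagonal_weight_bridge)

lemma outer_end:
  assumes "e \<in> outer"
  shows "\<exists>k q. q < n \<and> tail e = node Q k q" "\<exists>k q. q < n \<and> head e = node Q k q" "length (fst e) = 2"
proof -
  obtain t where t: "t < m" "e \<in> layer Q n I t (xs ! t)" using assms by (auto simp: outer_def)
  then have "(\<exists>k q. q < n \<and> tail e = node Q k q) \<and> (\<exists>k q. q < n \<and> head e = node Q k q) \<and> length (fst e) = 2"
    using t(2) bridge_lines_less[OF elementary_nth[OF t(1)]] bridge_elementary(1,2)[OF elementary_nth[OF t(1)]]
    unfolding layer_iff[OF elementary_nth[OF t(1)]]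
    by (elim disjE exE bexE conjE) (simp_all add: head_spoke tail_spoke length_spoke, blast+)
  then show "\<exists>k q. q < n \<and> tail e = node Q k q" "\<exists>k q. q < n \<and> head e = node Q k q" "length (fst e) = 2" by blast+
qed

lemma arcs_whole: "arcs whole"
  using arcs_N outer_end(3) unfolding arcs_def whole_def by auto

lemma finite_whole: "finite whole"
proof -
  have "finite (layer Q n I t x)" for t and x :: "'k elementary"
    by (auto simp: layer_def split: option.splits)
  then have "finite outer" unfolding outer_def by blast
  then show ?thesis using finite_N by (simp add: whole_def)
qed

lemma layer_whole: "t < m \<Longrightarrow> e \<in> layer Q n I t (xs ! t) \<Longrightarrow> e \<in> whole"
  by (auto simp: whole_def outer_def)

lemma outer_headE:
  assumes "e \<in> outer" "q < n" "head e = node Q k q"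
  obtains t where "t < m" "q \<in> I" "k = 2 * t"
      "e = spoke Q I q (2 * t) (if q \<in> bridge_lines (xs ! t) then 2 * t + 1 else 2 * t + 2) (diagonal_weight (xs ! t) q)"
    | t where "t < m" "q \<notin> I" "k = 2 * t + 2"
      "e = spoke Q I q (if q \<in> bridge_lines (xs ! t) then 2 * t + 1 else 2 * t) (2 * t + 2) (diagonal_weight (xs ! t) q)"
    | t where "t < m" "q \<in> bridge_lines (xs ! t)" "k = 2 * t + 1"
      "e = (if q \<in> I then spoke Q I q (2 * t + 1) (2 * t + 2) 1 else spoke Q I q (2 * t) (2 * t + 1) 1)"
    | t a l where "t < m" "bridge (xs ! t) = Some (a, q, l)" "k = 2 * t + 1"
      "e = ([node Q (2 * t + 1) a, node Q (2 * t + 1) q], l)"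
proof -
  obtain t where t: "t < m" "e \<in> layer Q n I t (xs ! t)" using assms(1) by (auto simp: outer_def)
  from layer_head[OF elementary_nth[OF t(1)] t(2) assms(2,3)] show thesis
    using t(1) that by blast
qed

lemma outer_tailE:
  assumes "e \<in> outer" "q < n" "tail e = node Q k q"
  obtains t where "t < m" "q \<notin> I" "k = 2 * t"
      "e = spoke Q I q (2 * t) (if q \<in> bridge_lines (xs ! t) then 2 * t + 1 else 2 * t + 2) (diagonal_weight (xs ! t) q)"
    | t where "t < m" "q \<in> I" "k = 2 * t + 2"
      "e = spoke Q I q (if q \<in> bridge_lines (xs ! t) then 2 * t + 1 else 2 * t) (2 * t + 2) (diagonal_weight (xs ! t) q)"
    | t where "t < m" "q \<in> bridge_lines (xs ! t)" "k = 2 * t + 1"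
      "e = (if q \<in> I then spoke Q I q (2 * t) (2 * t + 1) 1 else spoke Q I q (2 * t + 1) (2 * t + 2) 1)"
    | t h l where "t < m" "bridge (xs ! t) = Some (q, h, l)" "k = 2 * t + 1"
      "e = ([node Q (2 * t + 1) q, node Q (2 * t + 1) h], l)"
proof -
  obtain t where t: "t < m" "e \<in> layer Q n I t (xs ! t)" using assms(1) by (auto simp: outer_def)
  from layer_tail[OF elementary_nth[OF t(1)] t(2) assms(2,3)] show thesis
    using t(1) that by blast
qed

lemma whole_head_outer:
  assumes "e \<in> whole" "head e = node Q k q" "q < n" "0 < k \<or> q \<in> I"
  shows "e \<in> outer"
proof (rule ccontr)
  assume "e \<notin> outer"
  then have e: "e \<in> edges N" using assms(1) by (simp add: whole_def)
  show False
  proof (cases "0 < k")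
    case True
    then show False using N_vertex_not_node[OF e, of "head e" q k] assms by simp
  next
    case False
    then have "k = 0" by simp
    then show False using N_source(2)[of q] assms e by blast
  qed
qed

lemma whole_tail_outer:
  assumes "e \<in> whole" "tail e = node Q k q" "q < n" "0 < k \<or> q \<notin> I"
  shows "e \<in> outer"
proof (rule ccontr)
  assume "e \<notin> outer"
  then have e: "e \<in> edges N" using assms(1) by (simp add: whole_def)
  show False
  proof (cases "0 < k")
    case True
    then show False using N_vertex_not_node[OF e, of "tail e" q k] assms by simp
  next
    case False
    then have "k = 0" by simp
    then show False using N_sink[of q] assms e by blast
  qed
qed

lemma incoming_sink_line:
  assumes "t < m" "q < n" "q \<notin> I"
  shows "{f \<in> whole. head f = node Q (2 * t + 2) q} =
    {spoke Q I q (if q \<in> bridge_lines (xs ! t) then 2 * t + 1 else 2 * t) (2 * t + 2) (diagonal_weight (xs ! t) q)}"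
proof (intro equalityI subsetI)
  fix f assume f: "f \<in> {f \<in> whole. head f = node Q (2 * t + 2) q}"
  then have "f \<in> outer" using whole_head_outer[of f "2 * t + 2" q] assms by simp
  moreover have "head f = node Q (2 * t + 2) q" using f by simp
  ultimately show "f \<in> {spoke Q I q (if q \<in> bridge_lines (xs ! t) then 2 * t + 1 else 2 * t) (2 * t + 2) (diagonal_weight (xs ! t) q)}"
    by (rule outer_headE[OF _ assms(2)]) (use assms(3) in \<open>(simp; presburger)+\<close>)
next
  fix f assume "f \<in> {spoke Q I q (if q \<in> bridge_lines (xs ! t) then 2 * t + 1 else 2 * t) (2 * t + 2) (diagonal_weight (xs ! t) q)}"
  then show "f \<in> {f \<in> whole. head f = node Q (2 * t + 2) q}"
    using layer_whole[OF assms(1) layer_memI(2)[OF elementary_nth[OF assms(1)] assms(2)]] assms(3) by (auto simp: head_spoke)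
qed

lemma incoming_source_line:
  assumes "t < m" "q < n" "q \<in> I"
  shows "{f \<in> whole. head f = node Q (2 * t) q} =
    {spoke Q I q (2 * t) (if q \<in> bridge_lines (xs ! t) then 2 * t + 1 else 2 * t + 2) (diagonal_weight (xs ! t) q)}"
proof (intro equalityI subsetI)
  fix f assume f: "f \<in> {f \<in> whole. head f = node Q (2 * t) q}"
  then have "f \<in> outer" using whole_head_outer[of f "2 * t" q] assms by simp
  moreover have "head f = node Q (2 * t) q" using f by simp
  ultimately show "f \<in> {spoke Q I q (2 * t) (if q \<in> bridge_lines (xs ! t) then 2 * t + 1 else 2 * t + 2) (diagonal_weight (xs ! t) q)}"
    by (rule outer_headE[OF _ assms(2)]) (use assms(3) in \<open>(simp; presburger)+\<close>)
next
  fix f assume "f \<in> {spoke Q I q (2 * t) (if q \<in> bridge_lines (xs ! t) then 2 * t + 1 else 2 * t + 2) (diagonal_weight (xs ! t) q)}"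
  then show "f \<in> {f \<in> whole. head f = node Q (2 * t) q}"
    using layer_whole[OF assms(1) layer_memI(1)[OF elementary_nth[OF assms(1)] assms(2)]] assms(3) by (auto simp: head_spoke)
qed

text \<open>At the outer end of a source line the current therefore consists of what is injected
  there and nothing else.\<close>

lemma incoming_source:
  assumes "q < n" "q \<in> I"
  shows "{f \<in> whole. head f = node Q (2 * m) q} = {}"
proof -
  have False if f: "f \<in> whole" "head f = node Q (2 * m) q" for f
  proof -
    have "f \<in> outer" using whole_head_outer[OF f] assms by simp
    then show False using f(2)
      by (rule outer_headE[OF _ assms(1)]) (use assms(2) in \<open>(simp; presburger)+\<close>)
  qed
  then show ?thesis by blast
qed

lemma incoming_middle:
  assumes "t < m" "q \<in> bridge_lines (xs ! t)"
  shows "{f \<in> whole. head f = node Q (2 * t + 1) q} =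
    insert (if q \<in> I then spoke Q I q (2 * t + 1) (2 * t + 2) 1 else spoke Q I q (2 * t) (2 * t + 1) 1)
      {([node Q (2 * t + 1) a, node Q (2 * t + 1) q], l) | a l. bridge (xs ! t) = Some (a, q, l)}"
    (is "?A = insert ?s ?C")
proof (intro equalityI subsetI)
  have q: "q < n" using bridge_lines_less[OF elementary_nth[OF assms(1)] assms(2)] .
  fix f assume f: "f \<in> ?A"
  then have "f \<in> outer" using whole_head_outer[of f "2 * t + 1" q] q by simp
  moreover have "head f = node Q (2 * t + 1) q" using f by simp
  ultimately show "f \<in> insert ?s ?C"
  proof (rule outer_headE[OF _ q])
    fix t' assume "2 * t + 1 = 2 * t'" then have False by presburger
    then show ?thesis ..
  next
    fix t' assume "2 * t + 1 = 2 * t' + 2" then have False by presburger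
    then show ?thesis ..
  next
    fix t' assume "2 * t + 1 = 2 * t' + 1" "f = (if q \<in> I then spoke Q I q (2 * t' + 1) (2 * t' + 2) 1 else spoke Q I q (2 * t') (2 * t' + 1) 1)"
    then show ?thesis by simp
  next
    fix t' a l assume "2 * t + 1 = 2 * t' + 1" "bridge (xs ! t') = Some (a, q, l)" "f = ([node Q (2 * t' + 1) a, node Q (2 * t' + 1) q], l)"
    then show ?thesis by simp
  qed
next
  fix f assume "f \<in> insert ?s ?C"
  then show "f \<in> ?A"
  proof
    assume f: "f = ?s"
    have "?s \<in> layer Q n I t (xs ! t)" unfolding layer_iff[OF elementary_nth[OF assms(1)]] using assms(2) by auto
    then show ?thesis using f layer_whole[OF assms(1)] by (simp add: head_spoke)
  next
    assume "f \<in> ?C"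
    then obtain a l where "bridge (xs ! t) = Some (a, q, l)" "f = ([node Q (2 * t + 1) a, node Q (2 * t + 1) q], l)" by blast
    then show ?thesis using layer_whole[OF assms(1) layer_memI(3)[OF elementary_nth[OF assms(1)]]] by simp
  qed
qed

lemma incoming_N_sink:
  assumes "q < n" "q \<notin> I"
  shows "{f \<in> whole. head f = node Q 0 q} = {f \<in> edges N. head f = node Q 0 q}"
proof -
  have False if f: "f \<in> outer" "head f = node Q 0 q" for f
    using f by (rule outer_headE[OF _ assms(1)]) (use assms(2) in simp_all)
  then show ?thesis by (auto simp: whole_def)
qed

lemma incoming_interior:
  assumes "v \<in> interior (convex hull set Q)"
  shows "{f \<in> whole. head f = v} = {f \<in> edges N. head f = v}"
proof -
  have False if f: "f \<in> outer" "head f = v" for f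
    using outer_end(2)[OF f(1)] node_not_interior assms f(2) less_L by metis
  then show ?thesis by (auto simp: whole_def)
qed

text \<open>A gluing point lies on one line only, which passes through it in one direction. This
  yields the finiteness of the merged network and one case in the recovery of edges from their first
  two points.\<close>

lemma glue_point_outgoing_unique:
  assumes "e \<in> whole" "f \<in> whole" "tail e = tail f" "tail e \<in> glue_points"
  shows "e = f"
proof -
  obtain t q where tq: "tail e = node Q (2 * t) q" "t < m" "q < n" using assms(4) by (auto simp: glue_points_def)
  show ?thesis
  proof (cases "0 < t \<or> q \<notin> I")
    case True
    then have "e \<in> outer" "f \<in> outer"
      using whole_tail_outer[of e "2 * t" q] whole_tail_outer[of f "2 * t" q] tq assms by auto
    \<comment> \<open>On a source line the continuation lies in the preceding layer. In this case
      \<open>0 < t\<close>, so the subtractions of natural numbers are genuine.\<close>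
    have u: "g = (if q \<in> I then spoke Q I q (if q \<in> bridge_lines (xs ! (t - 1)) then 2 * t - 1 else 2 * t - 2) (2 * t) (diagonal_weight (xs ! (t - 1)) q)
       else spoke Q I q (2 * t) (if q \<in> bridge_lines (xs ! t) then 2 * t + 1 else 2 * t + 2) (diagonal_weight (xs ! t) q))"
      if g: "g \<in> outer" "tail g = node Q (2 * t) q" for g
      using g
    proof (rule outer_tailE[OF _ tq(3)])
      fix t' assume "2 * t = 2 * t' + 1" then have False by presburger
    then show ?thesis ..
    next
      fix t' assume "2 * t = 2 * t' + 1" then have False by presburger
    then show ?thesis ..
    next
      fix t' assume *: "q \<in> I" "2 * t = 2 * t' + 2" 
        "g = spoke Q I q (if q \<in> bridge_lines (xs ! t') then 2 * t' + 1 else 2 * t') (2 * t' + 2) (diagonal_weight (xs ! t') q)"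
      then have "t - 1 = t'" "2 * t - 1 = 2 * t' + 1" "2 * t - 2 = 2 * t'" by simp_all
      then show ?thesis using * by simp
    qed simp
    show ?thesis using u[of e] u[of f] \<open>e \<in> outer\<close> \<open>f \<in> outer\<close> tq assms by simp
  next
    case False
    then have q: "q \<in> I" "tail e = node Q 0 q" using tq by auto
    have "g \<notin> outer" if "tail g = node Q 0 q" for g
    proof
      assume "g \<in> outer"
      then show False using that by (rule outer_tailE[OF _ tq(3)]) (use q in simp_all)
    qed
    then have "e \<in> edges N" "f \<in> edges N" using assms q by (auto simp: whole_def)
    moreover obtain g where "{e\<in>edges N. tail e = node Q 0 q} = {g}" using N_source(1)[OF q(1)] by blast
    ultimately show ?thesis using q assms(3) by (metis (mono_tags, lifting) mem_Collect_eq singletonD)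
  qed
qed

end

section \<open>Absence of turns by \<open>pi\<close>, and recovery of edges from their arcs\<close>

lemma walk_turns:
  assumes E: "arcs E" "\<And>e. e \<in> E \<Longrightarrow> successively non_opposite (dirs (fst e))"
    "\<And>e f. e \<in> E \<Longrightarrow> f \<in> E \<Longrightarrow> head e = tail f \<Longrightarrow> non_opposite (last_dir e) (first_dir f)"
  shows "walk E P \<Longrightarrow> successively non_opposite (dirs (route P))"
proof (induction P rule: rev_induct)
  case (snoc e P)
  show ?case
  proof (cases "P = []")
    case True
    then have e: "e \<in> E" using snoc.prems by (simp add: walk_def)
    show ?thesis using E(2)[OF e] route_single[OF arcsD[OF E(1) e]] True by simp
  next
    case False
    then have w: "walk E P" "e \<in> E" "head (last P) = tail e" using snoc.prems by (auto simp: walk_append_single)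
    have len: "2 \<le> length (fst f)" if "f \<in> set P" for f using arcsD[OF E(1) walk_edges[OF w(1) that]] .
    have "dirs (route (P @ [e])) = dirs (route P) @ dirs (fst e)"
      by (rule dirs_route_append[OF False len arcsD[OF E(1) w(2)] w(3)])
    moreover have "last P \<in> E" using False w(1) walk_edges[OF w(1), of "last P"] by simp
    then have "non_opposite (last (dirs (route P))) (first_dir e)"
      unfolding dirs_route_ends(2)[OF w(1) E(1)] using E(3) w by blast
    ultimately show ?thesis using snoc.IH[OF w(1)] E(2)[OF w(2)] by (simp add: successively_append_iff)
  qed
qed (simp add: walk_def)

text \<open>Turning back makes the two segments overlap. Two common points different from
  \<open>v\<close> are produced because two edges of a network may share both end points, so that a
  single further point would be no contradiction.\<close>

lemma opposite_overlap:
  fixes p v s :: complex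
  assumes "p \<noteq> v" "s - v = - (c *\<^sub>R (v - p))" "c > 0"
  shows "\<exists>x y. x \<noteq> v \<and> y \<noteq> v \<and> x \<noteq> y \<and> {x, y} \<subseteq> closed_segment p v \<inter> closed_segment v s"
proof -
  have s: "s - v = c *\<^sub>R (p - v)" using assms(2) by (simp add: algebra_simps)
  have in1: "v + u *\<^sub>R (p - v) \<in> closed_segment v p" if "0 \<le> u" "u \<le> 1" for u
    using that unfolding closed_segment_def by (auto simp: algebra_simps intro!: exI[of _ u])
  have in2: "v + u *\<^sub>R (p - v) \<in> closed_segment v s" if "0 \<le> u" "u \<le> c" for u
  proof -
    have "v + u *\<^sub>R (p - v) = v + (u / c) *\<^sub>R (s - v)" using assms(3) by (simp add: s)
    moreover have "0 \<le> u / c" "u / c \<le> 1" using that assms(3) by auto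
    ultimately show ?thesis unfolding closed_segment_def by (auto simp: algebra_simps intro!: exI[of _ "u / c"])
  qed
  \<comment> \<open>Measured from \<open>v\<close> towards \<open>p\<close>, in units of
    \<open>p - v\<close>, the first segment has length \<open>1\<close> and the second has length
    \<open>c\<close>.\<close>
  define u where "u = min 1 c"
  have u: "0 < u" "u \<le> 1" "u \<le> c" using assms(3) by (auto simp: u_def)
  show ?thesis
  proof (intro exI conjI)
    show "v + u *\<^sub>R (p - v) \<noteq> v" "v + (u / 2) *\<^sub>R (p - v) \<noteq> v" using u assms(1) by auto
    show "v + u *\<^sub>R (p - v) \<noteq> v + (u / 2) *\<^sub>R (p - v)" using u assms(1) by auto
    show "{v + u *\<^sub>R (p - v), v + (u / 2) *\<^sub>R (p - v)} \<subseteq> closed_segment p v \<inter> closed_segment v s"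
      using in1[of u] in1[of "u / 2"] in2[of u] in2[of "u / 2"] u by (auto simp: closed_segment_commute)
  qed
qed

lemma simple_arc_nth_neq: "simple_arc r \<Longrightarrow> s < length r \<Longrightarrow> t < length r \<Longrightarrow> s \<noteq> t \<Longrightarrow> r ! s \<noteq> r ! t"
  by (simp add: simple_arc_def nth_eq_iff_index_eq)

lemma simple_arcD: "simple_arc r \<Longrightarrow> s < t \<Longrightarrow> Suc t < length r \<Longrightarrow>
    closed_segment (r ! s) (r ! Suc s) \<inter> closed_segment (r ! t) (r ! Suc t) \<subseteq> (if t = Suc s then {r ! t} else {})"
  unfolding simple_arc_def by blast

lemma simple_arc_turns:
  assumes r: "simple_arc r"
  shows "successively non_opposite (dirs r)"
  unfolding successively_conv_nth
proof (intro allI impI)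
  fix t assume "Suc t < length (dirs r)"
  then have t: "Suc (Suc t) < length r" by simp
  have d: "dirs r ! t = r ! Suc t - r ! t" "dirs r ! Suc t = r ! Suc (Suc t) - r ! Suc t" using t by (auto simp: nth_dirs)
  have ne: "r ! t \<noteq> r ! Suc t" "r ! Suc t \<noteq> r ! Suc (Suc t)" using simple_arc_nth_neq[OF r] t by auto
  show "non_opposite (dirs r ! t) (dirs r ! Suc t)"
    unfolding non_opposite_def
  proof (intro conjI allI impI notI)
    fix c :: real assume c: "0 < c" "dirs r ! Suc t = - (c *\<^sub>R dirs r ! t)"
    then obtain x where x: "x \<noteq> r ! Suc t" "x \<in> closed_segment (r ! t) (r ! Suc t) \<inter> closed_segment (r ! Suc t) (r ! Suc (Suc t))"
      using opposite_overlap[OF ne(1) _ c(1), of "r ! Suc (Suc t)"] unfolding d by blast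
    have "closed_segment (r ! t) (r ! Suc t) \<inter> closed_segment (r ! Suc t) (r ! Suc (Suc t)) \<subseteq> {r ! Suc t}"
    proof -
      have "closed_segment (r ! t) (r ! Suc t) \<inter> closed_segment (r ! Suc t) (r ! Suc (Suc t)) \<subseteq> (if Suc t = Suc t then {r ! Suc t} else {})"
        using simple_arcD[OF r, of t "Suc t"] t by simp
      then show ?thesis by simp
    qed
    then show False using x by blast
  qed (use ne d in auto)
qed

lemma first_segment:
  assumes "2 \<le> length r"
  shows "hd (dirs r) = r ! 1 - hd r" "closed_segment (hd r) (r ! 1) \<subseteq> polyline r"
proof -
  have r: "dirs r \<noteq> []" "r \<noteq> []" using assms by auto
  then show "hd (dirs r) = r ! 1 - hd r" using assms by (simp add: hd_conv_nth nth_dirs)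
  have "closed_segment (r ! 0) (r ! Suc 0) \<subseteq> polyline r" unfolding polyline_def using assms by (intro UN_upper) auto
  moreover have "r ! 0 = hd r" using assms by (cases r) auto
  ultimately show "closed_segment (hd r) (r ! 1) \<subseteq> polyline r" by simp
qed

lemma last_segment:
  assumes "2 \<le> length r"
  shows "last (dirs r) = last r - r ! (length r - 2)" "closed_segment (r ! (length r - 2)) (last r) \<subseteq> polyline r"
proof -
  have e: "Suc (length r - 2) = length r - 1" using assms by simp
  have "r \<noteq> []" using assms by auto
  then have l: "last r = r ! Suc (length r - 2)" using assms by (simp add: last_conv_nth e)
  have "dirs r \<noteq> []" using assms by auto
  then show "last (dirs r) = last r - r ! (length r - 2)"
    using assms nth_dirs[of "length r - 2" r] by (simp add: last_conv_nth l e numeral_2_eq_2)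
  show "closed_segment (r ! (length r - 2)) (last r) \<subseteq> polyline r"
    unfolding polyline_def l using assms by (intro UN_upper) auto
qed

text \<open>The end points of a segment may be ends of the arc and lie on the boundary of the disk.
  A midpoint is never an end of a simple arc, so for an edge of \<open>N\<close> it is an interior
  point of the disk.\<close>

lemma simple_arc_midpoint:
  assumes r: "simple_arc r" and t: "Suc t < length r"
  shows "midpoint (r ! t) (r ! Suc t) \<in> polyline r - {hd r, last r}"
proof -
  define x where "x = midpoint (r ! t) (r ! Suc t)"
  have x: "x \<in> closed_segment (r ! t) (r ! Suc t)" by (simp add: x_def)
  have ne: "r ! t \<noteq> r ! Suc t" using simple_arc_nth_neq[OF r] t by auto
  have xne: "x \<noteq> r ! t" "x \<noteq> r ! Suc t" using ne by (auto simp: x_def)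
  have "x \<noteq> r ! k" if k: "k < length r" for k
  proof
    assume xk: "x = r ! k"
    have kt: "k \<noteq> t" "k \<noteq> Suc t" using xk xne by auto
    show False
    proof (cases "t < k")
      case True
      then have k': "t < k - 1" "Suc (k - 1) = k" using kt by auto
      then have "x \<in> closed_segment (r ! (k - 1)) (r ! Suc (k - 1))" using xk by simp
      then have "x \<in> (if k - 1 = Suc t then {r ! (k - 1)} else {})"
        using subsetD[OF simple_arcD[OF r, of t "k - 1"], of x] x k k' by simp
      then show False using simple_arc_nth_neq[OF r, of k "k - 1"] k k' xk by (auto split: if_splits)
    next
      case False
      then have k': "k < t" using kt by auto
      then have "x \<in> closed_segment (r ! k) (r ! Suc k)" using xk by simp
      then have "x \<in> (if t = Suc k then {r ! t} else {})"
        using subsetD[OF simple_arcD[OF r, of k t], of x] x t k' by simp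
      then show False using xne by (auto split: if_splits)
    qed
  qed
  moreover have "0 < length r" "length r - 1 < length r" "r \<noteq> []" using t by auto
  ultimately have "x \<noteq> hd r" "x \<noteq> last r" by (simp_all add: hd_conv_nth last_conv_nth)
  moreover have "x \<in> polyline r" using x t by (auto simp: polyline_def)
  ultimately show ?thesis by (simp add: x_def)
qed

context glued_network
begin

definition flow :: "nat \<Rightarrow> complex" where
  "flow q = (if q \<in> I then - corner q else corner q)"

lemma dirs_spoke: "q < n \<Longrightarrow> dirs (fst (spoke Q I q a b w)) = [((real b - real a) / 2) *\<^sub>R flow q]"
  using less_L[of q] by (simp add: spoke_def node_corner flow_def algebra_simps diff_divide_distrib)

lemma spoke_dir:
  assumes "e = spoke Q I q a b w" "a < b" "q < n"
  shows "\<exists>c>0. first_dir e = c *\<^sub>R flow q" "\<exists>c>0. last_dir e = c *\<^sub>R flow q"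
  unfolding assms(1) dirs_spoke[OF assms(3)] using assms(2) by (intro exI[of _ "(real b - real a) / 2"]; simp)+

lemma dirs_chord: "a < n \<Longrightarrow> h < n \<Longrightarrow>
  dirs [node Q k a, node Q k h] = [(1 + real k / 2) *\<^sub>R (corner h - corner a)]"
  using less_L[of a] less_L[of h] by (simp add: node_corner algebra_simps)

lemma N_first_dir_interior:
  assumes "e \<in> edges N"
  shows "\<exists>p\<in>interior (convex hull set Q). first_dir e = 2 *\<^sub>R (p - tail e)"
proof -
  have r: "simple_arc (fst e)" using N_arc(1)[OF assms] .
  have l: "2 \<le> length (fst e)" using arcsD[OF arcs_N assms] .
  have "fst e ! 0 = tail e" using l by (cases "fst e") auto
  then have "midpoint (tail e) (fst e ! 1) \<in> interior (convex hull set Q)"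
    using simple_arc_midpoint[OF r, of 0] N_arc(2)[OF assms] l by auto
  moreover have "first_dir e = 2 *\<^sub>R (midpoint (tail e) (fst e ! 1) - tail e)"
    unfolding first_segment(1)[OF l] by (simp add: midpoint_def algebra_simps scaleR_2)
  ultimately show ?thesis by blast
qed

lemma N_last_dir_interior:
  assumes "e \<in> edges N"
  shows "\<exists>p\<in>interior (convex hull set Q). last_dir e = - (2 *\<^sub>R (p - head e))"
proof -
  have r: "simple_arc (fst e)" using N_arc(1)[OF assms] .
  have l: "2 \<le> length (fst e)" using arcsD[OF arcs_N assms] .
  define k where "k = length (fst e) - 2"
  have k: "Suc k < length (fst e)" using l by (simp add: k_def)
  have h: "fst e ! Suc k = head e"
  proof -
    have "Suc k = length (fst e) - 1" using l by (simp add: k_def)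
    moreover have "fst e \<noteq> []" using l by auto
    ultimately show ?thesis by (simp add: last_conv_nth)
  qed
  have "midpoint (fst e ! k) (head e) \<in> interior (convex hull set Q)"
    using simple_arc_midpoint[OF r k] N_arc(2)[OF assms] h by auto
  moreover have "last_dir e = - (2 *\<^sub>R (midpoint (fst e ! k) (head e) - head e))"
    unfolding last_segment(1)[OF l] k_def[symmetric] by (simp add: midpoint_def algebra_simps scaleR_2)
  ultimately show ?thesis by blast
qed

text \<open>The edge starts towards an interior point of the disk, which lies to the left of every
  side, here of the one that ends at corner \<open>q\<close>; its index is written
  \<open>q + L - 1\<close> to cover \<open>q = 0\<close>.\<close>

lemma N_first_dir:
  assumes "e \<in> edges N" "tail e = node Q 0 q" "q < n"
  shows "Im (cnj (side (q + L - 1)) * first_dir e) > 0"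
proof -
  obtain p where p: "p \<in> interior (convex hull set Q)" "first_dir e = 2 *\<^sub>R (p - tail e)"
    using N_first_dir_interior[OF assms(1)] by blast
  have t: "tail e = corner q" using assms less_L by (simp add: node_corner)
  have "corner (Suc (q + L - 1)) = corner q" using L by simp
  then have c: "corner (q + L - 1) = corner q - side (q + L - 1)" by (simp add: side_def)
  have "0 < Im (cnj (side (q + L - 1)) * (p - corner (q + L - 1)))" by (rule side_interior[OF p(1)])
  also have "\<dots> = Im (cnj (side (q + L - 1)) * (p - corner q))" unfolding c by (simp add: algebra_simps)
  finally show ?thesis unfolding p(2) t by (simp add: algebra_simps)
qed

lemma N_last_dir:
  assumes "e \<in> edges N" "head e = node Q 0 q" "q < n"
  shows "Im (cnj (side q) * last_dir e) < 0"
proof -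
  obtain p where p: "p \<in> interior (convex hull set Q)" "last_dir e = - (2 *\<^sub>R (p - head e))"
    using N_last_dir_interior[OF assms(1)] by blast
  have t: "head e = corner q" using assms less_L by (simp add: node_corner)
  show ?thesis using side_interior[OF p(1), of q] unfolding p(2) t by (simp add: algebra_simps)
qed

text \<open>Two edges meet only in common end points. After turning back they would share two
  distinct points other than \<open>head e\<close>, and both would have to be the tail of
  \<open>e\<close>.\<close>

lemma N_turn:
  assumes e: "e \<in> edges N" and f: "f \<in> edges N" and ef: "head e = tail f"
  shows "non_opposite (last_dir e) (first_dir f)"
proof -
  have le: "2 \<le> length (fst e)" "2 \<le> length (fst f)" using arcsD[OF arcs_N] e f by auto
  have re: "simple_arc (fst e)" "simple_arc (fst f)" using N_arc(1) e f by auto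
  have ht: "tail g \<noteq> head g" if "2 \<le> length (fst g)" "simple_arc (fst g)" for g :: "'k edge"
    using simple_arc_nth_neq[OF that(2), of 0 "length (fst g) - 1"] that(1)
    by (cases "fst g = []") (auto simp: hd_conv_nth last_conv_nth)
  have "e \<noteq> f" using ef ht[OF le(1) re(1)] by auto
  define p s v where "p = fst e ! (length (fst e) - 2)" and "s = fst f ! 1" and "v = head e"
  have d: "last_dir e = v - p" "first_dir f = s - v"
    using last_segment(1)[OF le(1)] first_segment(1)[OF le(2)] ef by (auto simp: p_def s_def v_def)
  have ne: "last_dir e \<noteq> 0" "first_dir f \<noteq> 0"
  proof -
    have "successively non_opposite (dirs (fst g)) \<Longrightarrow> 2 \<le> length (fst g) \<Longrightarrow> simple_arc (fst g) \<Longrightarrow> u \<in> set (dirs (fst g)) \<Longrightarrow> u \<noteq> 0" for g :: "'k edge" and u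
    proof -
      assume "2 \<le> length (fst g)" "simple_arc (fst g)" "u \<in> set (dirs (fst g))"
      then obtain t where "t < length (fst g) - 1" "u = dirs (fst g) ! t" by (auto simp: in_set_conv_nth)
      moreover from this have "Suc t < length (fst g)" by simp
      ultimately show "u \<noteq> 0" using simple_arc_nth_neq[OF \<open>simple_arc (fst g)\<close>, of t "Suc t"] by (simp add: nth_dirs)
    qed
    then show "last_dir e \<noteq> 0" "first_dir f \<noteq> 0"
      using simple_arc_turns le re arcs_dirs[OF le(1)] arcs_dirs[OF le(2)] by auto
  qed
  show ?thesis unfolding non_opposite_def
  proof (intro conjI allI impI notI)
    fix c :: real assume c: "0 < c" "first_dir f = - (c *\<^sub>R last_dir e)"
    have "p \<noteq> v" using ne d by auto
    from opposite_overlap[OF this _ c(1), of s] c(2) obtain x y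
      where xy: "x \<noteq> v" "y \<noteq> v" "x \<noteq> y" "{x, y} \<subseteq> closed_segment p v \<inter> closed_segment v s"
      unfolding d by blast
    have "closed_segment p v \<subseteq> polyline (fst e)" "closed_segment v s \<subseteq> polyline (fst f)"
      using last_segment(2)[OF le(1)] first_segment(2)[OF le(2)] ef by (auto simp: p_def s_def v_def)
    then have "{x, y} \<subseteq> {tail e, head e}" using N_disjoint[OF e f \<open>e \<noteq> f\<close>] xy(4) by blast
    then show False using xy(1-3) by (auto simp: v_def)
  qed (use ne in auto)
qed

lemma non_opposite_same_sign:
  assumes "Im (cnj s * u) > 0 \<and> Im (cnj s * v) > 0 \<or> Im (cnj s * u) < 0 \<and> Im (cnj s * v) < 0"
  shows "non_opposite u v"
  unfolding non_opposite_def
proof (intro conjI allI impI notI)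
  fix c :: real assume c: "0 < c" "v = - (c *\<^sub>R u)"
  then have "Im (cnj s * v) = - (c * Im (cnj s * u))" by (simp add: algebra_simps)
  then show False using assms c(1) by (auto simp: zero_less_mult_iff mult_less_0_iff)
qed (use assms in auto)

lemma flow_nonzero: "flow q \<noteq> 0"
  using corner_nonzero by (simp add: flow_def)

lemma non_opposite_flow: "0 < a \<Longrightarrow> 0 < b \<Longrightarrow> non_opposite (a *\<^sub>R flow q) (b *\<^sub>R flow q)"
  unfolding non_opposite_scaleR
  unfolding non_opposite_def
proof (intro conjI allI impI notI flow_nonzero)
  fix c :: real assume "0 < c" "flow q = - (c *\<^sub>R flow q)"
  then have "flow q + c *\<^sub>R flow q = 0" by (metis add.left_inverse add.commute minus_minus)
  then have "(1 + c) *\<^sub>R flow q = 0" by (simp add: scaleR_left_distrib)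
  then show False using flow_nonzero \<open>0 < c\<close> by simp
qed (use flow_nonzero in auto)

text \<open>Up to sign the chord is a side of the polygon and \<open>flow q\<close> is the radial
  direction at one of its ends; these are transversal because the origin is an interior
  point.\<close>

lemma chord_cross:
  assumes "h = Suc a \<or> a = Suc h" "q = a \<or> q = h"
  shows "Im (cnj (corner h - corner a) * flow q) \<noteq> 0" "Im (cnj (flow q) * (corner h - corner a)) \<noteq> 0"
proof -
  define g where "g = (if h = Suc a then a else h)"
  obtain u where u: "corner h - corner a = u *\<^sub>R side g" "u \<noteq> 0"
    using assms by (cases "h = Suc a") (auto simp: g_def side_def intro: that[of 1] that[of "- 1"])
  obtain v where v: "flow q = v *\<^sub>R corner q" "v \<noteq> 0"
    by (cases "q \<in> I") (auto simp: flow_def intro: that[of 1] that[of "- 1"])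
  have q: "q = g \<or> q = Suc g" using assms by (auto simp: g_def)
  have "Im (cnj (corner h - corner a) * flow q) = u * v * Im (cnj (side g) * corner q)"
    "Im (cnj (flow q) * (corner h - corner a)) = u * v * Im (cnj (corner q) * side g)"
    unfolding u(1) v(1) by (simp_all add: algebra_simps)
  then show "Im (cnj (corner h - corner a) * flow q) \<noteq> 0" "Im (cnj (flow q) * (corner h - corner a)) \<noteq> 0"
    using q u(2) v(2) side_corner_cross[of g] by (auto simp del: times_complex.simps)
qed

lemma outer_turn:
  assumes e: "e \<in> outer" and f: "f \<in> outer" and ef: "head e = tail f"
  shows "non_opposite (last_dir e) (first_dir f)"
proof -
  obtain k q where q: "q < n" "head e = node Q k q" using outer_end(2)[OF e] by blast
  then have tq: "tail f = node Q k q" using ef by simp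
  have fe: "(\<exists>a>0. last_dir e = a *\<^sub>R flow q) \<or> (\<exists>a h t l. odd k \<and> bridge (xs ! t) = Some (a, h, l) \<and> t < m \<and> k = 2 * t + 1 \<and> q = h \<and> last_dir e = (1 + real k / 2) *\<^sub>R (corner h - corner a))"
    using e q
  proof (rule outer_headE, goal_cases)
    case (1 t)
    show ?case by (rule disjI1, rule spoke_dir(2)[OF 1(4) _ q(1)]) simp
  next
    case (2 t)
    show ?case by (rule disjI1, rule spoke_dir(2)[OF 2(4) _ q(1)]) simp
  next
    case (3 t)
    show ?case
    proof (cases "q \<in> I")
      case True
      show ?thesis by (rule disjI1, rule spoke_dir(2)[OF 3(4)[unfolded if_P[OF True]] _ q(1)]) simp
    next
      case False
      show ?thesis by (rule disjI1, rule spoke_dir(2)[OF 3(4)[unfolded if_not_P[OF False]] _ q(1)]) simp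
    qed
  next
    case (4 t a l)
    then show ?case using dirs_chord[of a q k] bridge_elementary[OF elementary_nth[OF 4(1)] 4(2)] by auto
  qed
  have ff: "(\<exists>a>0. first_dir f = a *\<^sub>R flow q) \<or> (\<exists>a h t l. bridge (xs ! t) = Some (a, h, l) \<and> t < m \<and> k = 2 * t + 1 \<and> q = a \<and> first_dir f = (1 + real k / 2) *\<^sub>R (corner h - corner a))"
    using f q(1) tq
  proof (rule outer_tailE, goal_cases)
    case (1 t)
    show ?case by (rule disjI1, rule spoke_dir(1)[OF 1(4) _ q(1)]) simp
  next
    case (2 t)
    show ?case by (rule disjI1, rule spoke_dir(1)[OF 2(4) _ q(1)]) simp
  next
    case (3 t)
    show ?case
    proof (cases "q \<in> I")
      case True
      show ?thesis by (rule disjI1, rule spoke_dir(1)[OF 3(4)[unfolded if_P[OF True]] _ q(1)]) simp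
    next
      case False
      show ?thesis by (rule disjI1, rule spoke_dir(1)[OF 3(4)[unfolded if_not_P[OF False]] _ q(1)]) simp
    qed
  next
    case (4 t h l)
    then show ?case using dirs_chord[of q h k] bridge_elementary[OF elementary_nth[OF 4(1)] 4(2)] by auto
  qed
  have pos: "0 < 1 + real k / 2" by (simp add: add_pos_nonneg)
  from fe ff show ?thesis
  proof (elim disjE exE conjE)
    fix a b assume "0 < a" "last_dir e = a *\<^sub>R flow q" "0 < b" "first_dir f = b *\<^sub>R flow q"
    then show ?thesis using non_opposite_flow by simp
  next
    fix c a h t l assume *: "0 < c" "last_dir e = c *\<^sub>R flow q" "bridge (xs ! t) = Some (a, h, l)" "t < m"
      "q = a" "first_dir f = (1 + real k / 2) *\<^sub>R (corner h - corner a)"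
    have "h = Suc a \<or> a = Suc h" using bridge_elementary(4)[OF elementary_nth[OF *(4)] *(3)] .
    then show ?thesis unfolding *(2,6) non_opposite_scaleR[OF *(1) pos]
      using chord_cross(2)[of h a q] *(5) by (intro non_opposite_Im) simp
  next
    fix a h t l c assume *: "bridge (xs ! t) = Some (a, h, l)" "t < m" "q = h"
      "last_dir e = (1 + real k / 2) *\<^sub>R (corner h - corner a)" "0 < c" "first_dir f = c *\<^sub>R flow q"
    have "h = Suc a \<or> a = Suc h" using bridge_elementary(4)[OF elementary_nth[OF *(2)] *(1)] .
    then show ?thesis unfolding *(4,6) non_opposite_scaleR[OF pos *(5)]
      using chord_cross(1)[of h a q] *(3) by (intro non_opposite_Im) simp
  next
    \<comment> \<open>Two additional edges cannot follow each other: the level determines the layer,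
      which contains only one of them, and its two ends lie on different lines.\<close>
    fix a h t l a' h' t' l' assume *: "bridge (xs ! t) = Some (a, h, l)" "t < m" "k = 2 * t + 1" "q = h"
      "bridge (xs ! t') = Some (a', h', l')" "k = 2 * t' + 1" "q = a'"
    then have "t = t'" by simp
    then show ?thesis using * bridge_elementary(3)[OF elementary_nth[OF *(2)] *(1)] by simp
  qed
qed

lemma first_dir_outer_sink:
  assumes "f \<in> outer" "tail f = node Q 0 q" "q < n"
  shows "q \<notin> I" "\<exists>a>0. first_dir f = a *\<^sub>R corner q"
proof -
  have "q \<notin> I \<and> (\<exists>a>0. first_dir f = a *\<^sub>R corner q)"
    using assms(1,3,2)
  proof (rule outer_tailE, goal_cases)
    case (1 t)
    have "2 * t < (if q \<in> bridge_lines (xs ! t) then 2 * t + 1 else 2 * t + 2)" by simp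
    from spoke_dir(1)[OF 1(4) this assms(3)] show ?case using 1(2) by (simp add: flow_def)
  qed simp_all
  then show "q \<notin> I" "\<exists>a>0. first_dir f = a *\<^sub>R corner q" by auto
qed

lemma last_dir_outer_source:
  assumes "f \<in> outer" "head f = node Q 0 q" "q < n"
  shows "q \<in> I" "\<exists>a>0. last_dir f = a *\<^sub>R (- corner q)"
proof -
  have "q \<in> I \<and> (\<exists>a>0. last_dir f = a *\<^sub>R (- corner q))"
    using assms(1,3,2)
  proof (rule outer_headE, goal_cases)
    case (1 t)
    have "2 * t < (if q \<in> bridge_lines (xs ! t) then 2 * t + 1 else 2 * t + 2)" by simp
    from spoke_dir(2)[OF 1(4) this assms(3)] show ?case using 1(2) by (simp add: flow_def)
  qed simp_all
  then show "q \<in> I" "\<exists>a>0. last_dir f = a *\<^sub>R (- corner q)" by auto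
qed

lemma corner_previous_cross: "Im (cnj (side (q + L - 1)) * (- corner q)) > 0"
proof -
  have "corner (Suc (q + L - 1)) = corner q" using L by simp
  then show ?thesis using side_corner_cross(2)[of "q + L - 1"] by simp
qed

text \<open>Where \<open>N\<close> meets a layer, both directions lie on the same side of the line
  through an adjacent side of the polygon: both point outwards at a sink and inwards at a
  source.\<close>

lemma whole_turn:
  assumes e: "e \<in> whole" and f: "f \<in> whole" and ef: "head e = tail f"
  shows "non_opposite (last_dir e) (first_dir f)"
proof -
  consider "e \<in> edges N" "f \<in> edges N" | "e \<in> outer" "f \<in> outer" | "e \<in> edges N" "f \<in> outer" | "e \<in> outer" "f \<in> edges N"
    using e f by (auto simp: whole_def)
  then show ?thesis
  proof cases
    case 1
    then show ?thesis using N_turn ef by blast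
  next
    case 2
    then show ?thesis using outer_turn ef by blast
  next
    case 3
    obtain k q where q: "q < n" "tail f = node Q k q" using outer_end(1)[OF 3(2)] by blast
    then have k: "k = 0" using N_vertex_not_node[OF 3(1), of "head e" q k] ef by auto
    obtain a where a: "0 < a" "first_dir f = a *\<^sub>R corner q" using first_dir_outer_sink(2)[OF 3(2)] q k by auto
    have "Im (cnj (side q) * last_dir e) < 0" using N_last_dir[OF 3(1)] q k ef by simp
    moreover have "Im (cnj (side q) * first_dir f) = a * Im (cnj (side q) * corner q)" by (simp add: a algebra_simps)
    then have "Im (cnj (side q) * first_dir f) < 0" using side_corner_cross(1)[of q] a(1) by (simp add: mult_pos_neg)
    ultimately show ?thesis using non_opposite_same_sign by blast
  next
    case 4
    obtain k q where q: "q < n" "head e = node Q k q" using outer_end(2)[OF 4(1)] by blast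
    then have k: "k = 0" using N_vertex_not_node[OF 4(2), of "tail f" q k] ef by auto
    obtain a where a: "0 < a" "last_dir e = a *\<^sub>R (- corner q)" using last_dir_outer_source(2)[OF 4(1)] q k by auto
    have "Im (cnj (side (q + L - 1)) * first_dir f) > 0" using N_first_dir[OF 4(2)] q k ef by simp
    moreover have "Im (cnj (side (q + L - 1)) * last_dir e) = a * Im (cnj (side (q + L - 1)) * (- corner q))" by (simp add: a algebra_simps)
    then have "Im (cnj (side (q + L - 1)) * last_dir e) > 0" using corner_previous_cross[of q] a(1) by simp
    ultimately show ?thesis using non_opposite_same_sign by blast
  qed
qed

lemma whole_edge_turns:
  assumes "e \<in> whole"
  shows "successively non_opposite (dirs (fst e))"
proof (cases "e \<in> edges N")
  case True
  then show ?thesis using simple_arc_turns N_arc(1) by blast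
next
  case False
  then have "length (fst e) = 2" using outer_end(3)[of e] assms by (simp add: whole_def)
  then obtain p q where "fst e = [p, q]" by (auto simp: length_Suc_conv numeral_2_eq_2)
  then obtain d where "dirs (fst e) = [d]" by simp
  then show ?thesis by simp
qed

lemma walk_whole_turns: "walk whole P \<Longrightarrow> successively non_opposite (dirs (route P))"
  using walk_turns[OF arcs_whole whole_edge_turns whole_turn] .

lemma walk_N_turns:
  assumes "walk (edges N) P"
  shows "successively non_opposite (dirs (route P))"
  using assms by (intro walk_whole_turns) (auto simp: walk_def whole_def)

text \<open>Inner edges with a common first segment would overlap. Outer edges consist of two
  points, so they must be told apart by their ends; from an odd level the additional edge leads to
  another line while the spoke does not. A boundary vertex of \<open>N\<close> has outgoing edges on
  one side only.\<close>

lemma two_point_determined_whole: "two_point_determined whole"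
  unfolding two_point_determined_def
proof (intro ballI impI)
  fix e f assume e: "e \<in> whole" and f: "f \<in> whole" and ef: "tail e = tail f \<and> fst e ! 1 = fst f ! 1"
  have mixed: False if g: "g \<in> edges N" and h: "h \<in> outer" and "tail g = tail h" for g h
  proof -
    obtain k q where q: "q < n" "tail h = node Q k q" using outer_end(1)[OF h] by blast
    have tg: "tail g = node Q k q" using that(3) q(2) by simp
    then have k: "k = 0" using N_vertex_not_node[OF g, of "tail g" q k] q(1) by (cases "k = 0") simp_all
    then have "q \<notin> I" using first_dir_outer_sink(1)[OF h, of q] q by simp
    moreover have "g \<in> {e \<in> edges N. tail e = node Q 0 q}" using g tg k by simp
    ultimately show False using N_sink[OF q(1)] by simp
  qed
  consider "e \<in> edges N" "f \<in> edges N" | "e \<in> outer" "f \<in> outer"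
    using e f mixed[of e f] mixed[of f e] conjunct1[OF ef] unfolding whole_def by (metis UnE)
  then show "e = f"
  proof cases
    case 1
    show ?thesis
    proof (rule ccontr)
      assume "e \<noteq> f"
      have le: "2 \<le> length (fst e)" "2 \<le> length (fst f)" using arcsD[OF arcs_N] 1 by auto
      define v s where "v = tail e" and "s = fst e ! 1"
      have "closed_segment v s \<subseteq> polyline (fst e)" "closed_segment v s \<subseteq> polyline (fst f)"
        using first_segment(2)[OF le(1)] first_segment(2)[OF le(2)] ef by (auto simp: v_def s_def)
      then have sub: "closed_segment v s \<subseteq> {tail e, head e}" using N_disjoint[OF 1 \<open>e \<noteq> f\<close>] by blast
      have "v \<noteq> s"
      proof -
        have "fst e \<noteq> []" using le(1) by auto
        then have "v = fst e ! 0" by (simp add: v_def hd_conv_nth)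
        then show ?thesis using simple_arc_nth_neq[OF N_arc(1)[OF 1(1)], of 0 1] le(1) \<open>fst e \<noteq> []\<close> by (simp add: s_def)
      qed
      \<comment> \<open>Neither the midpoint nor \<open>s\<close> equals \<open>v\<close>, which is
        the tail, so both would have to be the head.\<close>
      have "midpoint v s \<in> {tail e, head e}" "s \<in> {tail e, head e}"
        using subsetD[OF sub midpoint_in_closed_segment] subsetD[OF sub ends_in_segment(2)] by simp_all
      then have "midpoint v s = s" using \<open>v \<noteq> s\<close> unfolding v_def[symmetric] by (metis insertE midpoint_eq_endpoint(1) singletonD)
      then show False using \<open>v \<noteq> s\<close> by simp
    qed
  next
    case 2
    obtain k q where q: "q < n" "tail e = node Q k q" using outer_end(1)[OF 2(1)] by blast
    then have fq: "tail f = node Q k q" using ef by simp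
    have hd1: "fst g ! 1 = head g" if "g \<in> outer" for g
      using outer_end(3)[OF that] by (cases "fst g") (auto simp: last_conv_nth)
    show ?thesis
    proof (cases "even k")
      case True
      then obtain t where t: "k = 2 * t" by blast
      show ?thesis
      proof (cases "t < m")
        case True
        then have "tail e \<in> glue_points" using q t by (auto simp: glue_points_def)
        then show ?thesis using glue_point_outgoing_unique e f ef by blast
      next
        case False
        have "g = spoke Q I q (if q \<in> bridge_lines (xs ! (t - 1)) then 2 * t - 1 else 2 * t - 2) (2 * t) (diagonal_weight (xs ! (t - 1)) q)"
          if g: "g \<in> outer" "tail g = node Q (2 * t) q" for g
          using g(1) q(1) g(2)
        proof (rule outer_tailE, goal_cases)
          case (1 t')
          then show ?case using False by simp
        next
          case (2 t')
          then have "t - 1 = t'" "2 * t - 1 = 2 * t' + 1" "2 * t - 2 = 2 * t'" by simp_all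
          then show ?case using 2 by simp
        next
          case (3 t')
          then have "2 * t = 2 * t' + 1" by blast
          then have False by presburger
          then show ?case ..
        next
          case (4 t')
          then have "2 * t = 2 * t' + 1" by blast
          then have False by presburger
          then show ?case ..
        qed
        note u = this
        have te: "tail e = node Q (2 * t) q" "tail f = node Q (2 * t) q" using q(2) fq t by simp_all
        show ?thesis using u[OF 2(1) te(1)] u[OF 2(2) te(2)] by simp
      qed
    next
      case False
      then obtain t where t: "k = 2 * t + 1" by (metis oddE)
      define s where "s = (if q \<in> I then spoke Q I q (2 * t) (2 * t + 1) 1 else spoke Q I q (2 * t + 1) (2 * t + 2) (1 :: 'k))"
      have g: "g = s \<or> (t < m \<and> (\<exists>h l. bridge (xs ! t) = Some (q, h, l) \<and> g = ([node Q (2 * t + 1) q, node Q (2 * t + 1) h], l)))"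
        if g: "g \<in> outer" "tail g = node Q k q" for g
        using g(1) q(1) g(2)
      proof (rule outer_tailE, goal_cases)
        case (1 t')
        then have False using 1(3) t by (metis even_add even_mult_iff even_numeral odd_one)
        then show ?case ..
      next
        case (2 t')
        then have False using 2(3) t by (metis even_add even_mult_iff even_numeral odd_one)
        then show ?case ..
      next
        case (3 t')
        then show ?case using t by (simp add: s_def)
      next
        case (4 t' h l)
        then show ?case using t by auto
      qed
      have sh: "head s \<noteq> node Q (2 * t + 1) h" if "t < m" "bridge (xs ! t) = Some (q, h, l)" for h l
        using bridge_elementary[OF elementary_nth[OF that(1)] that(2)] by (auto simp: s_def head_spoke node_eq)
      have hef: "head e = head f" using hd1[OF 2(1)] hd1[OF 2(2)] ef by simp
      from g[OF 2(1) q(2)] g[OF 2(2) fq] show ?thesis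
      proof (elim disjE exE conjE)
        assume "e = s" "f = s"
        then show ?thesis by simp
      next
        fix h l assume "e = s" "t < m" "bridge (xs ! t) = Some (q, h, l)" "f = ([node Q (2 * t + 1) q, node Q (2 * t + 1) h], l)"
        then show ?thesis using sh[of h l] hef by simp
      next
        fix h l assume "f = s" "t < m" "bridge (xs ! t) = Some (q, h, l)" "e = ([node Q (2 * t + 1) q, node Q (2 * t + 1) h], l)"
        then show ?thesis using sh[of h l] hef by simp
      next
        fix h l h' l' assume "bridge (xs ! t) = Some (q, h, l)" "f = ([node Q (2 * t + 1) q, node Q (2 * t + 1) h], l)"
          "bridge (xs ! t) = Some (q, h', l')" "e = ([node Q (2 * t + 1) q, node Q (2 * t + 1) h'], l')"
        then show ?thesis by simp
      qed
    qed
  qed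
qed

end

section \<open>Boundary measurements as sums over walks\<close>

lemma walk_merge_expand:
  assumes E: "arcs E" and P: "walk (merge G E) P"
  shows "\<exists>W. walk E W \<and> route P = route W"
proof -
  have "set P \<subseteq> contract ` strands G E" "P \<noteq> []" using P by (auto simp: walk_def merge_eq)
  then obtain PP where PP: "P = map contract PP" "set PP \<subseteq> strands G E"
    using subset_image_map by metis
  have ne: "PP \<noteq> []" "[] \<notin> set PP" using PP \<open>P \<noteq> []\<close> strands_nonempty by auto
  have "walk E (concat PP)" using walk_contract_iff[OF E ne(1) PP(2)] P PP(1) by simp
  then show ?thesis using route_contract[OF ne] PP(1) by auto
qed

context disk
begin

text \<open>The part of the sign in \<open>conc_closed_walk\<close> that depends on the end points
  alone.\<close>

definition boundary_sign :: "nat \<Rightarrow> nat \<Rightarrow> int" where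
  "boundary_sign i j = (if j < i then - 1 else 1) * angle_gauge (corner j) (theta j) * angle_gauge (- corner i) (theta i + pi)"

text \<open>Once the boundary factor is split off, the sign of a path is the path sign of its
  directions with a radial direction added at either end, which is what \<open>walk_series\<close>
  sums.\<close>

lemma path_series_eq_walk_series:
  fixes M :: "'k::field network" and c :: real
  assumes ij: "i < L" "j < L" "i \<noteq> j" and c: "0 < c" and M: "corners M = map (\<lambda>z. c *\<^sub>R z) Q" "arcs (edges M)"
    and good: "\<And>P. P \<in> paths M i j \<Longrightarrow> Im (cnj (side j) * last (dirs (route P))) < 0 \<and>
      Im (cnj (side (i + L - 1)) * hd (dirs (route P))) > 0 \<and> successively non_opposite (dirs (route P))"
  shows "path_series M i j = of_int (boundary_sign i j) * walk_series (edges M) (c *\<^sub>R corner i) (- corner i) (c *\<^sub>R corner j) (corner j)"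
proof (rule fps_ext)
  fix k
  have cor: "corners M ! i = c *\<^sub>R corner i" "corners M ! j = c *\<^sub>R corner j"
    using ij by (simp_all add: M corner_def)
  have sgn: "(- 1) ^ (conc (closed_path M i j P) + 1) = boundary_sign i j * path_sign (- corner i # dirs (route P) @ [corner j])"
    if P: "P \<in> paths M i j" for P
  proof -
    have w: "walk (edges M) P" "tail (hd P) = c *\<^sub>R corner i" "head (last P) = c *\<^sub>R corner j"
      using P by (auto simp: paths_def cor)
    have len: "2 \<le> length (fst e)" if "e \<in> set P" for e using arcsD[OF M(2) walk_edges[OF w(1) that]] .
    have ne: "P \<noteq> []" using w(1) by (simp add: walk_def)
    have d: "dirs (route P) \<noteq> []" by (rule dirs_route_nonempty[OF ne len])
    have l2: "2 \<le> length (route P)" using d by simp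
    have lr: "last (route P) = c *\<^sub>R corner j" using last_route[OF ne len] w(3) by simp
    have "path_sign (- corner i # dirs (route P) @ [corner j]) =
       turn_sign (- corner i) (hd (dirs (route P))) * path_sign (dirs (route P)) * turn_sign (last (dirs (route P))) (corner j)"
      using d by (simp add: path_sign_Cons path_sign_append)
    moreover have "(- 1) ^ (conc (butlast (route P) @ boundary_path (map (\<lambda>z. c *\<^sub>R z) Q) j i) + 1)
     = (if j < i then - 1 else 1) * angle_gauge (corner j) (theta j) * angle_gauge (- corner i) (theta i + pi)
       * turn_sign (- corner i) (hd (dirs (route P))) * path_sign (dirs (route P)) * turn_sign (last (dirs (route P))) (corner j)"
      using good[OF P] by (intro conc_closed_walk[OF ij c l2 _ lr]) (simp_all add: w(2))
    ultimately show ?thesis by (simp add: closed_path_def M(1) boundary_sign_def)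
  qed
  have "fps_nth (path_series M i j) k = (\<Sum>P\<in>{P \<in> paths M i j. walk_degree P = k}.
     of_int (boundary_sign i j) * (of_int (path_sign (- corner i # dirs (route P) @ [corner j])) * walk_weight P))"
    unfolding path_series_def fps_nth_Abs_fps
  proof (rule sum.cong[OF refl])
    fix P assume "P \<in> {P \<in> paths M i j. walk_degree P = k}"
    then have "P \<in> paths M i j" by simp
    then show "of_int ((- 1) ^ (conc (closed_path M i j P) + 1)) * walk_weight P =
      of_int (boundary_sign i j) * (of_int (path_sign (- corner i # dirs (route P) @ [corner j])) * walk_weight P)"
      by (simp only: sgn of_int_mult mult.assoc)
  qed
  also have "{P \<in> paths M i j. walk_degree P = k} =
     {P. walk (edges M) P \<and> tail (hd P) = c *\<^sub>R corner i \<and> head (last P) = c *\<^sub>R corner j \<and> walk_degree P = k}"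
    by (auto simp: paths_def cor)
  finally show "fps_nth (path_series M i j) k = fps_nth (of_int (boundary_sign i j) * walk_series (edges M) (c *\<^sub>R corner i) (- corner i) (c *\<^sub>R corner j) (corner j)) k"
    by (simp add: walk_series_def sum_distrib_left fps_of_int[symmetric] del: fps_of_int)
qed

end

context glued_network
begin

lemma node_0: "q < n \<Longrightarrow> node Q 0 q = corner q"
  using less_L by (simp add: node_corner)

definition inner_response :: "nat \<Rightarrow> nat \<Rightarrow> 'k fps" where
  "inner_response i j = vertex_current (edges N) (node Q 0 i) (- corner i) (node Q 0 j) (corner j)"

definition total_response :: "nat \<Rightarrow> nat \<Rightarrow> 'k fps" where
  "total_response i j = vertex_current whole (node Q (2 * m) i) (- corner i) (node Q (2 * m) j) (corner j)"

lemma path_series_N: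
  assumes i: "i \<in> I" and j: "j < n" "j \<notin> I"
  shows "path_series N i j = of_int (boundary_sign i j) * inner_response i j"
proof -
  have lt: "i < n" using i I_subset by auto
  have ij: "i < L" "j < L" "i \<noteq> j" using lt j i less_L by auto
  have "path_series N i j = of_int (boundary_sign i j) * walk_series (edges N) (1 *\<^sub>R corner i) (- corner i) (1 *\<^sub>R corner j) (corner j)"
  proof (rule path_series_eq_walk_series[OF ij])
    fix P assume P: "P \<in> paths N i j"
    then have w: "walk (edges N) P" "tail (hd P) = node Q 0 i" "head (last P) = node Q 0 j"
      by (auto simp: paths_def node_def)
    then have "hd P \<in> edges N" "last P \<in> edges N" by (auto simp: walk_def)
    then show "Im (cnj (side j) * last (dirs (route P))) < 0 \<and>
      Im (cnj (side (i + L - 1)) * hd (dirs (route P))) > 0 \<and> successively non_opposite (dirs (route P))"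
      using N_first_dir[OF _ w(2) lt] N_last_dir[OF _ w(3) j(1)] walk_N_turns[OF w(1)]
      unfolding dirs_route_ends[OF w(1) arcs_N] by blast
  qed (use arcs_N in simp_all)
  moreover have "node Q 0 i \<noteq> node Q 0 j" using node_eq lt j(1) ij(3) by simp
  ultimately show ?thesis
    using walk_series_eq[OF finite_N arcs_N, of "corner i" "corner j"] node_0 lt j(1) by (simp add: inner_response_def)
qed

lemma glue_points_outer_end: "q < n \<Longrightarrow> node Q (2 * m) q \<notin> glue_points"
  using node_eq by (auto simp: glue_points_def)

text \<open>The glued network is measured in the polygon dilated by \<open>c = 1 + m\<close>. Its
  paths are expanded to walks of \<open>whole\<close>, whose first and last edges run along radial
  lines; this gives the half-plane conditions at the boundary.\<close>

lemma path_series_compose: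
  assumes i: "i \<in> I" and j: "j < n" "j \<notin> I"
  shows "path_series (compose_net n I N xs) i j = of_int (boundary_sign i j) * total_response i j"
proof -
  define M where "M = compose_net n I N xs"
  define c where "c = 1 + real m"
  have cpos: "0 < c" by (simp add: c_def add_pos_nonneg)
  have lt: "i < n" using i I_subset by auto
  have ij: "i < L" "j < L" "i \<noteq> j" using lt j i less_L by auto
  have cor: "corners M = map (\<lambda>z. c *\<^sub>R z) Q" by (simp add: M_def compose_net_def c_def)
  have ed: "edges M = merge glue_points whole" using edges_compose by (simp add: M_def)
  have nodes: "node Q (2 * m) q = c *\<^sub>R corner q" if "q < n" for q
    using that less_L by (simp add: node_corner c_def)
  have "path_series M i j = of_int (boundary_sign i j) * walk_series (edges M) (c *\<^sub>R corner i) (- corner i) (c *\<^sub>R corner j) (corner j)"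
  proof (rule path_series_eq_walk_series[OF ij cpos cor])
    show "arcs (edges M)" unfolding ed by (rule arcs_merge[OF arcs_whole])
    fix P assume P: "P \<in> paths M i j"
    have wM: "walk (merge glue_points whole) P" using P by (simp add: paths_def ed)
    obtain W where W: "walk whole W" "route P = route W" using walk_merge_expand[OF arcs_whole wM] by blast
    have Pne: "P \<noteq> []" "W \<noteq> []" using wM W by (auto simp: walk_def)
    have lenP: "\<And>e. e \<in> set P \<Longrightarrow> 2 \<le> length (fst e)" using arcsD[OF arcs_merge[OF arcs_whole] walk_edges[OF wM]] .
    have lenW: "\<And>e. e \<in> set W \<Longrightarrow> 2 \<le> length (fst e)" using arcsD[OF arcs_whole walk_edges[OF W(1)]] .
    have tl: "tail (hd W) = node Q (2 * m) i"
    proof -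
      have "tail (hd W) = tail (hd P)" using arg_cong[OF W(2), of hd] by simp
      then show ?thesis using P ij lt by (simp add: paths_def cor nodes corner_def)
    qed
    have hl: "head (last W) = node Q (2 * m) j"
    proof -
      have "head (last W) = head (last P)" using last_route[OF Pne(1) lenP] last_route[OF Pne(2) lenW] W(2) by simp
      then show ?thesis using P ij j(1) by (simp add: paths_def cor nodes corner_def)
    qed
    have m: "0 < 2 * m" using xs by simp
    have o: "hd W \<in> outer" "last W \<in> outer"
      using whole_tail_outer[OF _ tl lt] whole_head_outer[OF _ hl j(1)] m Pne walk_edges[OF W(1)] by auto
    have "\<exists>a>0. first_dir (hd W) = a *\<^sub>R flow i"
      using o(1) lt tl
    proof (rule outer_tailE, goal_cases)
      case (2 t)
      show ?case by (rule spoke_dir(1)[OF 2(4) _ lt]) simp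
    next
      case (3 t)
      then have "2 * m = 2 * t + 1" by blast
      then have False by presburger
      then show ?case ..
    next
      case (4 t)
      then have "2 * m = 2 * t + 1" by blast
      then have False by presburger
      then show ?case ..
    qed (use i in simp)
    then obtain a where a: "0 < a" "first_dir (hd W) = a *\<^sub>R (- corner i)" using i by (auto simp: flow_def)
    have "\<exists>b>0. last_dir (last W) = b *\<^sub>R flow j"
      using o(2) j(1) hl
    proof (rule outer_headE, goal_cases)
      case (2 t)
      show ?case by (rule spoke_dir(2)[OF 2(4) _ j(1)]) simp
    next
      case (3 t)
      then have "2 * m = 2 * t + 1" by blast
      then have False by presburger
      then show ?case ..
    next
      case (4 t)
      then have "2 * m = 2 * t + 1" by blast
      then have False by presburger
      then show ?case ..
    qed (use j in simp)
    then obtain b where b: "0 < b" "last_dir (last W) = b *\<^sub>R corner j" using j by (auto simp: flow_def)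
    have "Im (cnj (side j) * last_dir (last W)) = b * Im (cnj (side j) * corner j)" by (simp add: b(2) algebra_simps)
    then have 1: "Im (cnj (side j) * last_dir (last W)) < 0" using b(1) side_corner_cross(1)[of j] by (simp add: mult_pos_neg)
    have "Im (cnj (side (i + L - 1)) * first_dir (hd W)) = a * Im (cnj (side (i + L - 1)) * (- corner i))" by (simp add: a(2) algebra_simps)
    then have 2: "Im (cnj (side (i + L - 1)) * first_dir (hd W)) > 0" using a(1) corner_previous_cross[of i] by simp
    show "Im (cnj (side j) * last (dirs (route P))) < 0 \<and>
      Im (cnj (side (i + L - 1)) * hd (dirs (route P))) > 0 \<and> successively non_opposite (dirs (route P))"
      using 1 2 walk_whole_turns[OF W(1)] unfolding W(2) dirs_route_ends[OF W(1) arcs_whole] by blast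
  qed
  also have "walk_series (edges M) (c *\<^sub>R corner i) (- corner i) (c *\<^sub>R corner j) (corner j)
    = walk_series whole (node Q (2 * m) i) (- corner i) (node Q (2 * m) j) (corner j)"
    unfolding ed using walk_series_merge[OF arcs_whole two_point_determined_whole glue_points_outer_end[OF lt] glue_points_outer_end[OF j(1)]]
    by (simp add: nodes lt j(1))
  also have "\<dots> = total_response i j"
    unfolding total_response_def using node_eq[OF lt j(1)] ij(3) by (intro walk_series_eq[OF finite_whole arcs_whole]) simp
  finally show ?thesis by (simp add: M_def)
qed

lemma has_value_inner:
  assumes "measurements_defined n I N" "i \<in> I" "j < n" "j \<notin> I"
  shows "has_value (fps_to_fls (of_int (boundary_sign i j) * inner_response i j)) (measurement N i j)"
proof -
  obtain x where "has_measurement N i j x" using assms unfolding measurements_defined_def by force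
  from has_value_measurement[OF finite_N arcsD[OF arcs_N] this]
  show ?thesis using path_series_N assms by simp
qed

lemma has_value_total:
  assumes "measurements_defined n I (compose_net n I N xs)" "i \<in> I" "j < n" "j \<notin> I"
  shows "has_value (fps_to_fls (of_int (boundary_sign i j) * total_response i j)) (measurement (compose_net n I N xs) i j)"
proof -
  obtain x where x: "has_measurement (compose_net n I N xs) i j x" using assms unfolding measurements_defined_def by force
  have "finite (edges (compose_net n I N xs))"
    unfolding edges_compose by (rule finite_merge[OF finite_whole glue_point_outgoing_unique])
  moreover have "2 \<le> length (fst e)" if "e \<in> edges (compose_net n I N xs)" for e
    using arcsD[OF arcs_merge[OF arcs_whole]] that unfolding edges_compose .
  ultimately show ?thesis using has_value_measurement[OF _ _ x] path_series_compose assms by simp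
qed

end

section \<open>Passing through a layer\<close>

lemma vertex_current_scaleR:
  assumes "0 < r"
  shows "vertex_current E v d u (r *\<^sub>R c) = vertex_current E v d u c"
  using assms by (simp add: vertex_current_def turn_sign_scaleR)

context glued_network
begin

text \<open>Compares the principal lift of the flow direction of line \<open>q\<close> with the one
  given by its lifted angle, which is \<open>theta q\<close> for a sink and
  \<open>theta q + pi\<close> for a source.\<close>

definition gauge :: "nat \<Rightarrow> int" where
  "gauge q = (if q \<in> I then angle_gauge (- corner q) (theta q + pi) else angle_gauge (corner q) (theta q))"

lemma gauge_square [simp]: "gauge q * gauge q = 1"
  by (simp add: gauge_def)

lemma flow_angle: "has_angle (flow q) (if q \<in> I then theta q + pi else theta q)"
  using has_angle_theta[of q] has_angle_uminus[OF has_angle_theta[of q]] by (simp add: flow_def)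

text \<open>The angle of side \<open>q\<close> lies between the angles of the adjacent corners and
  the same angles increased by \<open>pi\<close>. It is less than \<open>pi\<close> away from the
  flow direction of either line, whether that points outwards or inwards.\<close>

lemma turn_sign_upward:
  "turn_sign (flow q) (side q) * turn_sign (side q) (flow (Suc q)) = gauge q * gauge (Suc q)"
proof -
  define g where "g = angle_gauge (side q) (side_angle q)"
  note s = side_angle[of q] theta_Suc[of q]
  have 1: "turn_sign (flow q) (side q) = gauge q * g"
    using turn_sign_near[OF flow_angle[of q] s(1)] s(2-) by (simp add: g_def gauge_def flow_def)
  have 2: "turn_sign (side q) (flow (Suc q)) = g * gauge (Suc q)"
    using turn_sign_near[OF s(1) flow_angle[of "Suc q"]] s(2-) by (simp add: g_def gauge_def flow_def)
  have "g * g = 1" by (simp add: g_def)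
  moreover have "gauge q * g * (g * gauge (Suc q)) = gauge q * (g * g) * gauge (Suc q)"
    by (simp only: mult.assoc)
  ultimately show ?thesis unfolding 1 2 by simp
qed

text \<open>The reversed side has its angle increased by \<open>pi\<close>. It is still close to
  inward directions but more than \<open>pi\<close> beyond outward ones, so each of the two lines
  that leads to a sink contributes a factor \<open>- 1\<close>; the factors cancel unless exactly
  one line does.\<close>

lemma turn_sign_downward:
  "turn_sign (flow (Suc q)) (- side q) * turn_sign (- side q) (flow q)
     = (if (q \<in> I) = (Suc q \<in> I) then 1 else - 1) * (gauge q * gauge (Suc q))"
proof -
  define g where "g = angle_gauge (- side q) (side_angle q + pi)"
  note s = side_angle(2,3)[of q] theta_Suc[of q]
  note a = has_angle_uminus[OF side_angle(1)[of q]]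
  have 1: "turn_sign (flow (Suc q)) (- side q) = (if Suc q \<in> I then 1 else - 1) * (gauge (Suc q) * g)"
  proof (cases "Suc q \<in> I")
    case True
    then show ?thesis using turn_sign_near[OF flow_angle[of "Suc q"] a] s by (simp add: g_def gauge_def flow_def)
  next
    case False
    then show ?thesis using turn_sign_far[OF flow_angle[of "Suc q"] a] s by (simp add: g_def gauge_def flow_def)
  qed
  have 2: "turn_sign (- side q) (flow q) = (if q \<in> I then 1 else - 1) * (g * gauge q)"
  proof (cases "q \<in> I")
    case True
    then show ?thesis using turn_sign_near[OF a flow_angle[of q]] s by (simp add: g_def gauge_def flow_def)
  next
    case False
    then show ?thesis using turn_sign_far[OF a flow_angle[of q]] s by (simp add: g_def gauge_def flow_def)
  qed
  have "g * g = 1" by (simp add: g_def)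
  moreover have "x * (gauge (Suc q) * g) * (y * (g * gauge q)) = x * y * (g * g) * (gauge q * gauge (Suc q))" for x y
    by (simp only: mult_ac)
  ultimately show ?thesis unfolding 1 2 by simp
qed

lemma turn_sign_chord:
  assumes "h = Suc a \<or> a = Suc h" "0 < r"
  shows "turn_sign (flow a) (r *\<^sub>R (corner h - corner a)) * turn_sign (r *\<^sub>R (corner h - corner a)) (flow h)
     = (if a = Suc h \<and> (a \<in> I) \<noteq> (h \<in> I) then - 1 else 1) * (gauge a * gauge h)"
  using assms(1)
proof
  assume h: "h = Suc a"
  then have "corner h - corner a = side a" by (simp add: side_def)
  then show ?thesis using turn_sign_upward[of a] h assms(2) by (simp add: turn_sign_scaleR)
next
  assume a: "a = Suc h"
  then have e: "corner h - corner a = - side h" by (simp add: side_def)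
  show ?thesis
    unfolding e turn_sign_scaleR[OF assms(2)] using turn_sign_downward[of h] a by (simp add: mult.commute)
qed

definition cur :: "nat \<Rightarrow> 'k edge \<Rightarrow> 'k fps" where
  "cur i e = current whole (node Q (2 * m) i) (- corner i) e"

definition vcur :: "nat \<Rightarrow> complex \<Rightarrow> complex \<Rightarrow> 'k fps" where
  "vcur i u c = vertex_current whole (node Q (2 * m) i) (- corner i) u c"

lemma vcur_scaleR: "0 < r \<Longrightarrow> vcur i u (r *\<^sub>R c) = vcur i u c"
  by (simp add: vcur_def vertex_current_scaleR)

lemma cur_eq: "e \<in> whole \<Longrightarrow> cur i e = edge_factor e * vcur i (tail e) (first_dir e)"
  unfolding cur_def vcur_def by (rule current_eq[OF finite_whole arcs_whole])

lemma vcur_eq: "u \<noteq> node Q (2 * m) i \<Longrightarrow> vcur i u c = (\<Sum>f\<in>{f \<in> whole. head f = u}. cur i f * of_int (turn_sign (last_dir f) c))"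
  by (simp add: vcur_def cur_def vertex_current_def)

lemma edge_factor_segment: "edge_factor ([p, q], w) = fps_const w * fps_X"
  by (simp add: edge_factor_def edge_degree_def)

lemma edge_factor_spoke: "edge_factor (spoke Q I q a b w) = fps_const (if q \<in> I then inverse w else w) * fps_X"
  by (simp add: spoke_def edge_factor_segment)

lemma cur_spoke:
  assumes "spoke Q I q a b w \<in> whole" "a < b" "q < n"
  shows "cur i (spoke Q I q a b w) = fps_const (if q \<in> I then inverse w else w) * fps_X * vcur i (node Q (if q \<in> I then b else a) q) (flow q)"
proof -
  obtain c where c: "c > 0" "first_dir (spoke Q I q a b w) = c *\<^sub>R flow q" using spoke_dir(1)[OF refl assms(2,3)] by blast
  show ?thesis unfolding cur_eq[OF assms(1)] edge_factor_spoke tail_spoke c(2) vcur_scaleR[OF c(1)] ..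
qed

lemma vcur_single_spoke:
  assumes "{f \<in> whole. head f = u} = {spoke Q I q a b w}" "u \<noteq> node Q (2 * m) i" "a < b" "q < n"
  shows "vcur i u c = fps_const (if q \<in> I then inverse w else w) * fps_X * vcur i (node Q (if q \<in> I then b else a) q) (flow q)
     * of_int (turn_sign (flow q) c)"
proof -
  have "spoke Q I q a b w \<in> whole" using assms(1) by blast
  note cs = cur_spoke[OF this assms(3,4)]
  obtain r where r: "r > 0" "last_dir (spoke Q I q a b w) = r *\<^sub>R flow q" using spoke_dir(2)[OF refl assms(3,4)] by blast
  show ?thesis unfolding vcur_eq[OF assms(2)] assms(1) by (simp add: cs r turn_sign_scaleR)
qed

text \<open>Everything that the walks from source \<open>i\<close> bring to the node at level
  \<open>k\<close> of line \<open>q\<close>, turned into the direction in which the line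
  continues.\<close>

definition station :: "nat \<Rightarrow> nat \<Rightarrow> nat \<Rightarrow> 'k fps" where
  "station i k q = vcur i (node Q k q) (flow q)"

lemma station_source:
  assumes "i \<in> I" "q \<in> I"
  shows "station i (2 * m) q = (if q = i then 1 else 0)"
proof -
  have lt: "i < n" "q < n" using assms I_subset by auto
  show ?thesis
    unfolding station_def vcur_def vertex_current_def incoming_source[OF lt(2) assms(2)]
    using node_eq[OF lt(2,1)] assms by (simp add: flow_def)
qed

lemma station_sink: "j \<notin> I \<Longrightarrow> station i (2 * m) j = total_response i j"
  by (simp add: station_def vcur_def total_response_def flow_def)

lemma not_source: "i \<in> I \<Longrightarrow> q < n \<Longrightarrow> k \<noteq> 2 * m \<or> q \<noteq> i \<Longrightarrow> node Q k q \<noteq> node Q (2 * m) i"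
  using node_eq I_subset by (metis lessThan_iff subsetD)

text \<open>Only the line itself leads to this vertex, so for \<open>N\<close> it acts as a source
  into which the current \<open>station i 0 q\<close> is injected in the direction
  \<open>- corner q\<close>.\<close>

lemma vcur_inner_source:
  assumes i: "i \<in> I" and q: "q \<in> I"
  shows "vcur i (node Q 0 q) c = station i 0 q * of_int (turn_sign (- corner q) c)"
proof -
  have m: "0 < m" using xs by simp
  have qn: "q < n" using q I_subset by auto
  have ns: "node Q 0 q \<noteq> node Q (2 * m) i" using not_source[OF i qn] m by simp
  note inc = incoming_source_line[OF m qn q, unfolded mult_0_right]
  have lt: "0 < (if q \<in> bridge_lines (xs ! 0) then 0 + 1 else 0 + 2 :: nat)" by simp
  show ?thesis
    unfolding station_def vcur_single_spoke[OF inc ns lt qn] using q by (simp add: flow_def)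
qed

text \<open>Superposition: inside \<open>N\<close> both sides satisfy the same linear system with
  the same injected currents, so their difference solves the homogeneous system. Walks that leave
  \<open>N\<close> and return are thus accounted for without being decomposed.\<close>

lemma cur_inner:
  assumes i: "i \<in> I" and e: "e \<in> edges N"
  shows "cur i e = (\<Sum>q\<in>I. station i 0 q * current (edges N) (node Q 0 q) (- corner q) e)"
proof -
  have fI: "finite I" using I_subset finite_subset by blast
  define X where "X q f = current (edges N) (node Q 0 q) (- corner q) f" for q and f :: "'k edge"
  define D where "D f = cur i f - (\<Sum>q\<in>I. station i 0 q * X q f)" for f :: "'k edge"
  have m: "0 < m" using xs by simp
  have "D e = edge_factor e * (\<Sum>f\<in>{f\<in>edges N. head f = tail e}. D f * of_int (turn_sign (last_dir f) (first_dir e)))"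
    if e: "e \<in> edges N" for e
  proof -
    define F where "F = {f\<in>edges N. head f = tail e}"
    define s where "s f = (of_int (turn_sign (last_dir f) (first_dir e)) :: 'k fps)" for f :: "'k edge"
    define b where "b q = (if tail e = node Q 0 q then of_int (turn_sign (- corner q) (first_dir e)) else 0 :: 'k fps)" for q
    have X: "X q e = edge_factor e * (b q + (\<Sum>f\<in>F. X q f * s f))" for q
      unfolding X_def b_def F_def s_def current_eq[OF finite_N arcs_N e] vertex_current_def ..
    \<comment> \<open>A tail in the interior receives no injected current, and a tail at a source of
      \<open>N\<close> receives nothing else.\<close>
    have V: "vcur i (tail e) (first_dir e) = (\<Sum>q\<in>I. station i 0 q * b q) + (\<Sum>f\<in>F. cur i f * s f)"
    proof (cases "tail e \<in> interior (convex hull set Q)")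
      case True
      then have ne: "tail e \<noteq> node Q k q" if "q < n" for k q using node_not_interior[OF less_L[OF that]] by metis
      have "b q = 0" if "q \<in> I" for q
      proof -
        have "q < n" using that I_subset by auto
        then show ?thesis using ne[of q 0] by (simp add: b_def)
      qed
      moreover have "tail e \<noteq> node Q (2 * m) i" using ne i I_subset by auto
      ultimately show ?thesis by (simp add: vcur_eq incoming_interior[OF True] F_def s_def)
    next
      case False
      then obtain q where q: "q < n" "tail e = node Q 0 q" using N_vertex[OF e, of "tail e"] by auto
      have qI: "q \<in> I"
      proof (rule ccontr)
        assume "q \<notin> I"
        moreover have "e \<in> {e \<in> edges N. tail e = node Q 0 q}" using e q(2) by simp
        ultimately show False using N_sink[OF q(1)] by simp
      qed
      have "F = {}" unfolding F_def q(2) by (rule N_source(2)[OF qI])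
      moreover have "(\<Sum>p\<in>I. station i 0 p * b p) = (\<Sum>p\<in>I. if p = q then station i 0 q * of_int (turn_sign (- corner q) (first_dir e)) else 0)"
        using node_eq[OF q(1)] I_subset by (intro sum.cong) (auto simp: b_def q(2))
      ultimately show ?thesis using vcur_inner_source[OF i qI] fI qI by (simp add: q(2))
    qed
    have "D e = edge_factor e * vcur i (tail e) (first_dir e) - (\<Sum>q\<in>I. station i 0 q * (edge_factor e * (b q + (\<Sum>f\<in>F. X q f * s f))))"
      unfolding D_def X[symmetric] using cur_eq[of e i] e by (simp add: whole_def)
    also have "\<dots> = edge_factor e * (vcur i (tail e) (first_dir e) - (\<Sum>q\<in>I. station i 0 q * b q) - (\<Sum>q\<in>I. \<Sum>f\<in>F. station i 0 q * X q f * s f))"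
      by (simp add: algebra_simps sum.distrib sum_distrib_left)
    also have "(\<Sum>q\<in>I. \<Sum>f\<in>F. station i 0 q * X q f * s f) = (\<Sum>f\<in>F. (\<Sum>q\<in>I. station i 0 q * X q f) * s f)"
      by (subst sum.swap) (simp add: sum_distrib_right)
    also have "vcur i (tail e) (first_dir e) - (\<Sum>q\<in>I. station i 0 q * b q) - (\<Sum>f\<in>F. (\<Sum>q\<in>I. station i 0 q * X q f) * s f) = (\<Sum>f\<in>F. D f * s f)"
      unfolding V D_def by (simp add: sum_subtractf left_diff_distrib)
    finally show ?thesis by (simp add: F_def s_def)
  qed
  from homogeneous_current_zero[OF arcs_N this e] have "D e = 0" .
  then show ?thesis by (simp add: D_def X_def)
qed

lemma station_inner_sink:
  assumes i: "i \<in> I" and j: "j < n" "j \<notin> I"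
  shows "station i 0 j = (\<Sum>q\<in>I. station i 0 q * inner_response q j)"
proof -
  define F where "F = {f \<in> edges N. head f = node Q 0 j}"
  have ns: "node Q 0 j \<noteq> node Q (2 * m) i" using not_source[OF i j(1)] i j by auto
  have inner: "inner_response q j = (\<Sum>f\<in>F. current (edges N) (node Q 0 q) (- corner q) f * of_int (turn_sign (last_dir f) (corner j)))"
    if "q \<in> I" for q
  proof -
    have "q < n" using that I_subset by auto
    then have "node Q 0 j \<noteq> node Q 0 q" using node_eq j that by auto
    then show ?thesis by (simp add: inner_response_def vertex_current_def F_def)
  qed
  have "station i 0 j = (\<Sum>f\<in>F. cur i f * of_int (turn_sign (last_dir f) (corner j)))"
    using j by (simp add: station_def vcur_eq[OF ns] incoming_N_sink[OF j] F_def flow_def)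
  also have "\<dots> = (\<Sum>f\<in>F. \<Sum>q\<in>I. station i 0 q * current (edges N) (node Q 0 q) (- corner q) f * of_int (turn_sign (last_dir f) (corner j)))"
    by (rule sum.cong) (auto simp: F_def cur_inner[OF i] sum_distrib_right)
  also have "\<dots> = (\<Sum>q\<in>I. station i 0 q * inner_response q j)"
    by (subst sum.swap, rule sum.cong) (auto simp: inner sum_distrib_left mult.assoc)
  finally show ?thesis .
qed

lemma station_plain:
  assumes t: "t < m" and q: "q < n" "q \<notin> bridge_lines (xs ! t)" and i: "i \<in> I"
  shows "q \<notin> I \<Longrightarrow> station i (2 * t + 2) q = fps_const (diagonal_weight (xs ! t) q) * fps_X * station i (2 * t) q"
    and "q \<in> I \<Longrightarrow> station i (2 * t) q = fps_const (inverse (diagonal_weight (xs ! t) q)) * fps_X * station i (2 * t + 2) q"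
proof -
  assume qI: "q \<notin> I"
  have inc: "{f \<in> whole. head f = node Q (2 * t + 2) q} = {spoke Q I q (2 * t) (2 * t + 2) (diagonal_weight (xs ! t) q)}"
    using incoming_sink_line[OF t q(1) qI] q(2) by simp
  have ns: "node Q (2 * t + 2) q \<noteq> node Q (2 * m) i" using not_source[OF i q(1)] i qI by auto
  show "station i (2 * t + 2) q = fps_const (diagonal_weight (xs ! t) q) * fps_X * station i (2 * t) q"
    unfolding station_def by (subst vcur_single_spoke[OF inc ns _ q(1)]) (use qI in simp_all)
next
  assume qI: "q \<in> I"
  have inc: "{f \<in> whole. head f = node Q (2 * t) q} = {spoke Q I q (2 * t) (2 * t + 2) (diagonal_weight (xs ! t) q)}"
    using incoming_source_line[OF t q(1) qI] q(2) by simp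
  have ns: "node Q (2 * t) q \<noteq> node Q (2 * m) i" using not_source[OF i q(1)] t by auto
  show "station i (2 * t) q = fps_const (inverse (diagonal_weight (xs ! t) q)) * fps_X * station i (2 * t + 2) q"
    unfolding station_def by (subst vcur_single_spoke[OF inc ns _ q(1)]) (use qI in simp_all)
qed

lemma station_bridge_outer:
  assumes t: "t < m" and q: "q \<in> bridge_lines (xs ! t)" and i: "i \<in> I"
  shows "q \<notin> I \<Longrightarrow> station i (2 * t + 2) q = fps_X * station i (2 * t + 1) q"
    and "q \<in> I \<Longrightarrow> station i (2 * t) q = fps_X * station i (2 * t + 1) q"
proof -
  have qn: "q < n" using bridge_lines_less[OF elementary_nth[OF t] q] .
  {
    assume qI: "q \<notin> I"
    have inc: "{f \<in> whole. head f = node Q (2 * t + 2) q} = {spoke Q I q (2 * t + 1) (2 * t + 2) 1}"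
      using incoming_sink_line[OF t qn qI] q by (simp add: diagonal_weight_bridge)
    have ns: "node Q (2 * t + 2) q \<noteq> node Q (2 * m) i" using not_source[OF i qn] i qI by auto
    show "station i (2 * t + 2) q = fps_X * station i (2 * t + 1) q"
      unfolding station_def by (subst vcur_single_spoke[OF inc ns _ qn]) (use qI in simp_all)
  next
    assume qI: "q \<in> I"
    have inc: "{f \<in> whole. head f = node Q (2 * t) q} = {spoke Q I q (2 * t) (2 * t + 1) 1}"
      using incoming_source_line[OF t qn qI] q by (simp add: diagonal_weight_bridge)
    have ns: "node Q (2 * t) q \<noteq> node Q (2 * m) i" using not_source[OF i qn] t by auto
    show "station i (2 * t) q = fps_X * station i (2 * t + 1) q"
      unfolding station_def by (subst vcur_single_spoke[OF inc ns _ qn]) (use qI in simp_all)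
  }
qed

lemma odd_not_source: "i \<in> I \<Longrightarrow> q < n \<Longrightarrow> node Q (2 * t + 1) q \<noteq> node Q (2 * m) i"
  by (rule not_source) (simp_all, presburger)

lemma station_bridge_tail:
  assumes t: "t < m" and b: "bridge (xs ! t) = Some (a, h, l)" and i: "i \<in> I"
  shows "vcur i (node Q (2 * t + 1) a) c = fps_X * station i (if a \<in> I then 2 * t + 2 else 2 * t) a * of_int (turn_sign (flow a) c)"
proof -
  note B = bridge_elementary[OF elementary_nth[OF t] b]
  have a: "a \<in> bridge_lines (xs ! t)" using bridge_lines_Some[OF b] by simp
  have inc: "{f \<in> whole. head f = node Q (2 * t + 1) a} =
      {spoke Q I a (if a \<in> I then 2 * t + 1 else 2 * t) (if a \<in> I then 2 * t + 2 else 2 * t + 1) 1}"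
    unfolding incoming_middle[OF t a] using b B(3) by auto
  show ?thesis
    unfolding station_def by (subst vcur_single_spoke[OF inc odd_not_source[OF i B(1)] _ B(1)]) simp_all
qed

text \<open>Here the current of the line is joined by that of the additional edge. The sign of the
  latter is the product of the turn into the additional edge and the turn out of it.\<close>

lemma station_bridge_head:
  assumes t: "t < m" and b: "bridge (xs ! t) = Some (a, h, l)" and i: "i \<in> I"
  shows "station i (2 * t + 1) h = fps_X * station i (if h \<in> I then 2 * t + 2 else 2 * t) h +
    of_int ((if a = Suc h \<and> (a \<in> I) \<noteq> (h \<in> I) then - 1 else 1) * (gauge a * gauge h)) *
      (fps_const l * fps_X * station i (2 * t + 1) a)"
proof -
  note B = bridge_elementary[OF elementary_nth[OF t] b]
  have h: "h \<in> bridge_lines (xs ! t)" using bridge_lines_Some[OF b] by simp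
  define s where "s = spoke Q I h (if h \<in> I then 2 * t + 1 else 2 * t) (if h \<in> I then 2 * t + 2 else 2 * t + 1) (1 :: 'k)"
  define f where "f = ([node Q (2 * t + 1) a, node Q (2 * t + 1) h], l)"
  define d where "d = (1 + real (2 * t + 1) / 2) *\<^sub>R (corner h - corner a)"
  have rpos: "0 < 1 + real (2 * t + 1) / 2" by (simp add: add_pos_nonneg)
  have inc: "{f \<in> whole. head f = node Q (2 * t + 1) h} = {s, f}"
    unfolding incoming_middle[OF t h] using b by (auto simp: s_def f_def)
  have sf: "s \<noteq> f"
  proof
    assume "s = f"
    then have "tail s = node Q (2 * t + 1) a" by (simp add: f_def)
    then show False using B by (simp add: s_def tail_spoke node_eq)
  qed
  have mem: "s \<in> whole" "f \<in> whole" using inc by blast+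
  have df: "first_dir f = d" "last_dir f = d" using dirs_chord[OF B(1,2), of "2 * t + 1"] by (simp_all add: f_def d_def)
  have "cur i s * of_int (turn_sign (last_dir s) (flow h)) = fps_X * station i (if h \<in> I then 2 * t + 2 else 2 * t) h"
  proof -
    have lt: "(if h \<in> I then 2 * t + 1 else 2 * t) < (if h \<in> I then 2 * t + 2 else 2 * t + 1)" by simp
    obtain r where r: "r > 0" "last_dir s = r *\<^sub>R flow h" using spoke_dir(2)[OF s_def lt B(2)] by blast
    have "cur i s = fps_X * station i (if h \<in> I then 2 * t + 2 else 2 * t) h"
      using cur_spoke[OF mem(1)[unfolded s_def] lt B(2), of i, folded s_def] by (simp add: station_def)
    then show ?thesis by (simp add: r turn_sign_scaleR)
  qed
  moreover have "cur i f * of_int (turn_sign (last_dir f) (flow h)) =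
     of_int ((if a = Suc h \<and> (a \<in> I) \<noteq> (h \<in> I) then - 1 else 1) * (gauge a * gauge h)) *
      (fps_const l * fps_X * station i (2 * t + 1) a)"
  proof -
    have st: "station i (2 * t + 1) a = fps_X * station i (if a \<in> I then 2 * t + 2 else 2 * t) a"
      using station_bridge_tail[OF t b i, of "flow a"] by (simp add: station_def)
    have "cur i f = fps_const l * fps_X * vcur i (node Q (2 * t + 1) a) d"
      unfolding cur_eq[OF mem(2)] df by (simp add: f_def edge_factor_segment)
    also have "\<dots> = fps_const l * fps_X * station i (2 * t + 1) a * of_int (turn_sign (flow a) d)"
      unfolding station_bridge_tail[OF t b i, of d] st by (simp add: mult.assoc)
    finally have "cur i f * of_int (turn_sign (last_dir f) (flow h)) =
      of_int (turn_sign (flow a) d * turn_sign d (flow h)) * (fps_const l * fps_X * station i (2 * t + 1) a)"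
      unfolding df by (simp only: of_int_mult mult_ac)
    then show ?thesis unfolding d_def turn_sign_chord[OF B(4) rpos] .
  qed
  ultimately show ?thesis
    unfolding station_def vcur_eq[OF odd_not_source[OF i B(2)]] inc using sf by (simp add: station_def)
qed

end

section \<open>Matrices of currents\<close>

definition value_mat :: "'a::field fls Matrix.mat \<Rightarrow> 'a Matrix.mat \<Rightarrow> bool" where
  "value_mat M V \<longleftrightarrow> dim_row M = dim_row V \<and> dim_col M = dim_col V \<and>
     (\<forall>i<dim_row V. \<forall>j<dim_col V. has_value (M $$ (i, j)) (V $$ (i, j)))"

lemma value_matD: "value_mat M V \<Longrightarrow> i < dim_row V \<Longrightarrow> j < dim_col V \<Longrightarrow> has_value (M $$ (i, j)) (V $$ (i, j))"
  by (simp add: value_mat_def)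

lemma value_mat_mult:
  assumes M: "value_mat M V" and M': "value_mat M' V'" and d: "dim_col V = dim_row V'"
  shows "value_mat (M * M') (V * V')"
  unfolding value_mat_def
proof (intro conjI allI impI)
  fix i j assume ij: "i < dim_row (V * V')" "j < dim_col (V * V')"
  have dm: "dim_row M = dim_row V" "dim_col M = dim_col V" "dim_row M' = dim_row V'" "dim_col M' = dim_col V'"
    using M M' by (auto simp: value_mat_def)
  have "has_value (\<Sum>l\<in>{0..<dim_row V'}. M $$ (i, l) * M' $$ (l, j)) (\<Sum>l\<in>{0..<dim_row V'}. V $$ (i, l) * V' $$ (l, j))"
    using ij d by (intro has_value_sum has_value_mult value_matD[OF M] value_matD[OF M']) auto
  then show "has_value ((M * M') $$ (i, j)) ((V * V') $$ (i, j))"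
    using ij d dm by (simp add: scalar_prod_def)
qed (use M M' in \<open>simp_all add: value_mat_def\<close>)

lemma value_mat_unique:
  assumes "value_mat M V" "value_mat M V'"
  shows "V = V'"
  using assms has_value_unique unfolding value_mat_def by (intro eq_matI) (auto, blast)

lemma value_mat_one: "value_mat (1\<^sub>m n) (1\<^sub>m n)"
  by (auto simp: value_mat_def has_value_0 has_value_1)

lemma elementary_mat_carrier [simp]: "elementary_mat n x \<in> carrier_mat n n"
  by (cases x) auto

lemma product_mat_carrier [simp]: "product_mat n xs \<in> carrier_mat n n"
  unfolding product_mat_def by (induction xs) (simp_all add: mult_carrier_mat[OF elementary_mat_carrier])

lemma product_mat_snoc: "product_mat n (xs @ [x]) = product_mat n xs * elementary_mat n x"
proof -
  have "foldr (\<lambda>x M. elementary_mat n x * M) xs E = product_mat n xs * E" if "E \<in> carrier_mat n n" for E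
  proof (induction xs)
    case (Cons y ys)
    then show ?case using that assoc_mult_mat[OF elementary_mat_carrier product_mat_carrier that, of y ys]
      by (simp add: product_mat_def)
  qed (use that in \<open>simp add: product_mat_def\<close>)
  from this[of "elementary_mat n x"] show ?thesis
    by (simp add: product_mat_def right_mult_one_mat[OF elementary_mat_carrier])
qed

lemma elementary_mat_bridge:
  assumes "bridge x = Some (a, h, l)" "p < n" "q < n"
  shows "elementary_mat n x $$ (p, q) = (if p = q then 1 else 0) + (if p = a \<and> q = h then l else 0)"
  using assms by (cases x) auto

lemma elementary_mat_no_bridge:
  assumes "bridge x = None" "p < n" "q < n"
  shows "elementary_mat n x $$ (p, q) = (if p = q then diagonal_weight x q else 0)"
  using assms by (cases x) auto

text \<open>Conjugation by these signs gives an elementary matrix the signs of the transfer matrix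
  of its layer. They also split the exponent in \<open>Xbar\<close> into a row part and a column
  part.\<close>

definition rank_sign :: "nat set \<Rightarrow> nat \<Rightarrow> 'a::field" where
  "rank_sign I q = (- 1) ^ card (I \<inter> {..<q})"

definition sign_mat :: "nat \<Rightarrow> (nat \<Rightarrow> 'a::field) \<Rightarrow> 'a Matrix.mat" where
  "sign_mat n s = Matrix.mat n n (\<lambda>(p, q). if p = q then s q else 0)"

lemma rank_sign_square [simp]: "rank_sign I q * rank_sign I q = 1"
  by (simp add: rank_sign_def power_mult_distrib[symmetric])

lemma rank_sign_Suc: "rank_sign I (Suc q) = (if q \<in> I then - 1 else 1) * rank_sign I q"
proof -
  have "I \<inter> {..<Suc q} = (if q \<in> I then insert q (I \<inter> {..<q}) else I \<inter> {..<q})" by (auto simp: less_Suc_eq)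
  then show ?thesis by (simp add: rank_sign_def)
qed

lemma sign_mat_carrier [simp]: "sign_mat n s \<in> carrier_mat n n"
  by (simp add: sign_mat_def)

lemma mult_sign_mat:
  assumes "A \<in> carrier_mat k n" "i < k" "j < n"
  shows "(A * sign_mat n s) $$ (i, j) = A $$ (i, j) * s j"
proof -
  have "(A * sign_mat n s) $$ (i, j) = (\<Sum>l\<in>{0..<n}. A $$ (i, l) * (if l = j then s j else 0))"
    using assms by (simp add: scalar_prod_def sign_mat_def)
  also have "\<dots> = (\<Sum>l\<in>{0..<n}. if l = j then A $$ (i, l) * s j else 0)" by (intro sum.cong) auto
  finally show ?thesis using assms by simp
qed

lemma sign_mat_mult:
  assumes "A \<in> carrier_mat k n" "i < k" "j < n"
  shows "(sign_mat k s * A) $$ (i, j) = s i * A $$ (i, j)"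
proof -
  have "(sign_mat k s * A) $$ (i, j) = (\<Sum>l\<in>{0..<k}. (if i = l then s l else 0) * A $$ (l, j))"
    using assms by (simp add: scalar_prod_def sign_mat_def)
  also have "\<dots> = (\<Sum>l\<in>{0..<k}. if l = i then s i * A $$ (i, j) else 0)" by (intro sum.cong) auto
  finally show ?thesis using assms by simp
qed

lemma sign_mat_square:
  assumes "\<And>q. s q * s q = 1"
  shows "sign_mat n s * sign_mat n s = 1\<^sub>m n"
proof (rule eq_matI)
  fix i j assume ij: "i < dim_row (1\<^sub>m n)" "j < dim_col (1\<^sub>m n)"
  then have "(sign_mat n s * sign_mat n s) $$ (i, j) = sign_mat n s $$ (i, j) * s j"
    by (intro mult_sign_mat[OF sign_mat_carrier]) auto
  then show "(sign_mat n s * sign_mat n s) $$ (i, j) = 1\<^sub>m n $$ (i, j)"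
    using ij assms by (simp add: sign_mat_def)
qed (simp_all add: sign_mat_def)

context glued_network
begin

text \<open>The lines of the sources are traversed inwards, towards lower levels, which inverts the factors
  \<open>t\<close> of their segments.\<close>

definition growth :: "nat \<Rightarrow> 'k fls" where
  "growth q = (if q \<in> I then inverse fls_X else fls_X)"

text \<open>The first factor is the product of the two turn signs of the additional edge up to
  gauges, the second arises when the column signs \<open>flow_sign\<close> are split off.\<close>

definition bridge_sign :: "nat \<Rightarrow> nat \<Rightarrow> int" where
  "bridge_sign a h = (if a = Suc h \<and> (a \<in> I) \<noteq> (h \<in> I) then - 1 else 1) * (if a \<in> I then - 1 else 1)"

text \<open>A subdivided line has two segments in the layer, hence the square of
  \<open>growth\<close>. The entry off the diagonal follows a segment of line \<open>a\<close>, the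
  additional edge and a segment of line \<open>h\<close>.\<close>

definition transfer :: "'k elementary \<Rightarrow> 'k fls Matrix.mat" where
  "transfer x = Matrix.mat n n (\<lambda>(p, q). case bridge x of
     None \<Rightarrow> if p = q then fls_const (diagonal_weight x q) * growth q else 0
   | Some (a, h, l) \<Rightarrow>
       if p = q then (if q = a \<or> q = h then growth q * growth q else growth q)
       else if p = a \<and> q = h then of_int (bridge_sign a h) * fls_const l * growth h * fls_X * growth a
       else 0)"

lemma transfer_carrier [simp]: "transfer x \<in> carrier_mat n n"
  by (simp add: transfer_def)

lemma has_value_growth: "has_value (growth q) 1"
  by (simp add: growth_def has_value_X has_value_inverse_X)

text \<open>The ranks of two neighbouring lines differ exactly if the smaller one belongs to
  \<open>I\<close>. For \<open>a = Suc h\<close> the first factor of \<open>bridge_sign\<close>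
  exchanges \<open>a\<close> for \<open>h\<close> in this condition.\<close>

lemma rank_sign_bridge:
  assumes "h = Suc a \<or> a = Suc h"
  shows "rank_sign I a * rank_sign I h = (of_int (bridge_sign a h) :: 'k)"
  using assms
proof
  assume h: "h = Suc a"
  then show ?thesis by (simp add: rank_sign_Suc bridge_sign_def mult.left_commute)
next
  assume a: "a = Suc h"
  then show ?thesis by (auto simp: rank_sign_Suc bridge_sign_def mult.assoc)
qed

text \<open>All growth factors and the variable have the value \<open>1\<close>, so only the weights
  and the signs remain.\<close>

lemma value_transfer:
  assumes x: "is_elementary n x"
  shows "value_mat (transfer x) (sign_mat n (rank_sign I) * elementary_mat n x * sign_mat n (rank_sign I))"
  unfolding value_mat_def
proof (intro conjI allI impI)
  let ?V = "sign_mat n (rank_sign I) * elementary_mat n x * sign_mat n (rank_sign I)"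
  show "dim_row (transfer x) = dim_row ?V" "dim_col (transfer x) = dim_col ?V"
    by (simp_all add: transfer_def sign_mat_def)
  fix p q assume "p < dim_row ?V" "q < dim_col ?V"
  then have pq: "p < n" "q < n" by (auto simp: sign_mat_def)
  have V: "?V $$ (p, q) = rank_sign I p * elementary_mat n x $$ (p, q) * rank_sign I q"
    using mult_sign_mat[of "sign_mat n (rank_sign I) * elementary_mat n x" n n p q "rank_sign I"] pq
      sign_mat_mult[OF elementary_mat_carrier, of p n q "rank_sign I" x]
    by (metis elementary_mat_carrier mult_carrier_mat sign_mat_carrier)
  show "has_value (transfer x $$ (p, q)) (?V $$ (p, q))"
  proof (cases "bridge x")
    case None
    have "?V $$ (p, q) = (if p = q then diagonal_weight x q * 1 else 0)"
      unfolding V elementary_mat_no_bridge[OF None pq] by (simp add: mult.assoc mult.left_commute)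
    moreover have "transfer x $$ (p, q) = (if p = q then fls_const (diagonal_weight x q) * growth q else 0)"
      using pq None by (simp add: transfer_def)
    ultimately show ?thesis using has_value_mult[OF has_value_const has_value_growth, of "diagonal_weight x q" q]
      by (simp add: has_value_0)
  next
    case (Some b)
    obtain a h l where b: "bridge x = Some (a, h, l)" using Some by (metis prod_cases3)
    note B = bridge_elementary[OF x b]
    consider "p = q" | "p = a" "q = h" "p \<noteq> q" | "p \<noteq> q" "\<not> (p = a \<and> q = h)" by blast
    then show ?thesis
    proof cases
      case 1
      then have "?V $$ (p, q) = 1" unfolding V elementary_mat_bridge[OF b pq] using B by (auto simp: mult.assoc)
      moreover have "transfer x $$ (p, q) = (if q = a \<or> q = h then growth q * growth q else growth q)"
        using pq 1 b by (simp add: transfer_def)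
      ultimately show ?thesis using has_value_mult[OF has_value_growth has_value_growth, of q q]
        by (simp add: has_value_growth)
    next
      case 2
      have "?V $$ (p, q) = rank_sign I a * rank_sign I h * l * 1 * 1 * 1"
        unfolding V elementary_mat_bridge[OF b pq] using 2 by simp
      also have "\<dots> = of_int (bridge_sign a h) * l * 1 * 1 * 1" unfolding rank_sign_bridge[OF B(4)] ..
      finally have v: "?V $$ (p, q) = of_int (bridge_sign a h) * l * 1 * 1 * 1" .
      have "transfer x $$ (p, q) = of_int (bridge_sign a h) * fls_const l * growth h * fls_X * growth a"
        using pq 2 b by (simp add: transfer_def)
      then show ?thesis unfolding v
        by (simp only:) (intro has_value_mult has_value_of_int has_value_const has_value_growth has_value_X)
    next
      case 3
      then have "?V $$ (p, q) = 0" "transfer x $$ (p, q) = 0"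
        unfolding V elementary_mat_bridge[OF b pq] using pq b by (auto simp: transfer_def)
      then show ?thesis by (simp add: has_value_0)
    qed
  qed
qed

text \<open>Besides the gauge, source lines and sink lines get opposite signs: solving for the outer
  level on a source line moves the current of an additional edge to the other side of the
  equation.\<close>

definition flow_sign :: "nat \<Rightarrow> int" where
  "flow_sign q = (if q \<in> I then 1 else - 1) * gauge q"

lemma flow_sign_square [simp]: "flow_sign q * flow_sign q = 1"
  by (simp add: flow_sign_def)

definition level :: "nat \<Rightarrow> nat \<Rightarrow> nat \<Rightarrow> 'k fls" where
  "level i k q = fps_to_fls (station i k q)"

text \<open>On a source line the inner level is the inverse weight times \<open>t\<close> times the
  outer one. Solved for the outer level, the inversion of the weight caused by the reversal
  disappears, and both kinds of lines obey the same rule.\<close>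

lemma level_plain:
  assumes t: "t < m" and q: "q < n" "q \<notin> bridge_lines (xs ! t)" and i: "i \<in> I"
  shows "level i (2 * t + 2) q = fls_const (diagonal_weight (xs ! t) q) * growth q * level i (2 * t) q"
proof (cases "q \<in> I")
  case False
  then show ?thesis using station_plain(1)[OF t q i] by (simp add: level_def growth_def fls_times_fps_to_fls)
next
  case True
  define w where "w = diagonal_weight (xs ! t) q"
  have w: "w \<noteq> 0" using elementary_nth[OF t] q by (cases "xs ! t") (auto simp: w_def)
  have "level i (2 * t) q = fls_const (inverse w) * fls_X * level i (2 * t + 2) q"
    using station_plain(2)[OF t q i True] by (simp add: level_def w_def fls_times_fps_to_fls)
  then have "fls_const w * growth q * level i (2 * t) q =
    (fls_const w * fls_const (inverse w)) * (inverse fls_X * fls_X) * level i (2 * t + 2) q"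
    using True by (simp only: growth_def if_True mult_ac)
  also have "fls_const w * fls_const (inverse w) = 1" using w by (simp add: fls_const_mult_const)
  finally show ?thesis by (simp add: w_def)
qed

lemma level_bridge_outer:
  assumes t: "t < m" and q: "q \<in> bridge_lines (xs ! t)" and i: "i \<in> I"
  shows "q \<notin> I \<Longrightarrow> level i (2 * t + 2) q = fls_X * level i (2 * t + 1) q"
    and "q \<in> I \<Longrightarrow> level i (2 * t + 1) q = inverse fls_X * level i (2 * t) q"
proof -
  show "q \<notin> I \<Longrightarrow> level i (2 * t + 2) q = fls_X * level i (2 * t + 1) q"
    using station_bridge_outer(1)[OF t q i] by (simp add: level_def fls_times_fps_to_fls)
  assume "q \<in> I"
  then have "level i (2 * t) q = fls_X * level i (2 * t + 1) q"
    using station_bridge_outer(2)[OF t q i] by (simp add: level_def fls_times_fps_to_fls)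
  then show "level i (2 * t + 1) q = inverse fls_X * level i (2 * t) q"
    by (simp add: mult.assoc[symmetric])
qed

lemma level_bridge_tail:
  assumes t: "t < m" and b: "bridge (xs ! t) = Some (a, h, l)" and i: "i \<in> I"
  shows "level i (2 * t + 1) a = growth a * level i (2 * t) a"
    and "level i (2 * t + 2) a = growth a * growth a * level i (2 * t) a"
proof -
  have a: "a \<in> bridge_lines (xs ! t)" using bridge_lines_Some[OF b] by simp
  have "station i (2 * t + 1) a = fps_X * station i (if a \<in> I then 2 * t + 2 else 2 * t) a"
    using station_bridge_tail[OF t b i, of "flow a"] by (simp add: station_def)
  then have s: "level i (2 * t + 1) a = fls_X * level i (if a \<in> I then 2 * t + 2 else 2 * t) a"
    by (simp add: level_def fls_times_fps_to_fls)
  show 1: "level i (2 * t + 1) a = growth a * level i (2 * t) a"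
    using s level_bridge_outer(2)[OF t a i] by (simp add: growth_def)
  show "level i (2 * t + 2) a = growth a * growth a * level i (2 * t) a"
  proof (cases "a \<in> I")
    case True
    then have "level i (2 * t + 2) a = inverse fls_X * level i (2 * t + 1) a"
      using s by (simp add: mult.assoc[symmetric])
    then show ?thesis using 1 True by (simp add: growth_def mult.assoc)
  next
    case False
    then show ?thesis using level_bridge_outer(1)[OF t a i] 1 by (simp add: growth_def mult.assoc)
  qed
qed

text \<open>On a source line the current of the additional edge joins in the middle and flows
  inwards, so it is subtracted when the relation is solved for the outer level;
  \<open>flow_sign\<close> absorbs this difference between sources and sinks.\<close>

lemma level_bridge_head:
  assumes t: "t < m" and b: "bridge (xs ! t) = Some (a, h, l)" and i: "i \<in> I"
  shows "of_int (flow_sign h) * level i (2 * t + 2) h = of_int (flow_sign h) * level i (2 * t) h * (growth h * growth h) +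
    of_int (flow_sign a) * level i (2 * t) a * (of_int (bridge_sign a h) * fls_const l * growth h * fls_X * growth a)"
proof -
  have h: "h \<in> bridge_lines (xs ! t)" using bridge_lines_Some[OF b] by simp
  define e where "e = (if a = Suc h \<and> (a \<in> I) \<noteq> (h \<in> I) then - 1 else 1 :: int)"
  define E where "E = of_int (e * (gauge a * gauge h)) * (fls_const l * fls_X * level i (2 * t + 1) a)"
  have s: "level i (2 * t + 1) h = fls_X * level i (if h \<in> I then 2 * t + 2 else 2 * t) h + E"
    using station_bridge_head[OF t b i] unfolding e_def[symmetric]
    by (simp add: level_def fls_times_fps_to_fls E_def)
  have 1: "level i (2 * t + 2) h = growth h * growth h * level i (2 * t) h + of_int (if h \<in> I then - 1 else 1) * growth h * E"
  proof (cases "h \<in> I")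
    case True
    have "fls_X * level i (2 * t + 2) h = inverse fls_X * level i (2 * t) h - E"
      using s level_bridge_outer(2)[OF t h i] True by (simp add: eq_diff_eq)
    then have "inverse fls_X * (fls_X * level i (2 * t + 2) h) = inverse fls_X * (inverse fls_X * level i (2 * t) h - E)" by simp
    then show ?thesis using True by (simp add: growth_def mult.assoc[symmetric] right_diff_distrib)
  next
    case False
    then show ?thesis using s level_bridge_outer(1)[OF t h i] by (simp add: growth_def distrib_left mult.assoc)
  qed
  have E: "E = of_int (e * (gauge a * gauge h)) * (fls_const l * fls_X * (growth a * level i (2 * t) a))"
    unfolding E_def level_bridge_tail(1)[OF t b i] ..
  \<comment> \<open>The gauge of \<open>h\<close> occurs twice and cancels; both sides equal the
    turn factor \<open>e\<close> times \<open>- gauge a\<close>.\<close>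
  have sgn: "flow_sign h * (if h \<in> I then - 1 else 1) * (e * (gauge a * gauge h)) = flow_sign a * bridge_sign a h"
  proof -
    have "flow_sign h * (if h \<in> I then - 1 else 1) * (e * (gauge a * gauge h)) = - (e * gauge a) * (gauge h * gauge h)"
      by (simp add: flow_sign_def)
    moreover have "flow_sign a * bridge_sign a h = - (e * gauge a)"
      by (simp add: flow_sign_def bridge_sign_def e_def)
    ultimately show ?thesis by simp
  qed
  have "of_int (flow_sign h) * (of_int (if h \<in> I then - 1 else 1) * growth h * E) =
    of_int (flow_sign h * (if h \<in> I then - 1 else 1) * (e * (gauge a * gauge h))) * (fls_const l * fls_X * growth a * level i (2 * t) a * growth h)"
    unfolding E of_int_mult by (simp only: mult_ac)
  also have "\<dots> = of_int (flow_sign a) * level i (2 * t) a * (of_int (bridge_sign a h) * fls_const l * growth h * fls_X * growth a)"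
    unfolding sgn of_int_mult by (simp only: mult_ac)
  finally show ?thesis unfolding 1 by (simp add: distrib_left mult_ac)
qed

text \<open>The walks run outwards on some lines and inwards on others; only with the relations on
  source lines inverted is the outer vector of levels the inner one times a matrix.\<close>

lemma level_step:
  assumes t: "t < m" and q: "q < n" and i: "i \<in> I"
  shows "of_int (flow_sign q) * level i (2 * t + 2) q =
    (\<Sum>p\<in>{0..<n}. of_int (flow_sign p) * level i (2 * t) p * transfer (xs ! t) $$ (p, q))"
proof -
  define z where "z p = of_int (flow_sign p) * level i (2 * t) p" for p
  show ?thesis unfolding z_def[symmetric]
  proof (cases "bridge (xs ! t)")
    case None
    have nb: "q \<notin> bridge_lines (xs ! t)" using None by (simp add: bridge_lines_def)
    have "(\<Sum>p\<in>{0..<n}. z p * transfer (xs ! t) $$ (p, q)) =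
      (\<Sum>p\<in>{0..<n}. if p = q then z q * (fls_const (diagonal_weight (xs ! t) q) * growth q) else 0)"
      using q None by (intro sum.cong) (auto simp: transfer_def)
    also have "\<dots> = z q * (fls_const (diagonal_weight (xs ! t) q) * growth q)" using q by simp
    finally show "of_int (flow_sign q) * level i (2 * t + 2) q = (\<Sum>p\<in>{0..<n}. z p * transfer (xs ! t) $$ (p, q))"
      unfolding level_plain[OF t q nb i] z_def by (simp only: mult_ac)
  next
    case (Some b)
    obtain a h l where b: "bridge (xs ! t) = Some (a, h, l)" using Some by (metis prod_cases3)
    note B = bridge_elementary[OF elementary_nth[OF t] b]
    have lines: "bridge_lines (xs ! t) = {a, h}" using bridge_lines_Some[OF b] .
    show "of_int (flow_sign q) * level i (2 * t + 2) q = (\<Sum>p\<in>{0..<n}. z p * transfer (xs ! t) $$ (p, q))"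
    proof (cases "q = h")
      case False
      have "(\<Sum>p\<in>{0..<n}. z p * transfer (xs ! t) $$ (p, q)) =
        (\<Sum>p\<in>{0..<n}. if p = q then z q * (if q = a then growth q * growth q else growth q) else 0)"
        using q b False by (intro sum.cong) (auto simp: transfer_def)
      also have "\<dots> = z q * (if q = a then growth q * growth q else growth q)" using q by simp
      also have "\<dots> = of_int (flow_sign q) * level i (2 * t + 2) q"
      proof (cases "q = a")
        case True
        then show ?thesis using level_bridge_tail(2)[OF t b i] by (simp add: z_def mult_ac)
      next
        case qa: False
        then have "q \<notin> bridge_lines (xs ! t)" using lines False by simp
        from level_plain[OF t q this i] show ?thesis using qa b
          by (simp add: z_def mult_ac diagonal_weight_Some)
      qed
      finally show ?thesis by simp
    next
      case True
      define c where "c = of_int (bridge_sign a h) * fls_const l * growth h * fls_X * growth a"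
      have "(\<Sum>p\<in>{0..<n}. z p * transfer (xs ! t) $$ (p, q)) =
        (\<Sum>p\<in>{0..<n}. (if p = h then z h * (growth h * growth h) else 0) + (if p = a then z a * c else 0))"
        using q b True B(3) by (intro sum.cong) (auto simp: transfer_def c_def)
      also have "\<dots> = z h * (growth h * growth h) + z a * c" using B(1,2) by (simp add: sum.distrib)
      finally show ?thesis using level_bridge_head[OF t b i] True by (simp add: z_def c_def)
    qed
  qed
qed

end

section \<open>Row spaces, and elimination of the unknown factor\<close>

lemma same_Grassmannian_elementI:
  fixes X Y G S :: "'k::field Matrix.mat"
  assumes X: "X \<in> carrier_mat k n" and G: "G \<in> carrier_mat k k" and S: "S \<in> carrier_mat n k"
    and Y: "Y \<in> carrier_mat k n" "Y * S = 1\<^sub>m k" and GI: "invertible_mat G" and XG: "X = G * Y"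
  shows "same_Grassmannian_element k n Y X"
proof -
  interpret vec_space "TYPE('k)" n .
  have row: "row_space X = row_space Y" unfolding XG by (rule row_space_is_preserved[OF GI G Y(1)])
  have YT: "Y\<^sup>T \<in> carrier_mat n k" and ST: "S\<^sup>T \<in> carrier_mat k n" using Y S by auto
  \<comment> \<open>The right inverse \<open>S\<close> of \<open>Y\<close> gives a left inverse of
    the transpose, so the rows of \<open>Y\<close> are linearly independent. The same argument
    excludes equal rows, which independence of the set of rows would not detect.\<close>
  have STYT: "S\<^sup>T * Y\<^sup>T = 1\<^sub>m k" using transpose_mult[OF Y(1) S] Y(2) by simp
  have inj: "v = S\<^sup>T *\<^sub>v (Y\<^sup>T *\<^sub>v v)" if "v \<in> carrier_vec k" for v
    using assoc_mult_mat_vec[OF ST YT that] STYT that by simp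
  have dist: "distinct (cols Y\<^sup>T)"
    unfolding distinct_conv_nth
  proof (intro allI impI)
    fix i j assume ij: "i < length (cols Y\<^sup>T)" "j < length (cols Y\<^sup>T)" "i \<noteq> j"
    then have k: "i < k" "j < k" using YT by auto
    have c: "cols Y\<^sup>T ! i = Y\<^sup>T *\<^sub>v unit_vec k i" if "i < k" for i
      using that YT by (intro eq_vecI) auto
    show "cols Y\<^sup>T ! i \<noteq> cols Y\<^sup>T ! j"
    proof
      assume "cols Y\<^sup>T ! i = cols Y\<^sup>T ! j"
      then have "unit_vec k i = (unit_vec k j :: 'k vec)"
        using inj[of "unit_vec k i"] inj[of "unit_vec k j"] c k by simp
      then show False using k ij(3) by (metis index_unit_vec(1) zero_neq_one)
    qed
  qed
  have indpt: "lin_indpt (set (cols Y\<^sup>T))"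
  proof
    assume "lin_dep (set (cols Y\<^sup>T))"
    then obtain v where v: "v \<in> carrier_vec k" "v \<noteq> 0\<^sub>v k" "Y\<^sup>T *\<^sub>v v = 0\<^sub>v n"
      using lin_depE[OF YT _ dist] by blast
    then have "v = S\<^sup>T *\<^sub>v 0\<^sub>v n" using inj by metis
    also have "\<dots> = 0\<^sub>v k" using ST by (intro eq_vecI) auto
    finally show False using v(2) by simp
  qed
  have "row_space Y = span (set (cols Y\<^sup>T))" by (simp add: row_space_def)
  moreover have "set (cols Y\<^sup>T) \<subseteq> carrier V" using rows_carrier[of Y] Y(1) by simp
  moreover have "rank Y\<^sup>T = k" by (rule lin_indpt_full_rank[OF YT dist indpt])
  ultimately have "row_space Y \<in> Grassmannian k n"
    unfolding Grassmannian_def mem_Collect_eq rank_def using span_is_subspace by simp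
  then show ?thesis
    unfolding same_Grassmannian_element_def using row X Y(1) by auto
qed

lemma invertible_matI_left:
  fixes G H :: "'k::field Matrix.mat"
  assumes "G \<in> carrier_mat k k" "H \<in> carrier_mat k k" "G * H = 1\<^sub>m k"
  shows "invertible_mat G"
proof -
  have "H * G = 1\<^sub>m k" by (rule mat_mult_left_right_inverse[OF assms])
  then show ?thesis using assms unfolding invertible_mat_def inverts_mat_def by auto
qed

text \<open>The square matrix \<open>Z * S\<close> has \<open>C\<close> as a left inverse, hence
  also as a right inverse, and \<open>C\<close> drops out.\<close>

lemma eliminate_left_factor:
  fixes C :: "'k::field Matrix.mat"
  assumes C: "C \<in> carrier_mat k k" and Z: "Z \<in> carrier_mat k n" and S: "S \<in> carrier_mat n k"
    and CZ: "C * Z * S = 1\<^sub>m k"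
  shows "Z * S * (C * Z) = Z"
proof -
  have ZS: "Z * S \<in> carrier_mat k k" using Z S by simp
  have "C * (Z * S) = 1\<^sub>m k" using CZ assoc_mult_mat[OF C Z S] by simp
  then have "(Z * S) * C = 1\<^sub>m k" by (rule mat_mult_left_right_inverse[OF C ZS])
  then show ?thesis using assoc_mult_mat[OF ZS C Z] Z by simp
qed

context glued_network
begin

abbreviation "k \<equiv> card I"

definition source :: "nat \<Rightarrow> nat" where "source r = sorted_list_of_set I ! r"

lemma finite_I: "finite I"
  using I_subset finite_subset by blast

lemma source_in: "r < k \<Longrightarrow> source r \<in> I" and source_less: "r < k \<Longrightarrow> source r < n"
proof -
  show "source r \<in> I" if "r < k" for r
    using that nth_mem[of r "sorted_list_of_set I"] finite_I by (simp add: source_def)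
  then show "r < k \<Longrightarrow> source r < n" using I_subset by auto
qed

lemma source_mono: "r < s \<Longrightarrow> s < k \<Longrightarrow> source r < source s"
  using strict_sorted_list_of_set[of I] by (simp add: source_def sorted_wrt_nth_less)

lemma source_eq_iff: "r < k \<Longrightarrow> s < k \<Longrightarrow> source r = source s \<longleftrightarrow> r = s"
  using source_mono by (metis less_irrefl linorder_neqE_nat)

lemma source_bij: "bij_betw source {0..<k} I"
proof -
  have "source ` {0..<k} = I"
  proof (intro equalityI subsetI)
    fix i assume "i \<in> I"
    then have "i \<in> set (sorted_list_of_set I)" using finite_I by simp
    then obtain r where "r < k" "source r = i" by (auto simp: in_set_conv_nth source_def)
    then show "i \<in> source ` {0..<k}" by auto
  qed (auto simp: source_in)
  then show ?thesis using source_eq_iff by (auto simp: bij_betw_def inj_on_def)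
qed

lemma card_sources_less: "card (I \<inter> {..<q}) = card {r \<in> {0..<k}. source r < q}"
proof -
  have "I \<inter> {..<q} = source ` {r \<in> {0..<k}. source r < q}"
  proof (intro equalityI subsetI)
    fix i assume i: "i \<in> I \<inter> {..<q}"
    then have "i \<in> source ` {0..<k}" using bij_betw_imp_surj_on[OF source_bij] by blast
    then show "i \<in> source ` {r \<in> {0..<k}. source r < q}" using i by blast
  qed (use source_in in auto)
  moreover have "inj_on source {r \<in> {0..<k}. source r < q}"
    using bij_betw_imp_inj_on[OF source_bij] by (rule inj_on_subset) auto
  ultimately show ?thesis by (simp add: card_image)
qed

lemma card_less_source:
  assumes "s < k"
  shows "card (I \<inter> {..<source s}) = s"
proof -
  have "{r \<in> {0..<k}. source r < source s} = {0..<s}"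
    using source_mono[of _ s] source_mono[of s] assms by (auto; metis linorder_neqE_nat less_asym less_irrefl)
  then show ?thesis using card_sources_less[of "source s"] by simp
qed

lemma rank_sign_source: "s < k \<Longrightarrow> rank_sign I (source s) = (- 1) ^ s"
  by (simp add: rank_sign_def card_less_source)

text \<open>The signs of the rows do not affect the row space; together with those of the columns
  they make the columns in \<open>I\<close> of the last matrix an identity matrix.\<close>

definition level_mat :: "nat \<Rightarrow> 'k fls Matrix.mat" where
  "level_mat t = Matrix.mat k n (\<lambda>(r, q). of_int (flow_sign (source r)) * (of_int (flow_sign q) * level (source r) (2 * t) q))"

lemma level_mat_carrier [simp]: "level_mat t \<in> carrier_mat k n"
  by (simp add: level_mat_def)

lemma level_mat_Suc:
  assumes t: "t < m"
  shows "level_mat (Suc t) = level_mat t * transfer (xs ! t)"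
proof (rule eq_matI)
  fix r q assume "r < dim_row (level_mat t * transfer (xs ! t))" "q < dim_col (level_mat t * transfer (xs ! t))"
  then have rq: "r < k" "q < n" by (auto simp: level_mat_def transfer_def)
  have "level_mat (Suc t) $$ (r, q) = of_int (flow_sign (source r)) * (of_int (flow_sign q) * level (source r) (2 * t + 2) q)"
    using rq by (simp add: level_mat_def)
  also have "\<dots> = (\<Sum>p\<in>{0..<n}. level_mat t $$ (r, p) * transfer (xs ! t) $$ (p, q))"
    unfolding level_step[OF t rq(2) source_in[OF rq(1)]] sum_distrib_left
    using rq by (intro sum.cong) (simp_all add: level_mat_def mult.assoc)
  also have "\<dots> = (level_mat t * transfer (xs ! t)) $$ (r, q)"
    using rq carrier_matD[OF level_mat_carrier[of t]] carrier_matD[OF transfer_carrier[of "xs ! t"]]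
    by (simp add: scalar_prod_def)
  finally show "level_mat (Suc t) $$ (r, q) = (level_mat t * transfer (xs ! t)) $$ (r, q)" .
qed (simp_all add: level_mat_def transfer_def)

abbreviation "D \<equiv> sign_mat n (rank_sign I)"

lemma D_square: "D * D = 1\<^sub>m n"
  by (rule sign_mat_square) simp

text \<open>Only the two outermost sign matrices survive, since neighbouring layers meet in
  \<open>D * D\<close>.\<close>

lemma exists_transfer:
  "t \<le> m \<Longrightarrow> \<exists>P\<in>carrier_mat n n. level_mat t = level_mat 0 * P \<and> value_mat P (D * product_mat n (take t xs) * D)"
proof (induction t)
  case 0
  have "D * product_mat n (take 0 xs) * D = 1\<^sub>m n"
    using D_square by (simp add: product_mat_def right_mult_one_mat[OF sign_mat_carrier])
  then show ?case
    using value_mat_one right_mult_one_mat[OF level_mat_carrier] by (intro bexI[of _ "1\<^sub>m n"]) auto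
next
  case (Suc t)
  then obtain P where P: "P \<in> carrier_mat n n" "level_mat t = level_mat 0 * P" "value_mat P (D * product_mat n (take t xs) * D)"
    by auto
  have t: "t < m" using Suc.prems by simp
  define T where "T = product_mat n (take t xs)"
  define E where "E = elementary_mat n (xs ! t)"
  have c: "D \<in> carrier_mat n n" "T \<in> carrier_mat n n" "E \<in> carrier_mat n n" by (simp_all add: T_def E_def)
  have "level_mat (Suc t) = level_mat 0 * (P * transfer (xs ! t))"
    unfolding level_mat_Suc[OF t] P(2) by (rule assoc_mult_mat[OF level_mat_carrier P(1) transfer_carrier])
  moreover have "value_mat (P * transfer (xs ! t)) ((D * T * D) * (D * E * D))"
    using value_mat_mult[OF P(3) value_transfer[OF elementary_nth[OF t]]] by (simp add: T_def E_def sign_mat_def)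
  moreover have "(D * T * D) * (D * E * D) = D * (T * E) * D"
  proof -
    have DT: "D * T \<in> carrier_mat n n" and DE: "D * E \<in> carrier_mat n n" and ED: "E * D \<in> carrier_mat n n"
      by (meson c mult_carrier_mat)+
    have "(D * T * D) * (D * E * D) = (D * T) * (D * (D * E * D))"
    proof (rule assoc_mult_mat[OF DT c(1)])
      show "D * E * D \<in> carrier_mat n n" by (meson c mult_carrier_mat)
    qed
    also have "D * (D * E * D) = (D * D) * (E * D)"
      using assoc_mult_mat[OF c(1) c(1) ED] assoc_mult_mat[OF c(1) c(3) c(1)] by simp
    also have "\<dots> = E * D" unfolding D_square by (rule left_mult_one_mat[OF ED])
    also have "(D * T) * (E * D) = D * T * E * D" using assoc_mult_mat[OF DT c(3) c(1)] by simp
    also have "D * T * E = D * (T * E)" using assoc_mult_mat[OF c] .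
    finally show ?thesis .
  qed
  moreover have "T * E = product_mat n (take (Suc t) xs)"
    using t by (simp add: take_Suc_conv_app_nth product_mat_snoc T_def E_def)
  ultimately show ?case using P(1) by (intro bexI[of _ "P * transfer (xs ! t)"]) auto
qed

definition response_mat :: "(nat \<Rightarrow> nat \<Rightarrow> 'k fps) \<Rightarrow> 'k fls Matrix.mat" where
  "response_mat f = Matrix.mat k n (\<lambda>(s, q). if q \<in> I then (if q = source s then 1 else 0)
     else of_int (flow_sign (source s) * flow_sign q) * fps_to_fls (f (source s) q))"

definition source_columns :: "'b::zero_neq_one Matrix.mat" where
  "source_columns = Matrix.mat n k (\<lambda>(q, s). if q = source s then 1 else 0)"

lemma mult_source_columns:
  fixes X :: "'b::semiring_1 Matrix.mat"
  assumes "X \<in> carrier_mat k n" "r < k" "s < k"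
  shows "(X * source_columns) $$ (r, s) = X $$ (r, source s)"
proof -
  have "(X * source_columns) $$ (r, s) = (\<Sum>q\<in>{0..<n}. X $$ (r, q) * (if q = source s then 1 else 0))"
    using assms by (simp add: scalar_prod_def source_columns_def)
  also have "\<dots> = (\<Sum>q\<in>{0..<n}. if q = source s then X $$ (r, source s) else 0)"
    by (intro sum.cong) auto
  finally show ?thesis using source_less[OF assms(3)] by simp
qed

lemma source_columns_carrier [simp]: "source_columns \<in> carrier_mat n k"
  by (simp add: source_columns_def)

lemma level_mat_last: "level_mat m = response_mat total_response"
proof (rule eq_matI)
  fix r q assume "r < dim_row (response_mat total_response)" "q < dim_col (response_mat total_response)"
  then have rq: "r < k" "q < n" by (auto simp: response_mat_def)
  show "level_mat m $$ (r, q) = response_mat total_response $$ (r, q)"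
  proof (cases "q \<in> I")
    case True
    have "of_int (flow_sign p) * of_int (flow_sign p) = (1 :: 'k fls)" for p by (simp flip: of_int_mult)
    then show ?thesis using rq True station_source[OF source_in[OF rq(1)] True]
      by (simp add: level_mat_def response_mat_def level_def)
  next
    case False
    then show ?thesis using rq station_sink[OF False]
      by (simp add: level_mat_def response_mat_def level_def mult.assoc)
  qed
qed (simp_all add: level_mat_def response_mat_def)

text \<open>The factor \<open>C\<close> consists of the source columns of
  \<open>level_mat 0\<close>, the currents that enter \<open>N\<close>; those that leave it at its
  sinks depend on them linearly through the responses of \<open>N\<close>.\<close>

lemma level_mat_first: "\<exists>C\<in>carrier_mat k k. level_mat 0 = C * response_mat inner_response"
proof
  define C where "C = Matrix.mat k k (\<lambda>(r, s). of_int (flow_sign (source r)) * (of_int (flow_sign (source s)) * level (source r) 0 (source s)))"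
  show C: "C \<in> carrier_mat k k" by (simp add: C_def)
  show "level_mat 0 = C * response_mat inner_response"
  proof (rule eq_matI)
    fix r q assume "r < dim_row (C * response_mat inner_response)" "q < dim_col (C * response_mat inner_response)"
    then have rq: "r < k" "q < n" by (auto simp: C_def response_mat_def)
    have prod: "(C * response_mat inner_response) $$ (r, q) = (\<Sum>s\<in>{0..<k}. C $$ (r, s) * response_mat inner_response $$ (s, q))"
      using rq by (simp add: scalar_prod_def C_def response_mat_def)
    show "level_mat 0 $$ (r, q) = (C * response_mat inner_response) $$ (r, q)"
    proof (cases "q \<in> I")
      case True
      then obtain s0 where s0: "s0 < k" "source s0 = q" using bij_betw_imp_surj_on[OF source_bij] by force
      have "(\<Sum>s\<in>{0..<k}. C $$ (r, s) * response_mat inner_response $$ (s, q)) = (\<Sum>s\<in>{0..<k}. if s = s0 then C $$ (r, s0) else 0)"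
      proof (rule sum.cong[OF refl])
        fix s assume "s \<in> {0..<k}"
        then show "C $$ (r, s) * response_mat inner_response $$ (s, q) = (if s = s0 then C $$ (r, s0) else 0)"
          using rq True s0 source_eq_iff[of s s0] by (auto simp: response_mat_def)
      qed
      also have "\<dots> = C $$ (r, s0)" using s0 by simp
      finally show ?thesis unfolding prod using rq s0 by (simp add: C_def level_mat_def)
    next
      case False
      define e where "e = (of_int (flow_sign (source r)) * of_int (flow_sign q) :: 'k fls)"
      have "(\<Sum>s\<in>{0..<k}. C $$ (r, s) * response_mat inner_response $$ (s, q)) =
        (\<Sum>s\<in>{0..<k}. e * (level (source r) 0 (source s) * fps_to_fls (inner_response (source s) q)))"
      proof (rule sum.cong[OF refl])
        fix s assume "s \<in> {0..<k}"
        then have s: "s < k" by simp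
        have fs: "of_int (flow_sign (source s)) * of_int (flow_sign (source s)) = (1 :: 'k fls)" by (simp flip: of_int_mult)
        have "C $$ (r, s) * response_mat inner_response $$ (s, q) =
          (of_int (flow_sign (source s)) * of_int (flow_sign (source s))) * (e * (level (source r) 0 (source s) * fps_to_fls (inner_response (source s) q)))"
          using rq s False by (simp add: C_def response_mat_def e_def mult_ac)
        then show "C $$ (r, s) * response_mat inner_response $$ (s, q) = e * (level (source r) 0 (source s) * fps_to_fls (inner_response (source s) q))"
          unfolding fs by simp
      qed
      also have "\<dots> = e * (\<Sum>i\<in>I. level (source r) 0 i * fps_to_fls (inner_response i q))"
        unfolding sum_distrib_left by (rule sum.reindex_bij_betw[OF source_bij])
      also have "(\<Sum>i\<in>I. level (source r) 0 i * fps_to_fls (inner_response i q)) = fps_to_fls (\<Sum>i\<in>I. station (source r) 0 i * inner_response i q)"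
      proof -
        have "fps_to_fls (sum g J) = (\<Sum>i\<in>J. fps_to_fls (g i))" if "finite J" for g :: "nat \<Rightarrow> 'k fps" and J
          using that by (induction J rule: finite_induct) auto
        then show ?thesis using finite_I by (simp add: level_def fls_times_fps_to_fls)
      qed
      also have "\<dots> = level (source r) 0 q"
        unfolding level_def station_inner_sink[OF source_in[OF rq(1)] rq(2) False] ..
      finally show ?thesis unfolding prod using rq by (simp add: e_def level_mat_def mult.assoc)
    qed
  qed (simp_all add: level_mat_def C_def response_mat_def)
qed

abbreviation "alt \<equiv> sign_mat k (\<lambda>s. (- 1) ^ s)"

text \<open>Passing to rank signs leaves a sign \<open>c\<close> on the side of \<open>Xbar\<close>,
  and expressing the flow signs by \<open>boundary_sign\<close> leaves the same \<open>c\<close> on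
  the side of the series.\<close>

lemma value_response_mat:
  assumes M: "\<And>i j. i \<in> I \<Longrightarrow> j < n \<Longrightarrow> j \<notin> I \<Longrightarrow> has_value (fps_to_fls (of_int (boundary_sign i j) * f i j)) (measurement M i j)"
  shows "value_mat (response_mat f) (alt * Xbar n I M * D)"
  unfolding value_mat_def
proof (intro conjI allI impI)
  show "dim_row (response_mat f) = dim_row (alt * Xbar n I M * D)" "dim_col (response_mat f) = dim_col (alt * Xbar n I M * D)"
    by (simp_all add: response_mat_def sign_mat_def)
  fix s q assume "s < dim_row (alt * Xbar n I M * D)" "q < dim_col (alt * Xbar n I M * D)"
  then have sq: "s < k" "q < n" by (auto simp: sign_mat_def)
  define i where "i = source s"
  have i: "i \<in> I" using source_in sq by (simp add: i_def)
  have XC: "Xbar n I M \<in> carrier_mat k n" by (simp add: Xbar_def)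
  have "alt * Xbar n I M \<in> carrier_mat k n" using XC by (rule mult_carrier_mat[OF sign_mat_carrier])
  from mult_sign_mat[OF this sq]
  have V: "(alt * Xbar n I M * D) $$ (s, q) = (- 1) ^ s * Xbar n I M $$ (s, q) * rank_sign I q"
    unfolding sign_mat_mult[OF XC sq] .
  have X: "Xbar n I M $$ (s, q) = (if q \<in> I then (if q = i then 1 else 0)
     else (- 1) ^ card (I \<inter> {min i q<..<max i q}) * measurement M i q)"
    using sq by (simp add: Xbar_def i_def source_def Let_def)
  show "has_value (response_mat f $$ (s, q)) ((alt * Xbar n I M * D) $$ (s, q))"
  proof (cases "q \<in> I")
    case True
    have "(alt * Xbar n I M * D) $$ (s, q) = (if q = i then 1 else 0)"
    proof (cases "q = i")
      case True
      have "(- 1) ^ s * (- 1) ^ s = (1 :: 'k)" by (simp flip: power_mult_distrib)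
      then show ?thesis unfolding V X using True i by (simp add: i_def rank_sign_source[OF sq(1)])
    next
      case False
      then show ?thesis unfolding V X using \<open>q \<in> I\<close> by simp
    qed
    then show ?thesis using sq True by (simp add: response_mat_def i_def has_value_0 has_value_1)
  next
    case False
    define c where "c = (if q < i then 1 else - 1 :: int)"
    have "q \<noteq> i" using i False by auto
    \<comment> \<open>The elements of \<open>I\<close> below the larger label are those below the
      smaller one, those strictly between and, if \<open>i\<close> is the smaller label, also
      \<open>i\<close> itself; this extra element gives the sign \<open>c\<close>.\<close>
    have parity: "(- 1) ^ s * (- 1) ^ card (I \<inter> {min i q<..<max i q}) * rank_sign I q = (of_int c :: 'k)"
    proof (cases "q < i")
      case True
      have "I \<inter> {..<i} = (I \<inter> {..<q}) \<union> (I \<inter> {q<..<i})" using True False by (auto simp: not_less le_less)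
      then have "card (I \<inter> {..<i}) = card (I \<inter> {..<q}) + card (I \<inter> {q<..<i})"
        by (simp add: card_Un_disjoint finite_I disjoint_iff)
      then have s: "s = card (I \<inter> {..<q}) + card (I \<inter> {q<..<i})" using card_less_source[OF sq(1)] by (simp add: i_def)
      show ?thesis using True unfolding rank_sign_def
        by (subst s) (simp add: c_def power_add power_mult_distrib[symmetric] mult_ac)
    next
      case iq: False
      then have "i < q" using \<open>q \<noteq> i\<close> by simp
      have "I \<inter> {..<q} = insert i ((I \<inter> {..<i}) \<union> (I \<inter> {i<..<q}))" using \<open>i < q\<close> i by (auto simp: not_less le_less)
      then have "card (I \<inter> {..<q}) = Suc (card (I \<inter> {..<i}) + card (I \<inter> {i<..<q}))"
        by (simp add: card_Un_disjoint finite_I disjoint_iff)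
      then have r: "card (I \<inter> {..<q}) = Suc (s + card (I \<inter> {i<..<q}))" using card_less_source[OF sq(1)] by (simp add: i_def)
      show ?thesis using \<open>i < q\<close> unfolding rank_sign_def r
        by (simp add: c_def power_add power_mult_distrib[symmetric] mult_ac)
    qed
    have "(alt * Xbar n I M * D) $$ (s, q) = of_int c * measurement M i q"
      unfolding V X parity[symmetric] using False by (simp only: if_False mult_ac)
    moreover have "response_mat f $$ (s, q) = of_int c * fps_to_fls (of_int (boundary_sign i q) * f i q)"
    proof -
      have "flow_sign i * flow_sign q = c * boundary_sign i q"
        using i False by (simp add: flow_sign_def gauge_def boundary_sign_def c_def)
      then show ?thesis using sq False
        by (simp add: response_mat_def i_def[symmetric] fls_times_fps_to_fls mult.assoc)
    qed
    ultimately show ?thesis using has_value_mult[OF has_value_of_int M[OF i sq(2) False], of c] by simp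
  qed
qed

theorem same_element:
  assumes A: "A \<in> carrier_mat n n" "invertible_mat A" "product_mat n xs = A"
    and defined: "measurements_defined n I N" "measurements_defined n I (compose_net n I N xs)"
  shows "same_Grassmannian_element k n (Xbar n I (compose_net n I N xs)) (Xbar n I N * A)"
proof -
  define X where "X = Xbar n I N"
  define X' where "X' = Xbar n I (compose_net n I N xs)"
  define Y where "Y = response_mat inner_response"
  define Y' where "Y' = response_mat total_response"
  define S where "S = (source_columns :: 'k fls Matrix.mat)"
  define S0 where "S0 = (source_columns :: 'k Matrix.mat)"
  have carr: "X \<in> carrier_mat k n" "X' \<in> carrier_mat k n" "Y \<in> carrier_mat k n" "Y' \<in> carrier_mat k n"
    "S \<in> carrier_mat n k" "S0 \<in> carrier_mat n k" "D \<in> carrier_mat n n" "alt \<in> carrier_mat k k"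
    by (simp_all add: X_def X'_def Xbar_def Y_def Y'_def response_mat_def S_def S0_def)
  obtain P where P: "P \<in> carrier_mat n n" "level_mat m = level_mat 0 * P" "value_mat P (D * A * D)"
    using exists_transfer[of m] A(3) by auto
  obtain C where C: "C \<in> carrier_mat k k" "level_mat 0 = C * Y" using level_mat_first by (auto simp: Y_def)
  have Y'_eq: "Y' = C * (Y * P)"
    using P(2) unfolding C(2) level_mat_last Y'_def[symmetric] using assoc_mult_mat[OF C(1) carr(3) P(1)] by simp
  have YP: "Y * P \<in> carrier_mat k n" using carr P by simp
  have Y'S: "Y' * S = 1\<^sub>m k"
  proof (rule eq_matI)
    fix r s assume "r < dim_row (1\<^sub>m k :: 'k fls Matrix.mat)" "s < dim_col (1\<^sub>m k :: 'k fls Matrix.mat)"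
    then have rs: "r < k" "s < k" by auto
    show "(Y' * S) $$ (r, s) = 1\<^sub>m k $$ (r, s)"
      unfolding S_def mult_source_columns[OF carr(4) rs] using rs source_in[of s] source_less[of s] source_eq_iff[of s r]
      by (auto simp: Y'_def response_mat_def)
  qed (use carr in \<open>auto simp: Y'_def response_mat_def S_def source_columns_def\<close>)
  \<comment> \<open>Over the Laurent series \<open>C\<close> is eliminated with the help of the
    identity columns of \<open>Y'\<close>; all matrices that remain have values at
    \<open>1\<close>.\<close>
  have elim: "Y * P * S * Y' = Y * P"
    using eliminate_left_factor[OF C(1) YP carr(5)] Y'S unfolding Y'_eq by simp
  have XS: "X0 * S0 = 1\<^sub>m k" if X0: "X0 = Xbar n I M" for X0 :: "'k Matrix.mat" and M
  proof (rule eq_matI)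
    have c: "X0 \<in> carrier_mat k n" by (simp add: X0 Xbar_def)
    fix r s assume "r < dim_row (1\<^sub>m k :: 'k Matrix.mat)" "s < dim_col (1\<^sub>m k :: 'k Matrix.mat)"
    then have rs: "r < k" "s < k" by auto
    show "(X0 * S0) $$ (r, s) = 1\<^sub>m k $$ (r, s)"
      unfolding S0_def mult_source_columns[OF c rs] using rs source_in[of s] source_less[of s] source_eq_iff[of s r]
      by (auto simp: X0 Xbar_def source_def[symmetric] Let_def)
  qed (auto simp: X0 Xbar_def S0_def source_columns_def)
  have vY: "value_mat Y (alt * X * D)"
    unfolding Y_def X_def by (rule value_response_mat[OF has_value_inner[OF defined(1)]])
  have vY': "value_mat Y' (alt * X' * D)"
    unfolding Y'_def X'_def by (rule value_response_mat[OF has_value_total[OF defined(2)]])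
  have vS: "value_mat S S0"
    by (auto simp: value_mat_def S_def S0_def source_columns_def has_value_0 has_value_1)
  have DAD: "D * A * D \<in> carrier_mat n n" by (meson carr(7) A(1) mult_carrier_mat)
  have vYP: "value_mat (Y * P) (alt * X * D * (D * A * D))"
    by (rule value_mat_mult[OF vY P(3)]) (simp add: sign_mat_def)
  have aX: "alt * X \<in> carrier_mat k n" "alt * X' \<in> carrier_mat k n"
    by (meson carr mult_carrier_mat)+
  define W where "W = alt * X * A * D"
  have XA: "X * A \<in> carrier_mat k n" by (meson carr(1) A(1) mult_carrier_mat)
  have aXA: "alt * X * A \<in> carrier_mat k n" by (meson aX(1) A(1) mult_carrier_mat)
  have WC: "W \<in> carrier_mat k n" unfolding W_def by (meson aXA carr(7) mult_carrier_mat)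
  have W: "alt * X * D * (D * A * D) = W"
  proof -
    have AD: "A * D \<in> carrier_mat n n" by (meson carr(7) A(1) mult_carrier_mat)
    have "alt * X * D * (D * A * D) = alt * X * (D * (D * A * D))" using assoc_mult_mat[OF aX(1) carr(7) DAD] .
    also have "D * (D * A * D) = (D * D) * (A * D)"
      using assoc_mult_mat[OF carr(7) carr(7) AD] assoc_mult_mat[OF carr(7) A(1) carr(7)] by simp
    also have "\<dots> = A * D" unfolding D_square by (rule left_mult_one_mat[OF AD])
    finally show ?thesis using assoc_mult_mat[OF aX(1) A(1) carr(7)] by (simp add: W_def)
  qed
  have vl: "value_mat (Y * P * S * Y') (W * S0 * (alt * X' * D))"
    using WC by (intro value_mat_mult vYP[unfolded W] vS vY') (simp_all add: S0_def source_columns_def sign_mat_def)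
  \<comment> \<open>By the uniqueness of values the equation of series becomes an equation of
    matrices over the original field.\<close>
  have WE: "W * S0 * (alt * X' * D) = W"
    using value_mat_unique[OF vl] vYP unfolding elim W by simp
  \<comment> \<open>Up to signs, which cancel, these are the columns of \<open>X * A\<close> in
    \<open>I\<close>.\<close>
  define G where "G = alt * (W * S0 * alt)"
  have WS: "W * S0 \<in> carrier_mat k k" by (meson WC carr(6) mult_carrier_mat)
  then have WSa: "W * S0 * alt \<in> carrier_mat k k" by (meson carr(8) mult_carrier_mat)
  then have G: "G \<in> carrier_mat k k" unfolding G_def by (meson carr(8) mult_carrier_mat)
  have altalt: "alt * alt = 1\<^sub>m k" by (rule sign_mat_square) (simp flip: power_mult_distrib)
  have XAG: "X * A = G * X'"
  proof -
    have WD: "W * D = alt * (X * A)"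
    proof -
      have "W * D = alt * X * A * (D * D)"
        unfolding W_def by (rule assoc_mult_mat[OF aXA carr(7) carr(7)])
      also have "\<dots> = alt * X * A" unfolding D_square by (rule right_mult_one_mat[OF aXA])
      finally show ?thesis using assoc_mult_mat[OF carr(8) carr(1) A(1)] by simp
    qed
    have "W * D = W * S0 * (alt * X' * D) * D" using WE by simp
    also have "\<dots> = W * S0 * (alt * X' * D * D)"
      by (rule assoc_mult_mat[OF WS _ carr(7)]) (meson aX(2) carr(7) mult_carrier_mat)
    also have "alt * X' * D * D = alt * X' * (D * D)" using assoc_mult_mat[OF aX(2) carr(7) carr(7)] .
    also have "\<dots> = alt * X'" unfolding D_square by (rule right_mult_one_mat[OF aX(2)])
    also have "W * S0 * (alt * X') = W * S0 * alt * X'" using assoc_mult_mat[OF WS carr(8) carr(2)] by simp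
    finally have e: "alt * (X * A) = W * S0 * alt * X'" unfolding WD .
    have "X * A = alt * alt * (X * A)" unfolding altalt using left_mult_one_mat[OF XA] by simp
    also have "\<dots> = alt * (W * S0 * alt * X')" unfolding assoc_mult_mat[OF carr(8) carr(8) XA] e ..
    also have "\<dots> = G * X'" unfolding G_def by (rule assoc_mult_mat[OF carr(8) WSa carr(2), symmetric])
    finally show ?thesis .
  qed
  obtain B where B: "B \<in> carrier_mat n n" "A * B = 1\<^sub>m n"
  proof -
    obtain B where B: "A * B = 1\<^sub>m (dim_row A)" "B * A = 1\<^sub>m (dim_row B)"
      using A(2) unfolding invertible_mat_def inverts_mat_def by blast
    have "dim_row B = n" using arg_cong[OF B(2), of dim_col] A(1) by simp
    moreover have "dim_col B = n" using arg_cong[OF B(1), of dim_col] A(1) by simp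
    ultimately show thesis using that[of B] B(1) A(1) by auto
  qed
  \<comment> \<open>Since \<open>B\<close> undoes \<open>A\<close>, the product
    \<open>G * X' * B\<close> is \<open>X\<close>, whose columns in \<open>I\<close> form the
    identity matrix; this exhibits a right inverse of \<open>G\<close>.\<close>
  have "G * (X' * B * S0) = 1\<^sub>m k"
  proof -
    have X'B: "X' * B \<in> carrier_mat k n" using carr B by simp
    have "G * (X' * B * S0) = G * (X' * B) * S0" using assoc_mult_mat[OF G X'B carr(6)] by simp
    also have "G * (X' * B) = G * X' * B" using assoc_mult_mat[OF G carr(2) B(1)] by simp
    also have "\<dots> = X" unfolding XAG[symmetric] using assoc_mult_mat[OF carr(1) A(1) B(1)] B(2) carr(1) by simp
    finally show ?thesis using XS[OF X_def] by simp
  qed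
  then have "invertible_mat G" using G carr B by (intro invertible_matI_left[of G k "X' * B * S0"]) simp_all
  from same_Grassmannian_elementI[OF XA G carr(6) carr(2) XS[OF X'_def] this XAG]
  show ?thesis by (simp add: X_def X'_def)
qed

end

theorem lemma4p7:
  fixes N :: "'k::field network" and A :: "'k Matrix.mat" and xs :: "'k elementary list"
    and n :: nat and I :: "nat set"
  assumes N: "Net n I N"
    and A: "A \<in> carrier_mat n n" "invertible_mat A"
    and xs: "xs \<noteq> []" "\<forall>x\<in>set xs. is_elementary n x" "product_mat n xs = A"
    and defined: "measurements_defined n I N" "measurements_defined n I (compose_net n I N xs)"
  shows "same_Grassmannian_element (card I) n (Xbar n I (compose_net n I N xs)) (Xbar n I N * A)"
proof -
  interpret glued_network n I N xs by unfold_locales (fact N xs(1) xs(2))+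
  show ?thesis by (rule same_element[OF A assms(6) defined])
qed

end
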